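(* Let $n\ge2$ and consider a $D=2n+\varepsilon$ dimensional (off-shell, Euclidean signature) Kerr-NUT-(A)dS space with its metric $g$, Levi-Civita connection $\nabla$ and Darboux coframe $e^\mu,\hat e^\mu$ ($\mu=1,\dots,n$) and, if $\varepsilon=1$, $\hat e^0$. Let $\mathcal R_{abcd}$ be a Riemann-symmetric tensor field of totally zero weight, $$\mathcal R=\sum_{\mu<\nu}\left[\Omega_{\mu\nu}(h_\mu\odot h_\nu)+\alpha_{\mu\nu}(Q_\mu\odot Q_\nu)\right]+\sum_\mu\left[\tfrac12\Omega_{\mu\mu}(h_\mu\odot h_\mu)+\alpha^{(\epsilon)}_\mu(Q_\mu\odot Q_\epsilon)\right],$$ whose coefficients are parametrized, for $\mu\neq\nu$, by functions $d_1,\dots,d_n$ as $$\alpha_{\mu\nu}=\frac{x_\mu d_\mu-x_\nu d_\nu}{x_\mu^2-x_\nu^2}-\varepsilon\left(\frac{d_\mu}{x_\mu}+\frac{d_\nu}{x_\nu}\right),\qquad \Omega_{\mu\nu}=\frac{x_\mu d_\nu-x_\nu d_\mu}{x_\mu^2-x_\nu^2},\qquad \alpha^{(\epsilon)}_\mu=\varepsilon\frac{d_\mu}{x_\mu}.$$ Then the second Bianchi identity $\nabla_{[e}\mathcal R_{ab]cd}=0$ implies, for all $\mu\neq\nu$, $$\Omega_{\mu\mu}=-\tfrac13\,\partial_\mu d_\mu+\tfrac23\,\varepsilon\,\frac{d_\mu}{x_\mu},\qquad \partial_\mu d_\nu=-2\,\frac{x_\mu d_\nu-x_\nu d_\mu}{x_\mu^2-x_\nu^2},\qquad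 \partial_\mu=\frac{\partial}{\partial x_\mu}.$$
   Context: Greek indices run over $1,\dots,n$; repeated Greek indices are not summed unless a sum is written. $\varepsilon\in\{0,1\}$; when $\varepsilon=0$ the coefficients $\alpha^{(\epsilon)}_\mu$ are absent (set to $0$). All functions are smooth. Metric. In coordinates $x_1,\dots,x_n$ and $\psi_0,\dots,\psi_{n-1+\varepsilon}$, $$g=\sum_{\mu=1}^n\left[\frac{U_\mu}{X_\mu}dx_\mu^2+\frac{X_\mu}{U_\mu}\Big(\sum_{k=0}^{n-1}A^{(k)}_\mu d\psi_k\Big)^2\right]+\varepsilon\frac{c}{A^{(n)}}\Big(\sum_{k=0}^nA^{(k)}d\psi_k\Big)^2,$$ $$A^{(k)}=\sum_{\nu_1<\dots<\nu_k}x_{\nu_1}^2\cdots x_{\nu_k}^2,\quad A^{(k)}_\mu=\sum_{\nu_1<\dots<\nu_k,\ \nu_i\neq\mu}x_{\nu_1}^2\cdots x_{\nu_k}^2,\quad U_\mu=\prod_{\nu\neq\mu}(x_\nu^2-x_\mu^2),$$ where $c$ is a constant and each $X_\mu=X_\mu(x_\mu)$ is an arbitrary smooth function of the single variable $x_\mu$; the coordinates are restricted to a range where the expressions are defined and $g$ is positive definite. Darboux coframe (orthonormal): $e^\mu=\sqrt{U_\mu/X_\mu}\,dx_\mu$, $\hat e^\mu=\sqrt{X_\mu/U_\mu}\sum_{k=0}^{n-1}A^{(k)}_\mu d\psi_k$, and, for $\varepsilon=1$, $\hat e^0=\sqrt{c/A^{(n)}}\sum_{k=0}^nA^{(k)}d\psi_k$.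 Tensors. $h_\mu=e^\mu\otimes\hat e^\mu-\hat e^\mu\otimes e^\mu$, $Q_\mu=e^\mu\otimes e^\mu+\hat e^\mu\otimes\hat e^\mu$, $Q_\epsilon=\varepsilon g$. For antisymmetric $h,f$: $$(h\odot f)_{abcd}=\tfrac14h_{ab}f_{cd}+\tfrac14f_{ab}h_{cd}+\tfrac18h_{ac}f_{bd}+\tfrac18f_{ac}h_{bd}-\tfrac18h_{ad}f_{bc}-\tfrac18f_{ad}h_{bc};$$ for symmetric $Q,k$: $$(Q\odot k)_{abcd}=\tfrac18Q_{ad}k_{bc}+\tfrac18k_{ad}Q_{bc}-\tfrac18Q_{ac}k_{bd}-\tfrac18k_{ac}Q_{bd}.$$ A Riemann-symmetric tensor is a 4-tensor with $r_{abcd}=r_{[ab][cd]}=r_{cdab}$ and $r_{a[bcd]}=0$; those of totally zero weight (linear combinations of monomials in $e^{\pm\mu}=e^\mu\pm i\hat e^\mu$ and $\hat e^0$ with equally many $e^{+\mu}$ and $e^{-\mu}$ for each $\mu$) are exactly those of the form displayed in the claim. Note that $\mathcal R_{abcd}$ is not assumed to be the curvature of $g$, while $\nabla$ is the Levi-Civita connection of $g$. *)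

theory Defs
  imports "HOL-Analysis.Analysis"
begin

section \<open>Partial derivatives and smoothness\<close>

definition dir_deriv :: "'a::real_normed_vector \<Rightarrow> ('a \<Rightarrow> real) \<Rightarrow> 'a \<Rightarrow> real" where
  "dir_deriv v f p = deriv (\<lambda>t. f (p + t *\<^sub>R v)) 0"

definition partial :: "'i::finite \<Rightarrow> (real^'i \<Rightarrow> real) \<Rightarrow> real^'i \<Rightarrow> real" where
  "partial i = dir_deriv (axis i 1)"

text \<open>Intended for open sets only.\<close>

primrec Ck_on :: "nat \<Rightarrow> 'a::euclidean_space set \<Rightarrow> ('a \<Rightarrow> real) \<Rightarrow> bool" where
  "Ck_on 0 S f \<longleftrightarrow> continuous_on S f"
| "Ck_on (Suc k) S f \<longleftrightarrow>
     (\<forall>p\<in>S. f differentiable (at p)) \<and> (\<forall>b\<in>Basis. Ck_on k S (dir_deriv b f))"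

definition smooth_on :: "'a::euclidean_space set \<Rightarrow> ('a \<Rightarrow> real) \<Rightarrow> bool" where
  "smooth_on S f \<longleftrightarrow> (\<forall>k. Ck_on k S f)"


section \<open>Coordinates\<close>

text \<open>
  The Greek indices form the type \<open>'n\<close>, so \<open>n = CARD('n)\<close>, and the
  coordinates \<open>\<psi>\<close> are indexed by a linearly ordered type \<open>'m\<close> with
  \<open>CARD('m) = n + \<epsilon>\<close>; \<open>psi_no k\<close> is the number in \<open>0, \<dots>, n - 1 + \<epsilon>\<close> carried by \<open>k :: 'm\<close>.
  A point is the vector of all \<open>D = 2 n + \<epsilon>\<close> coordinates, and tensors on the coordinate
  patch are given by their components in the coordinate basis.
\<close>

type_synonym ('n, 'm) point = "real^('n + 'm)"
type_synonym 'i cov1 = "'i \<Rightarrow> real"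
type_synonym 'i cov2 = "'i \<Rightarrow> 'i \<Rightarrow> real"
type_synonym 'i cov4 = "'i \<Rightarrow> 'i \<Rightarrow> 'i \<Rightarrow> 'i \<Rightarrow> real"

definition xc :: "'n::finite \<Rightarrow> ('n, 'm::finite) point \<Rightarrow> real" where
  "xc \<mu> p = p $ Inl \<mu>"

definition psi_no :: "'m::{finite,linorder} \<Rightarrow> nat" where
  "psi_no k = card {j. j < k}"

definition dcoord :: "'i \<Rightarrow> 'i cov1" where
  "dcoord i a = (if a = i then 1 else 0)"

definition tensor2 :: "'i cov1 \<Rightarrow> 'i cov1 \<Rightarrow> 'i cov2" where
  "tensor2 u v a b = u a * v b"


section \<open>The off-shell Kerr-NUT-(A)dS metric and the Darboux coframe\<close>

definition A_fun :: "nat \<Rightarrow> ('n::finite, 'm::finite) point \<Rightarrow> real" where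
  "A_fun k p = (\<Sum>N | card N = k. \<Prod>\<nu>\<in>N. (xc \<nu> p)\<^sup>2)"

definition A_fun_at :: "'n \<Rightarrow> nat \<Rightarrow> ('n::finite, 'm::finite) point \<Rightarrow> real" where
  "A_fun_at \<mu> k p = (\<Sum>N | card N = k \<and> \<mu> \<notin> N. \<Prod>\<nu>\<in>N. (xc \<nu> p)\<^sup>2)"

definition U_fun :: "'n \<Rightarrow> ('n::finite, 'm::finite) point \<Rightarrow> real" where
  "U_fun \<mu> p = (\<Prod>\<nu>\<in>UNIV - {\<mu>}. (xc \<nu> p)\<^sup>2 - (xc \<mu> p)\<^sup>2)"

definition psi_form :: "'n \<Rightarrow> ('n::finite, 'm::{finite,linorder}) point \<Rightarrow> ('n + 'm) cov1" where
  "psi_form \<mu> p a =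
     (\<Sum>k | psi_no k < CARD('n). A_fun_at \<mu> (psi_no k) p * dcoord (Inr k :: 'n + 'm) a)"

definition psi_form0 :: "('n::finite, 'm::{finite,linorder}) point \<Rightarrow> ('n + 'm) cov1" where
  "psi_form0 p a =
     (\<Sum>k | psi_no k \<le> CARD('n). A_fun (psi_no k) p * dcoord (Inr k :: 'n + 'm) a)"

definition kerr_metric ::
  "nat \<Rightarrow> real \<Rightarrow> ('n \<Rightarrow> real \<Rightarrow> real) \<Rightarrow> ('n::finite, 'm::{finite,linorder}) point \<Rightarrow> ('n + 'm) cov2"
where
  "kerr_metric \<epsilon> c X p a b =
     (\<Sum>\<mu>\<in>UNIV. U_fun \<mu> p / X \<mu> (xc \<mu> p) * tensor2 (dcoord (Inl \<mu>)) (dcoord (Inl \<mu>)) a b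
              + X \<mu> (xc \<mu> p) / U_fun \<mu> p * tensor2 (psi_form \<mu> p) (psi_form \<mu> p) a b)
     + real \<epsilon> * (c / A_fun (CARD('n)) p) * tensor2 (psi_form0 p) (psi_form0 p) a b"

definition e_form ::
  "('n \<Rightarrow> real \<Rightarrow> real) \<Rightarrow> 'n \<Rightarrow> ('n::finite, 'm::{finite,linorder}) point \<Rightarrow> ('n + 'm) cov1" where
  "e_form X \<mu> p a = sqrt (U_fun \<mu> p / X \<mu> (xc \<mu> p)) * dcoord (Inl \<mu>) a"

definition eh_form ::
  "('n \<Rightarrow> real \<Rightarrow> real) \<Rightarrow> 'n \<Rightarrow> ('n::finite, 'm::{finite,linorder}) point \<Rightarrow> ('n + 'm) cov1" where
  "eh_form X \<mu> p a = sqrt (X \<mu> (xc \<mu> p) / U_fun \<mu> p) * psi_form \<mu> p a"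

definition eh0_form ::
  "real \<Rightarrow> ('n::finite, 'm::{finite,linorder}) point \<Rightarrow> ('n + 'm) cov1" where
  "eh0_form c p a = sqrt (c / A_fun (CARD('n)) p) * psi_form0 p a"

definition pos_def :: "('i::finite) cov2 \<Rightarrow> bool" where
  "pos_def g \<longleftrightarrow> (\<forall>v :: real^'i. v \<noteq> 0 \<longrightarrow> (\<Sum>a\<in>UNIV. \<Sum>b\<in>UNIV. g a b * v $ a * v $ b) > 0)"

definition admissible ::
  "nat \<Rightarrow> real \<Rightarrow> ('n \<Rightarrow> real \<Rightarrow> real) \<Rightarrow> ('n::finite, 'm::{finite,linorder}) point \<Rightarrow> bool" where
  "admissible \<epsilon> c X p \<longleftrightarrow>
     (\<forall>\<mu>. X \<mu> (xc \<mu> p) \<noteq> 0 \<and> U_fun \<mu> p \<noteq> 0) \<and> (\<epsilon> = 1 \<longrightarrow> A_fun (CARD('n)) p \<noteq> 0)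
     \<and> pos_def (kerr_metric \<epsilon> c X p)"


section \<open>The Levi-Civita connection and covariant derivatives\<close>

definition inv_metric :: "('i::finite) cov2 \<Rightarrow> 'i cov2" where
  "inv_metric g a b = matrix_inv (\<chi> i j. g i j) $ a $ b"

definition christoffel ::
  "(real^'i \<Rightarrow> 'i cov2) \<Rightarrow> real^'i::finite \<Rightarrow> 'i \<Rightarrow> 'i \<Rightarrow> 'i \<Rightarrow> real" where
  "christoffel g p f b c =
     1/2 * (\<Sum>d\<in>UNIV. inv_metric (g p) f d *
       (partial b (\<lambda>q. g q d c) p + partial c (\<lambda>q. g q d b) p - partial d (\<lambda>q. g q b c) p))"

text \<open>In \<open>nabla4 g R p e a b c d\<close> the derivative index \<open>e\<close> comes first.\<close>

definition nabla4 ::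
  "(real^'i \<Rightarrow> 'i cov2) \<Rightarrow> (real^'i \<Rightarrow> 'i cov4) \<Rightarrow> real^'i::finite \<Rightarrow> 'i \<Rightarrow> 'i cov4" where
  "nabla4 g R p e a b c d =
     partial e (\<lambda>q. R q a b c d) p
     - (\<Sum>f\<in>UNIV. christoffel g p f e a * R p f b c d + christoffel g p f e b * R p a f c d
                + christoffel g p f e c * R p a b f d + christoffel g p f e d * R p a b c f)"

definition alt2 :: "('i \<Rightarrow> 'i \<Rightarrow> real) \<Rightarrow> 'i \<Rightarrow> 'i \<Rightarrow> real" where
  "alt2 T a b = (T a b - T b a) / 2"

definition alt3 :: "('i \<Rightarrow> 'i \<Rightarrow> 'i \<Rightarrow> real) \<Rightarrow> 'i \<Rightarrow> 'i \<Rightarrow> 'i \<Rightarrow> real" where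
  "alt3 T a b c = (T a b c + T b c a + T c a b - T a c b - T c b a - T b a c) / 6"

definition second_bianchi ::
  "(real^'i \<Rightarrow> 'i cov2) \<Rightarrow> (real^'i \<Rightarrow> 'i cov4) \<Rightarrow> (real^'i::finite) set \<Rightarrow> bool" where
  "second_bianchi g R S \<longleftrightarrow>
     (\<forall>p\<in>S. \<forall>a b c d e. alt3 (\<lambda>e a b. nabla4 g R p e a b c d) e a b = 0)"


section \<open>Riemann-symmetric tensors of totally zero weight\<close>

definition riemann_symmetric :: "'i cov4 \<Rightarrow> bool" where
  "riemann_symmetric r \<longleftrightarrow>
     (\<forall>a b c d. r a b c d = alt2 (\<lambda>a b. alt2 (\<lambda>c d. r a b c d) c d) a b
              \<and> r a b c d = r c d a b
              \<and> alt3 (r a) b c d = 0)"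

definition odot_anti :: "'i cov2 \<Rightarrow> 'i cov2 \<Rightarrow> 'i cov4" where
  "odot_anti h f a b c d =
     1/4 * h a b * f c d + 1/4 * f a b * h c d
     + 1/8 * h a c * f b d + 1/8 * f a c * h b d
     - 1/8 * h a d * f b c - 1/8 * f a d * h b c"

definition odot_sym :: "'i cov2 \<Rightarrow> 'i cov2 \<Rightarrow> 'i cov4" where
  "odot_sym Q k a b c d =
     1/8 * Q a d * k b c + 1/8 * k a d * Q b c
     - 1/8 * Q a c * k b d - 1/8 * k a c * Q b d"

text \<open>
  Labels of the complex coframe: \<open>Some (\<mu>, s)\<close> stands for \<open>e_form + \<i> * eh_form\<close> if \<open>s\<close> holds and for
  \<open>e_form - \<i> * eh_form\<close> otherwise; \<open>None\<close> stands for \<open>eh0_form\<close>, which exists only for \<open>\<epsilon> = 1\<close>.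
\<close>

type_synonym 'n wlabel = "('n \<times> bool) option"

definition cframe ::
  "real \<Rightarrow> ('n \<Rightarrow> real \<Rightarrow> real) \<Rightarrow> ('n::finite, 'm::{finite,linorder}) point \<Rightarrow>
   'n wlabel \<Rightarrow> 'n + 'm \<Rightarrow> complex" where
  "cframe c X p w a = (case w of
       None \<Rightarrow> of_real (eh0_form c p a)
     | Some (\<mu>, s) \<Rightarrow> of_real (e_form X \<mu> p a)
                       + (if s then \<i> else - \<i>) * of_real (eh_form X \<mu> p a))"

inductive totally_zero_weight ::
  "nat \<Rightarrow> real \<Rightarrow> ('n \<Rightarrow> real \<Rightarrow> real) \<Rightarrow> ('n::finite, 'm::{finite,linorder}) point \<Rightarrow>
   ('n + 'm \<Rightarrow> 'n + 'm \<Rightarrow> 'n + 'm \<Rightarrow> 'n + 'm \<Rightarrow> complex) \<Rightarrow> bool"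
  for \<epsilon> :: nat and c :: real and X :: "'n \<Rightarrow> real \<Rightarrow> real" and p :: "('n, 'm) point"
where
  monomial:
    "(\<And>\<mu>. count_list [w1, w2, w3, w4] (Some (\<mu>, True)) = count_list [w1, w2, w3, w4] (Some (\<mu>, False)))
     \<Longrightarrow> (None \<in> {w1, w2, w3, w4} \<Longrightarrow> \<epsilon> = 1)
     \<Longrightarrow> totally_zero_weight \<epsilon> c X p
           (\<lambda>i j k l. cframe c X p w1 i * cframe c X p w2 j * cframe c X p w3 k * cframe c X p w4 l)"
| zero: "totally_zero_weight \<epsilon> c X p (\<lambda>i j k l. 0)"
| add: "totally_zero_weight \<epsilon> c X p r \<Longrightarrow> totally_zero_weight \<epsilon> c X p s \<Longrightarrow>
     totally_zero_weight \<epsilon> c X p (\<lambda>i j k l. r i j k l + s i j k l)"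
| scale: "totally_zero_weight \<epsilon> c X p r \<Longrightarrow> totally_zero_weight \<epsilon> c X p (\<lambda>i j k l. z * r i j k l)"

definition h_form ::
  "('n \<Rightarrow> real \<Rightarrow> real) \<Rightarrow> 'n \<Rightarrow> ('n::finite, 'm::{finite,linorder}) point \<Rightarrow> ('n + 'm) cov2" where
  "h_form X \<mu> p a b = tensor2 (e_form X \<mu> p) (eh_form X \<mu> p) a b - tensor2 (eh_form X \<mu> p) (e_form X \<mu> p) a b"

definition Q_form ::
  "('n \<Rightarrow> real \<Rightarrow> real) \<Rightarrow> 'n \<Rightarrow> ('n::finite, 'm::{finite,linorder}) point \<Rightarrow> ('n + 'm) cov2" where
  "Q_form X \<mu> p a b = tensor2 (e_form X \<mu> p) (e_form X \<mu> p) a b + tensor2 (eh_form X \<mu> p) (eh_form X \<mu> p) a b"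

definition Q_eps_form ::
  "nat \<Rightarrow> real \<Rightarrow> ('n \<Rightarrow> real \<Rightarrow> real) \<Rightarrow> ('n::finite, 'm::{finite,linorder}) point \<Rightarrow> ('n + 'm) cov2"
where
  "Q_eps_form \<epsilon> c X p a b = real \<epsilon> * kerr_metric \<epsilon> c X p a b"

definition zero_weight_tensor ::
  "nat \<Rightarrow> real \<Rightarrow> ('n \<Rightarrow> real \<Rightarrow> real) \<Rightarrow> ('n \<Rightarrow> 'n \<Rightarrow> ('n, 'm) point \<Rightarrow> real) \<Rightarrow>
   ('n \<Rightarrow> 'n \<Rightarrow> ('n, 'm) point \<Rightarrow> real) \<Rightarrow> ('n \<Rightarrow> ('n, 'm) point \<Rightarrow> real) \<Rightarrow>
   ('n::{finite,linorder}, 'm::{finite,linorder}) point \<Rightarrow> ('n + 'm) cov4" where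
  "zero_weight_tensor \<epsilon> c X \<Omega> \<alpha> \<alpha>\<epsilon> p a b c' d =
     (\<Sum>(\<mu>, \<nu>) \<in> {(\<mu>, \<nu>). \<mu> < \<nu>}.
         \<Omega> \<mu> \<nu> p * odot_anti (h_form X \<mu> p) (h_form X \<nu> p) a b c' d
       + \<alpha> \<mu> \<nu> p * odot_sym (Q_form X \<mu> p) (Q_form X \<nu> p) a b c' d)
     + (\<Sum>\<mu>\<in>UNIV.
         1/2 * \<Omega> \<mu> \<mu> p * odot_anti (h_form X \<mu> p) (h_form X \<mu> p) a b c' d
       + \<alpha>\<epsilon> \<mu> p * odot_sym (Q_form X \<mu> p) (Q_eps_form \<epsilon> c X p) a b c' d)"


section \<open>Consistency checks\<close>

text \<open>
  The last lemmas of this section show that the displayed form of a tensor already makes it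
  Riemann-symmetric and of totally zero weight, so that assuming these is no restriction.
\<close>

lemma bij_psi_no: "bij_betw (psi_no :: 'm::{finite,linorder} \<Rightarrow> nat) UNIV {..<CARD('m)}"
proof -
  have mono: "psi_no j < psi_no k" if "j < k" for j k :: 'm
    unfolding psi_no_def using that by (intro psubset_card_mono) auto
  then have inj: "inj (psi_no :: 'm \<Rightarrow> nat)"
    by (metis injI less_irrefl linorder_neqE)
  have "psi_no k < CARD('m)" for k :: 'm
    unfolding psi_no_def by (intro psubset_card_mono) auto
  then have sub: "range (psi_no :: 'm \<Rightarrow> nat) \<subseteq> {..<CARD('m)}" by auto
  have "card (range (psi_no :: 'm \<Rightarrow> nat)) = CARD('m)" using inj by (rule card_image)
  with sub have "range (psi_no :: 'm \<Rightarrow> nat) = {..<CARD('m)}"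
    by (intro card_subset_eq) auto
  with inj show ?thesis by (simp add: bij_betw_def)
qed

lemma kerr_metric_quadratic:
  "(\<Sum>a\<in>UNIV. \<Sum>b\<in>UNIV. kerr_metric \<epsilon> c X p a b * v $ a * v $ b) =
   (\<Sum>\<mu>\<in>UNIV. U_fun \<mu> p / X \<mu> (xc \<mu> p) * (v $ Inl \<mu>)\<^sup>2
       + X \<mu> (xc \<mu> p) / U_fun \<mu> p * (\<Sum>a\<in>UNIV. psi_form \<mu> p a * v $ a)\<^sup>2)
   + real \<epsilon> * (c / A_fun (CARD('n)) p) * (\<Sum>a\<in>UNIV. psi_form0 p a * v $ a)\<^sup>2"
  for v :: "real^('n::finite + 'm::{finite,linorder})"
proof -
  have sq: "(\<Sum>a\<in>UNIV. \<Sum>b\<in>UNIV. z * tensor2 u u a b * v $ a * v $ b)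
             = z * (\<Sum>a\<in>UNIV. u a * v $ a)\<^sup>2" for z and u :: "('n + 'm) cov1"
    by (simp add: tensor2_def power2_eq_square sum_product sum_distrib_left mult_ac)
  have ev: "(\<Sum>a\<in>UNIV. dcoord (Inl \<mu>) a * v $ a) = v $ Inl \<mu>" for \<mu>
    by (simp add: dcoord_def if_distrib[of "\<lambda>x. x * _"] cong: if_cong)
  have "(\<Sum>a\<in>UNIV. \<Sum>b\<in>UNIV. kerr_metric \<epsilon> c X p a b * v $ a * v $ b) =
    (\<Sum>a\<in>UNIV. \<Sum>b\<in>UNIV. \<Sum>\<mu>\<in>UNIV.
        U_fun \<mu> p / X \<mu> (xc \<mu> p) * tensor2 (dcoord (Inl \<mu>)) (dcoord (Inl \<mu>)) a b * v $ a * v $ b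
      + X \<mu> (xc \<mu> p) / U_fun \<mu> p * tensor2 (psi_form \<mu> p) (psi_form \<mu> p) a b * v $ a * v $ b)
    + (\<Sum>a\<in>UNIV. \<Sum>b\<in>UNIV. real \<epsilon> * (c / A_fun (CARD('n)) p)
          * tensor2 (psi_form0 p) (psi_form0 p) a b * v $ a * v $ b)"
    unfolding kerr_metric_def by (simp only: distrib_right sum_distrib_right sum.distrib)
  also have "(\<Sum>a\<in>UNIV. \<Sum>b\<in>UNIV. \<Sum>\<mu>\<in>UNIV.
        U_fun \<mu> p / X \<mu> (xc \<mu> p) * tensor2 (dcoord (Inl \<mu>)) (dcoord (Inl \<mu>)) a b * v $ a * v $ b
      + X \<mu> (xc \<mu> p) / U_fun \<mu> p * tensor2 (psi_form \<mu> p) (psi_form \<mu> p) a b * v $ a * v $ b)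
     = (\<Sum>\<mu>\<in>UNIV. \<Sum>a\<in>UNIV. \<Sum>b\<in>UNIV.
        U_fun \<mu> p / X \<mu> (xc \<mu> p) * tensor2 (dcoord (Inl \<mu>)) (dcoord (Inl \<mu>)) a b * v $ a * v $ b
      + X \<mu> (xc \<mu> p) / U_fun \<mu> p * tensor2 (psi_form \<mu> p) (psi_form \<mu> p) a b * v $ a * v $ b)"
    by (subst sum.swap[where A = "UNIV :: 'n set"])
       (rule sum.cong[OF refl], rule sum.swap)
  finally show ?thesis
    by (simp only: sum.distrib sq ev)
qed

lemma admissible_U_over_X:
  fixes p :: "('n::finite, 'm::{finite,linorder}) point"
  assumes "admissible \<epsilon> c X p"
  shows "U_fun \<mu> p / X \<mu> (xc \<mu> p) > 0"
proof -
  let ?v = "axis (Inl \<mu>) 1 :: real^('n + 'm)"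
  have z: "psi_form \<nu> p a * ?v $ a = 0" "psi_form0 p a * ?v $ a = 0" for \<nu> a
    by (auto simp: psi_form_def psi_form0_def dcoord_def axis_def)
  have "?v \<noteq> 0" by (simp add: axis_eq_0_iff)
  then have "0 < (\<Sum>a\<in>UNIV. \<Sum>b\<in>UNIV. kerr_metric \<epsilon> c X p a b * ?v $ a * ?v $ b)"
    using assms unfolding admissible_def pos_def_def by blast
  also have "\<dots> = (\<Sum>\<nu>\<in>UNIV. U_fun \<nu> p / X \<nu> (xc \<nu> p) * (?v $ Inl \<nu>)\<^sup>2)"
    unfolding kerr_metric_quadratic by (simp add: z)
  also have "\<dots> = (\<Sum>\<nu>\<in>UNIV. if \<nu> = \<mu> then U_fun \<mu> p / X \<mu> (xc \<mu> p) else 0)"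
    by (rule sum.cong) (auto simp: axis_def)
  finally show ?thesis by simp
qed

lemma admissible_c_over_A:
  fixes p :: "('n::finite, 'm::{finite,linorder}) point"
  assumes adm: "admissible \<epsilon> c X p" and eps: "\<epsilon> = 1" and card: "CARD('m) = CARD('n) + \<epsilon>"
  shows "c / A_fun (CARD('n)) p > 0"
proof -
  define L :: "real^('n + 'm) \<Rightarrow> real^('n + 'n)" where
    "L v = (\<chi> i. case i of Inl \<mu> \<Rightarrow> v $ Inl \<mu> | Inr \<mu> \<Rightarrow> (\<Sum>a\<in>UNIV. psi_form \<mu> p a * v $ a))" for v
  have lin: "linear L"
    by (rule linearI) (auto simp: L_def vec_eq_iff algebra_simps sum.distrib sum_distrib_left split: sum.splits)
  have "\<not> inj L"
  proof
    assume "inj L"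
    with lin have "dim (range L) = DIM(real^('n + 'm))"
      by (metis dim_UNIV dim_image_eq inj_on_subset span_UNIV subset_UNIV)
    moreover have "dim (range L) \<le> DIM(real^('n + 'n))" by (rule dim_subset_UNIV)
    ultimately show False using card eps by simp
  qed
  then obtain v where v: "v \<noteq> 0" "L v = 0"
    using linear_injective_0[OF lin] by blast
  have "0 < (\<Sum>a\<in>UNIV. \<Sum>b\<in>UNIV. kerr_metric \<epsilon> c X p a b * v $ a * v $ b)"
    using adm v unfolding admissible_def pos_def_def by blast
  also have "\<dots> = c / A_fun (CARD('n)) p * (\<Sum>a\<in>UNIV. psi_form0 p a * v $ a)\<^sup>2"
  proof -
    have "L v $ Inl \<mu> = 0" "L v $ Inr \<mu> = 0" for \<mu> using v by simp_all
    then have "v $ Inl \<mu> = 0" "(\<Sum>a\<in>UNIV. psi_form \<mu> p a * v $ a) = 0" for \<mu>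
      by (simp_all add: L_def)
    then show ?thesis unfolding kerr_metric_quadratic by (simp add: eps)
  qed
  finally show ?thesis by (metis mult_not_zero not_less_iff_gr_or_eq zero_le_power2 zero_less_mult_pos2 order_le_less)
qed

lemma kerr_metric_coframe:
  fixes p :: "('n::finite, 'm::{finite,linorder}) point"
  assumes adm: "admissible \<epsilon> c X p" and eps: "\<epsilon> \<in> {0, 1}" and card: "CARD('m) = CARD('n) + \<epsilon>"
  shows "kerr_metric \<epsilon> c X p a b =
    (\<Sum>\<mu>\<in>UNIV. Q_form X \<mu> p a b) + real \<epsilon> * tensor2 (eh0_form c p) (eh0_form c p) a b"
proof -
  have 1: "Q_form X \<mu> p a b = U_fun \<mu> p / X \<mu> (xc \<mu> p) * tensor2 (dcoord (Inl \<mu>)) (dcoord (Inl \<mu>)) a b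
       + X \<mu> (xc \<mu> p) / U_fun \<mu> p * tensor2 (psi_form \<mu> p) (psi_form \<mu> p) a b" for \<mu>
  proof -
    have s: "sqrt z * u * (sqrt z * w) = z * (u * w)" if "z > 0" for z u w :: real
      using that by (metis (no_types, lifting) mult.assoc mult.left_commute less_eq_real_def real_sqrt_mult_self abs_of_pos)
    have u: "U_fun \<mu> p / X \<mu> (xc \<mu> p) > 0" using adm by (rule admissible_U_over_X)
    then have "X \<mu> (xc \<mu> p) / U_fun \<mu> p > 0" by (auto simp: zero_less_divide_iff)
    then show ?thesis unfolding Q_form_def tensor2_def e_form_def eh_form_def by (simp only: s u)
  qed
  have 2: "real \<epsilon> * tensor2 (eh0_form c p) (eh0_form c p) a b
      = real \<epsilon> * (c / A_fun (CARD('n)) p) * tensor2 (psi_form0 p) (psi_form0 p) a b"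
  proof (cases "\<epsilon> = 1")
    case True
    then have "sqrt (c / A_fun (CARD('n)) p) * sqrt (c / A_fun (CARD('n)) p) = c / A_fun (CARD('n)) p"
      using admissible_c_over_A[OF adm _ card] by (metis True less_eq_real_def real_sqrt_mult_self abs_of_pos)
    then show ?thesis
      unfolding eh0_form_def tensor2_def True
      by (metis (no_types, lifting) mult.assoc mult.left_commute)
  qed (use eps in auto)
  show ?thesis unfolding 2 1 kerr_metric_def ..
qed

lemma riemann_symmetricI:
  assumes "\<And>a b c d. r b a c d = - r a b c d" "\<And>a b c d. r c d a b = r a b c d"
    "\<And>a b c d. r a b c d + r a c d b + r a d b c = 0"
  shows "riemann_symmetric r"
proof -
  have cd: "r a b d c = - r a b c d" for a b c d
    using assms(1)[of d c a b] assms(2)[of a b c d] assms(2)[of a b d c] by simp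
  show ?thesis
    unfolding riemann_symmetric_def
  proof (intro allI conjI)
    fix a b c d
    show "r a b c d = alt2 (\<lambda>a b. alt2 (\<lambda>c d. r a b c d) c d) a b"
      using cd[of a b c d] cd[of b a c d] assms(1)[of a b c d] unfolding alt2_def by simp
    show "r a b c d = r c d a b" using assms(2) by metis
    show "alt3 (r a) b c d = 0"
      using assms(3)[of a b c d] cd[of a c d b] cd[of a d b c] cd[of a b c d] unfolding alt3_def by simp
  qed
qed

lemma riemann_symmetric_zero_weight_tensor:
  fixes p :: "('n::{finite,linorder}, 'm::{finite,linorder}) point"
  shows "riemann_symmetric (zero_weight_tensor \<epsilon> c X \<Omega> \<alpha> \<alpha>\<epsilon> p)"
proof -
  have h: "h_form X \<mu> p b a = - h_form X \<mu> p a b" for \<mu> a b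
    by (simp add: h_form_def tensor2_def)
  have Q: "Q_form X \<mu> p b a = Q_form X \<mu> p a b" for \<mu> a b
    by (simp add: Q_form_def tensor2_def mult.commute)
  have g: "Q_eps_form \<epsilon> c X p b a = Q_eps_form \<epsilon> c X p a b" for a b
    by (simp add: Q_eps_form_def kerr_metric_def tensor2_def mult.commute)
  have oa: "odot_anti u w b a c d = - odot_anti u w a b c d"
    "odot_anti u w c d a b = odot_anti u w a b c d"
    "odot_anti u w a b c d + odot_anti u w a c d b + odot_anti u w a d b c = 0"
    if u: "\<And>a b. u b a = - u a b" and w: "\<And>a b. w b a = - w a b" for u w :: "('n + 'm) cov2" and a b c d
    unfolding odot_anti_def
    using u[of a b] u[of a c] u[of a d] u[of b c] u[of b d] u[of c d]
      w[of a b] w[of a c] w[of a d] w[of b c] w[of b d] w[of c d]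
    by (simp_all add: algebra_simps)
  have os: "odot_sym u w b a c d = - odot_sym u w a b c d"
    "odot_sym u w c d a b = odot_sym u w a b c d"
    "odot_sym u w a b c d + odot_sym u w a c d b + odot_sym u w a d b c = 0"
    if u: "\<And>a b. u b a = u a b" and w: "\<And>a b. w b a = w a b" for u w :: "('n + 'm) cov2" and a b c d
    unfolding odot_sym_def
    using u[of a b] u[of a c] u[of a d] u[of b c] u[of b d] u[of c d]
      w[of a b] w[of a c] w[of a d] w[of b c] w[of b d] w[of c d]
    by (simp_all add: algebra_simps)
  have hh: "odot_anti (h_form X \<mu> p) (h_form X \<nu> p) b a k l = - odot_anti (h_form X \<mu> p) (h_form X \<nu> p) a b k l"
    "odot_anti (h_form X \<mu> p) (h_form X \<nu> p) k l a b = odot_anti (h_form X \<mu> p) (h_form X \<nu> p) a b k l"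
    "odot_anti (h_form X \<mu> p) (h_form X \<nu> p) a b k l + odot_anti (h_form X \<mu> p) (h_form X \<nu> p) a k l b + odot_anti (h_form X \<mu> p) (h_form X \<nu> p) a l b k = 0"
    for a b k l \<mu> \<nu> by (rule oa[OF h h])+
  have QQ: "odot_sym (Q_form X \<mu> p) (Q_form X \<nu> p) b a k l = - odot_sym (Q_form X \<mu> p) (Q_form X \<nu> p) a b k l"
    "odot_sym (Q_form X \<mu> p) (Q_form X \<nu> p) k l a b = odot_sym (Q_form X \<mu> p) (Q_form X \<nu> p) a b k l"
    "odot_sym (Q_form X \<mu> p) (Q_form X \<nu> p) a b k l + odot_sym (Q_form X \<mu> p) (Q_form X \<nu> p) a k l b + odot_sym (Q_form X \<mu> p) (Q_form X \<nu> p) a l b k = 0"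
    for a b k l \<mu> \<nu> by (rule os[OF Q Q])+
  have Qg: "odot_sym (Q_form X \<mu> p) (Q_eps_form \<epsilon> c X p) b a k l = - odot_sym (Q_form X \<mu> p) (Q_eps_form \<epsilon> c X p) a b k l"
    "odot_sym (Q_form X \<mu> p) (Q_eps_form \<epsilon> c X p) k l a b = odot_sym (Q_form X \<mu> p) (Q_eps_form \<epsilon> c X p) a b k l"
    "odot_sym (Q_form X \<mu> p) (Q_eps_form \<epsilon> c X p) a b k l + odot_sym (Q_form X \<mu> p) (Q_eps_form \<epsilon> c X p) a k l b + odot_sym (Q_form X \<mu> p) (Q_eps_form \<epsilon> c X p) a l b k = 0"
    for a b k l \<mu> by (rule os[OF Q g])+
  show ?thesis
  proof (rule riemann_symmetricI)
    fix i j k l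
    show "zero_weight_tensor \<epsilon> c X \<Omega> \<alpha> \<alpha>\<epsilon> p j i k l = - zero_weight_tensor \<epsilon> c X \<Omega> \<alpha> \<alpha>\<epsilon> p i j k l"
      unfolding zero_weight_tensor_def hh(1)[where a=i and b=j and k=k and l=l] QQ(1)[where a=i and b=j and k=k and l=l] Qg(1)[where a=i and b=j and k=k and l=l]
      by (simp add: sum_negf[symmetric] split_def)
    show "zero_weight_tensor \<epsilon> c X \<Omega> \<alpha> \<alpha>\<epsilon> p k l i j = zero_weight_tensor \<epsilon> c X \<Omega> \<alpha> \<alpha>\<epsilon> p i j k l"
      unfolding zero_weight_tensor_def hh(2)[where a=i and b=j and k=k and l=l] QQ(2)[where a=i and b=j and k=k and l=l] Qg(2)[where a=i and b=j and k=k and l=l] ..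
    have "zero_weight_tensor \<epsilon> c X \<Omega> \<alpha> \<alpha>\<epsilon> p i j k l + zero_weight_tensor \<epsilon> c X \<Omega> \<alpha> \<alpha>\<epsilon> p i k l j
        + zero_weight_tensor \<epsilon> c X \<Omega> \<alpha> \<alpha>\<epsilon> p i l j k =
      (\<Sum>(\<mu>, \<nu>) \<in> {(\<mu>, \<nu>). \<mu> < \<nu>}.
         \<Omega> \<mu> \<nu> p * (odot_anti (h_form X \<mu> p) (h_form X \<nu> p) i j k l
            + odot_anti (h_form X \<mu> p) (h_form X \<nu> p) i k l j + odot_anti (h_form X \<mu> p) (h_form X \<nu> p) i l j k)
       + \<alpha> \<mu> \<nu> p * (odot_sym (Q_form X \<mu> p) (Q_form X \<nu> p) i j k l
            + odot_sym (Q_form X \<mu> p) (Q_form X \<nu> p) i k l j + odot_sym (Q_form X \<mu> p) (Q_form X \<nu> p) i l j k))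
     + (\<Sum>\<mu>\<in>UNIV.
         1/2 * \<Omega> \<mu> \<mu> p * (odot_anti (h_form X \<mu> p) (h_form X \<mu> p) i j k l
            + odot_anti (h_form X \<mu> p) (h_form X \<mu> p) i k l j + odot_anti (h_form X \<mu> p) (h_form X \<mu> p) i l j k)
       + \<alpha>\<epsilon> \<mu> p * (odot_sym (Q_form X \<mu> p) (Q_eps_form \<epsilon> c X p) i j k l
            + odot_sym (Q_form X \<mu> p) (Q_eps_form \<epsilon> c X p) i k l j + odot_sym (Q_form X \<mu> p) (Q_eps_form \<epsilon> c X p) i l j k))"
      unfolding zero_weight_tensor_def by (simp add: sum.distrib split_def distrib_left)
    also have "\<dots> = 0" by (simp add: hh(3) QQ(3) Qg(3))
    finally show "zero_weight_tensor \<epsilon> c X \<Omega> \<alpha> \<alpha>\<epsilon> p i j k l + zero_weight_tensor \<epsilon> c X \<Omega> \<alpha> \<alpha>\<epsilon> p i k l j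
        + zero_weight_tensor \<epsilon> c X \<Omega> \<alpha> \<alpha>\<epsilon> p i l j k = 0" .
  qed
qed

lemma totally_zero_weight_sum:
  assumes "finite I" "\<And>i. i \<in> I \<Longrightarrow> totally_zero_weight \<epsilon> c X p (r i)"
  shows "totally_zero_weight \<epsilon> c X p (\<lambda>j k l m. \<Sum>i\<in>I. r i j k l m)"
  using assms by (induction rule: finite_induct) (auto intro: totally_zero_weight.intros)

lemma totally_zero_weight_zero_weight_tensor:
  fixes p :: "('n::{finite,linorder}, 'm::{finite,linorder}) point"
  assumes adm: "admissible \<epsilon> c X p" and eps: "\<epsilon> \<in> {0, 1}" and card: "CARD('m) = CARD('n) + \<epsilon>"
  shows "totally_zero_weight \<epsilon> c X p
    (\<lambda>i j k l. complex_of_real (zero_weight_tensor \<epsilon> c X \<Omega> \<alpha> \<alpha>\<epsilon> p i j k l))"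
proof -
  let ?Z = "totally_zero_weight \<epsilon> c X p"
  \<comment> \<open>pairs of labels whose product has zero weight\<close>
  define W :: "('n wlabel \<times> 'n wlabel) set" where
    "W = {(Some (\<mu>, s), Some (\<mu>, \<not> s)) | \<mu> s. True} \<union> (if \<epsilon> = 1 then {(None, None)} else {})"
  let ?C = "\<lambda>w. cframe c X p w"
  define Z2 where "Z2 f \<longleftrightarrow> (\<exists>z. \<forall>i j. complex_of_real (f i j)
     = (\<Sum>w\<in>W. z w * (?C (fst w) i * ?C (snd w) j)))" for f :: "('n + 'm) cov2"
  have mon: "?Z (\<lambda>i j k l. ?C (fst w) i * ?C (snd w) j * ?C (fst w') k * ?C (snd w') l)"
       "?Z (\<lambda>i j k l. ?C (fst w) i * ?C (fst w') j * ?C (snd w) k * ?C (snd w') l)"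
       "?Z (\<lambda>i j k l. ?C (fst w) i * ?C (fst w') j * ?C (snd w') k * ?C (snd w) l)"
    if "w \<in> W" "w' \<in> W" for w w'
    using that by (auto intro!: totally_zero_weight.monomial simp: W_def split: if_splits)
  have fin: "finite W" by simp
  have exp: "complex_of_real (f i j * f' k l) =
      (\<Sum>w\<in>W. \<Sum>w'\<in>W. z w * z' w' * (?C (fst w) i * ?C (snd w) j * ?C (fst w') k * ?C (snd w') l))"
    if "\<forall>i j. complex_of_real (f i j) = (\<Sum>w\<in>W. z w * (?C (fst w) i * ?C (snd w) j))"
       "\<forall>i j. complex_of_real (f' i j) = (\<Sum>w\<in>W. z' w * (?C (fst w) i * ?C (snd w) j))"
    for f f' z z' i j k l
    unfolding of_real_mult that(1)[rule_format] that(2)[rule_format] sum_product by (simp add: mult_ac)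
  have prod: "?Z (\<lambda>i j k l. complex_of_real (f i j * f' k l))"
      "?Z (\<lambda>i j k l. complex_of_real (f i k * f' j l))"
      "?Z (\<lambda>i j k l. complex_of_real (f i l * f' j k))"
    if Z: "Z2 f" "Z2 f'" for f f'
  proof -
    obtain z where z: "\<forall>i j. complex_of_real (f i j) = (\<Sum>w\<in>W. z w * (?C (fst w) i * ?C (snd w) j))"
      using Z unfolding Z2_def by blast
    obtain z' where z': "\<forall>i j. complex_of_real (f' i j) = (\<Sum>w\<in>W. z' w * (?C (fst w) i * ?C (snd w) j))"
      using Z unfolding Z2_def by blast
    note e = exp[OF z z']
    show "?Z (\<lambda>i j k l. complex_of_real (f i j * f' k l))"
      unfolding e by (intro totally_zero_weight_sum fin totally_zero_weight.scale mon)
    have "?Z (\<lambda>i j k l. \<Sum>w\<in>W. \<Sum>w'\<in>W. z w * z' w' * (?C (fst w) i * ?C (fst w') j * ?C (snd w) k * ?C (snd w') l))"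
      by (intro totally_zero_weight_sum fin totally_zero_weight.scale mon)
    then show "?Z (\<lambda>i j k l. complex_of_real (f i k * f' j l))"
      unfolding e by (simp add: mult_ac)
    have "?Z (\<lambda>i j k l. \<Sum>w\<in>W. \<Sum>w'\<in>W. z w * z' w' * (?C (fst w) i * ?C (fst w') j * ?C (snd w') k * ?C (snd w) l))"
      by (intro totally_zero_weight_sum fin totally_zero_weight.scale mon)
    then show "?Z (\<lambda>i j k l. complex_of_real (f i l * f' j k))"
      unfolding e by (simp add: mult_ac)
  qed
  have sc: "?Z (\<lambda>i j k l. complex_of_real (z * r i j k l))"
    if "?Z (\<lambda>i j k l. complex_of_real (r i j k l))" for z and r :: "('n + 'm) cov4"
    using totally_zero_weight.scale[OF that, of "complex_of_real z"] by simp
  have ad: "?Z (\<lambda>i j k l. complex_of_real (r i j k l + s i j k l))"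
    if "?Z (\<lambda>i j k l. complex_of_real (r i j k l))" "?Z (\<lambda>i j k l. complex_of_real (s i j k l))"
    for r s :: "('n + 'm) cov4"
    using totally_zero_weight.add[OF that] by simp
  have su: "?Z (\<lambda>i j k l. complex_of_real (\<Sum>x\<in>I. r x i j k l))"
    if "finite I" "\<And>x. x \<in> I \<Longrightarrow> ?Z (\<lambda>i j k l. complex_of_real (r x i j k l))"
    for I :: "'b set" and r :: "'b \<Rightarrow> ('n + 'm) cov4"
    using totally_zero_weight_sum[OF that, of "\<lambda>x. x"] by simp
  have oa: "?Z (\<lambda>i j k l. complex_of_real (odot_anti f f' i j k l))" if "Z2 f" "Z2 f'" for f f'
  proof -
    have eq: "odot_anti f f' = (\<lambda>i j k l. 1/4 * (f i j * f' k l) + 1/4 * (f' i j * f k l)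
       + 1/8 * (f i k * f' j l) + 1/8 * (f' i k * f j l)
       + (-1/8) * (f i l * f' j k) + (-1/8) * (f' i l * f j k))"
      by (intro ext) (simp add: odot_anti_def)
    show ?thesis unfolding eq by (intro ad sc prod that)
  qed
  have os: "?Z (\<lambda>i j k l. complex_of_real (odot_sym f f' i j k l))" if "Z2 f" "Z2 f'" for f f'
  proof -
    have eq: "odot_sym f f' = (\<lambda>i j k l. 1/8 * (f i l * f' j k) + 1/8 * (f' i l * f j k)
       + (-1/8) * (f i k * f' j l) + (-1/8) * (f' i k * f j l))"
      by (intro ext) (simp add: odot_sym_def)
    show ?thesis unfolding eq by (intro ad sc prod that)
  qed
  have two: "Z2 f" if eq: "\<And>i j. complex_of_real (f i j) =
      z * (?C (Some (\<mu>, True)) i * ?C (Some (\<mu>, False)) j)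
      + z' * (?C (Some (\<mu>, False)) i * ?C (Some (\<mu>, True)) j)" for f z z' \<mu>
  proof -
    let ?a = "(Some (\<mu>, True), Some (\<mu>, False))" and ?b = "(Some (\<mu>, False), Some (\<mu>, True))"
    let ?z = "\<lambda>w. if w = ?a then z else if w = ?b then z' else 0"
    have "complex_of_real (f i j) = (\<Sum>w\<in>W. ?z w * (?C (fst w) i * ?C (snd w) j))" for i j
    proof -
      have "(\<Sum>w\<in>W. ?z w * (?C (fst w) i * ?C (snd w) j))
          = (\<Sum>w\<in>{?a, ?b}. ?z w * (?C (fst w) i * ?C (snd w) j))"
        by (rule sum.mono_neutral_right[OF fin]) (auto simp: W_def)
      then show ?thesis by (simp add: eq)
    qed
    then show ?thesis unfolding Z2_def by (intro exI[of _ ?z]) blast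
  qed
  have Zh: "Z2 (h_form X \<mu> p)" for \<mu>
    by (rule two[of _ "\<i>/2" \<mu> "-\<i>/2"])
       (simp add: h_form_def tensor2_def cframe_def algebra_simps)
  have ZQ: "Z2 (Q_form X \<mu> p)" for \<mu>
    by (rule two[of _ "1/2" \<mu> "1/2"])
       (simp add: Q_form_def tensor2_def cframe_def algebra_simps)
  have Zadd: "Z2 (\<lambda>i j. f i j + f' i j)" if Z: "Z2 f" "Z2 f'" for f f'
  proof -
    obtain z where "\<forall>i j. complex_of_real (f i j) = (\<Sum>w\<in>W. z w * (?C (fst w) i * ?C (snd w) j))"
      using Z unfolding Z2_def by blast
    moreover obtain z' where "\<forall>i j. complex_of_real (f' i j) = (\<Sum>w\<in>W. z' w * (?C (fst w) i * ?C (snd w) j))"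
      using Z unfolding Z2_def by blast
    ultimately show ?thesis unfolding Z2_def
      by (intro exI[of _ "\<lambda>w. z w + z' w"]) (simp add: distrib_right sum.distrib)
  qed
  have Z0: "Z2 (\<lambda>i j. 0)" unfolding Z2_def by (intro exI[of _ "\<lambda>_. 0"]) simp
  have Zsum: "Z2 (\<lambda>i j. \<Sum>\<mu>\<in>I. Q_form X \<mu> p i j)" for I
  proof -
    have "finite I" by simp
    then show ?thesis
      by (induction rule: finite_induct) (auto intro: Z0 Zadd ZQ)
  qed
  have Zg: "Z2 (Q_eps_form \<epsilon> c X p)"
  proof (cases "\<epsilon> = 1")
    case True
    have "Z2 (tensor2 (eh0_form c p) (eh0_form c p))"
    proof -
      let ?z = "\<lambda>w. if w = (None, None) then 1 else 0"
      have "complex_of_real (tensor2 (eh0_form c p) (eh0_form c p) i j)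
           = (\<Sum>w\<in>W. ?z w * (?C (fst w) i * ?C (snd w) j))" for i j
      proof -
        have "(\<Sum>w\<in>W. ?z w * (?C (fst w) i * ?C (snd w) j))
            = (\<Sum>w\<in>{(None, None)}. ?z w * (?C (fst w) i * ?C (snd w) j))"
          by (rule sum.mono_neutral_right[OF fin]) (auto simp: W_def True)
        then show ?thesis by (simp add: tensor2_def cframe_def)
      qed
      then show ?thesis unfolding Z2_def by (intro exI[of _ ?z]) blast
    qed
    moreover have "Q_eps_form \<epsilon> c X p = (\<lambda>a b. (\<Sum>\<mu>\<in>UNIV. Q_form X \<mu> p a b) + tensor2 (eh0_form c p) (eh0_form c p) a b)"
      using kerr_metric_coframe[OF adm eps card] by (simp add: Q_eps_form_def True fun_eq_iff)
    ultimately show ?thesis using Zadd[OF Zsum] by simp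
  next
    case False
    with eps have "Q_eps_form \<epsilon> c X p = (\<lambda>i j. 0)" by (simp add: Q_eps_form_def fun_eq_iff)
    then show ?thesis using Z0 by simp
  qed
  have "?Z (\<lambda>i j k l. complex_of_real
     ((\<Sum>x\<in>{(\<mu>, \<nu>). \<mu> < \<nu>}.
         \<Omega> (fst x) (snd x) p * odot_anti (h_form X (fst x) p) (h_form X (snd x) p) i j k l
       + \<alpha> (fst x) (snd x) p * odot_sym (Q_form X (fst x) p) (Q_form X (snd x) p) i j k l)
     + (\<Sum>\<mu>\<in>UNIV.
         1/2 * \<Omega> \<mu> \<mu> p * odot_anti (h_form X \<mu> p) (h_form X \<mu> p) i j k l
       + \<alpha>\<epsilon> \<mu> p * odot_sym (Q_form X \<mu> p) (Q_eps_form \<epsilon> c X p) i j k l)))"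
    apply (rule ad)
     apply (rule su, rule finite)
     apply (rule ad)
      apply (rule sc)
      apply (rule oa[OF Zh Zh])
     apply (rule sc)
     apply (rule os[OF ZQ ZQ])
    apply (rule su, rule finite)
    apply (rule ad)
     apply (rule sc)
     apply (rule oa[OF Zh Zh])
    apply (rule sc)
    apply (rule os[OF ZQ Zg])
    done
  then show ?thesis unfolding zero_weight_tensor_def split_def .
qed

end

theory Submission
  imports Defs
begin

text \<open>
  The second Bianchi identity is evaluated on a frame at one fixed point \<open>p\<close>. Write
  \<open>G\<^sub>\<mu> = U\<^sub>\<mu> / X\<^sub>\<mu>\<close> and \<open>\<psi>\<^sup>\<mu> = \<Sum>\<^sub>k A\<^sub>\<mu>\<^sup>(\<^sup>k\<^sup>) d\<psi>\<^sub>k\<close>, so that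
  \<open>g = \<Sum>\<^sub>\<mu> (G\<^sub>\<mu> dx\<^sub>\<mu>\<^sup>2 + (\<psi>\<^sup>\<mu>)\<^sup>2 / G\<^sub>\<mu>)\<close> plus the term with \<open>\<epsilon>\<close>. The frame consists of the coordinate
  vectors \<open>\<partial>\<^sub>\<mu>\<close> and of vectors \<open>V\<^sub>\<sigma>\<close> in the \<open>\<psi>\<close>-directions with constant coordinates that are dual to the
  \<open>\<psi>\<^sup>\<tau>\<close> at \<open>p\<close>. All vectors are thus constant, so that Lie brackets vanish, and the square roots of
  the orthonormal coframe never enter: \<open>h\<^sub>\<mu> = dx\<^sub>\<mu> \<and> \<psi>\<^sup>\<mu>\<close>.

  The geometry enters through two derivative formulas. With
  \<open>c\<^sub>\<mu>\<^sub>\<nu> = 2 x\<^sub>\<mu> / (x\<^sub>\<mu>\<^sup>2 - x\<^sub>\<nu>\<^sup>2)\<close> and \<open>\<mu> \<noteq> \<nu>\<close> one has \<open>\<partial>\<^sub>\<mu> G\<^sub>\<nu> = c\<^sub>\<mu>\<^sub>\<nu> G\<^sub>\<nu>\<close> (lemma \<open>DERIV_g_xx_other\<close>) and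
  \<open>\<partial>\<^sub>\<mu> \<psi>\<^sup>\<nu> = c\<^sub>\<mu>\<^sub>\<nu> (\<psi>\<^sup>\<nu> - \<psi>\<^sup>\<mu>)\<close> (lemma \<open>DERIV_psi_form\<close>). These give every Christoffel symbol that is needed; the
  unknown derivative \<open>\<partial>\<^sub>\<mu> G\<^sub>\<mu>\<close>, which contains \<open>X\<^sub>\<mu>\<close>, cancels in the end.

  In the combination \<open>\<alpha>\<^sub>\<mu>\<^sub>\<nu> + \<alpha>\<^sub>\<mu>\<^sup>(\<^sup>\<epsilon>\<^sup>) + \<alpha>\<^sub>\<nu>\<^sup>(\<^sup>\<epsilon>\<^sup>)\<close> the terms with \<open>\<epsilon>\<close> cancel and leave
  \<open>K\<^sub>\<mu>\<^sub>\<nu> = (x\<^sub>\<mu> d\<^sub>\<mu> - x\<^sub>\<nu> d\<^sub>\<nu>) / (x\<^sub>\<mu>\<^sup>2 - x\<^sub>\<nu>\<^sup>2)\<close>. Up to the factor \<open>-1/8\<close>, this is the component of the tensor on the plane of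
  \<open>\<partial>\<^sub>\<mu>\<close> and \<open>V\<^sub>\<nu>\<close> in the orthonormal normalisation, and on the plane of \<open>\<partial>\<^sub>\<mu>\<close> and \<open>V\<^sub>\<mu>\<close> it is
  \<open>S\<^sub>\<mu> = 2 \<alpha>\<^sub>\<mu>\<^sup>(\<^sup>\<epsilon>\<^sup>) - 3 \<Omega>\<^sub>\<mu>\<^sub>\<mu>\<close>. Two components of the Bianchi identity suffice for each pair \<open>\<mu> \<noteq> \<nu>\<close>: the
  derivatives along \<open>\<partial>\<^sub>\<mu>\<close>, \<open>\<partial>\<^sub>\<nu>\<close>, \<open>V\<^sub>\<mu>\<close> with second index pair \<open>(\<partial>\<^sub>\<nu>, V\<^sub>\<mu>)\<close> give
  \<open>\<partial>\<^sub>\<mu> K\<^sub>\<mu>\<^sub>\<nu> + c\<^sub>\<mu>\<^sub>\<nu> (K\<^sub>\<mu>\<^sub>\<nu> - S\<^sub>\<mu>) / 2 + 3 c\<^sub>\<nu>\<^sub>\<mu> \<Omega>\<^sub>\<mu>\<^sub>\<nu> / 2 = 0\<close> (lemma \<open>bianchi_K\<close>), and with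
  \<open>(\<partial>\<^sub>\<mu>, V\<^sub>\<nu>)\<close> they give \<open>\<partial>\<^sub>\<mu> \<Omega>\<^sub>\<mu>\<^sub>\<nu> + 3 c\<^sub>\<mu>\<^sub>\<nu> \<Omega>\<^sub>\<mu>\<^sub>\<nu> / 2 + c\<^sub>\<nu>\<^sub>\<mu> (K\<^sub>\<mu>\<^sub>\<nu> - S\<^sub>\<mu>) / 2 = 0\<close>
  (lemma \<open>bianchi_Omega\<close>).

  Insert the formulas for \<open>K\<^sub>\<mu>\<^sub>\<nu>\<close> and \<open>\<Omega>\<^sub>\<mu>\<^sub>\<nu>\<close>. With \<open>a = \<partial>\<^sub>\<mu> d\<^sub>\<mu> - S\<^sub>\<mu>\<close> and \<open>b = \<partial>\<^sub>\<mu> d\<^sub>\<nu> + 2 \<Omega>\<^sub>\<mu>\<^sub>\<nu>\<close> the two equations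
  become \<open>x\<^sub>\<mu> a = x\<^sub>\<nu> b\<close> and \<open>x\<^sub>\<nu> a = x\<^sub>\<mu> b\<close>. The determinant \<open>x\<^sub>\<nu>\<^sup>2 - x\<^sub>\<mu>\<^sup>2\<close> does not vanish because \<open>U\<^sub>\<mu>\<close> does not, hence
  \<open>a = b = 0\<close>, which is the claim (lemma \<open>bianchi_consequences\<close>).
\<close>

section \<open>Finite sums, quotients and differentiability\<close>

lemma sum_of_bool [simp]:
  fixes f h :: "'i::finite \<Rightarrow> real"
  shows "(\<Sum>\<kappa>\<in>UNIV. f \<kappa> * of_bool (\<kappa> = \<tau>)) = f \<tau>" "(\<Sum>\<kappa>\<in>UNIV. f \<kappa> * of_bool (\<tau> = \<kappa>)) = f \<tau>"
    and "(\<Sum>\<kappa>\<in>UNIV. of_bool (\<kappa> = \<tau>) * f \<kappa>) = f \<tau>" "(\<Sum>\<kappa>\<in>UNIV. of_bool (\<tau> = \<kappa>) * f \<kappa>) = f \<tau>"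
    and "(\<Sum>\<kappa>\<in>UNIV. f \<kappa> * of_bool (\<kappa> = \<tau>) * h \<kappa>) = f \<tau> * h \<tau>"
    and "(\<Sum>\<kappa>\<in>UNIV. f \<kappa> * of_bool (\<tau> = \<kappa>) * h \<kappa>) = f \<tau> * h \<tau>"
  by (simp_all add: of_bool_def if_distrib[of "(*) _"] if_distrib[of "\<lambda>x. x * _"] cong: if_cong)

lemma sum_single:
  fixes f :: "'i::finite \<Rightarrow> real"
  assumes "f \<mu> = y" "\<And>\<kappa>. \<kappa> \<noteq> \<mu> \<Longrightarrow> f \<kappa> = 0"
  shows "(\<Sum>\<kappa>\<in>UNIV. f \<kappa>) = y"
  using assms by (subst sum.remove[of _ \<mu>]) (auto intro: sum.neutral)

lemma sum_pairs_symmetrised: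
  fixes f :: "'n::{finite,linorder} \<Rightarrow> 'n \<Rightarrow> real"
  shows "(\<Sum>(\<mu>, \<nu>) \<in> {(\<mu>, \<nu>). \<mu> < \<nu>}. f \<mu> \<nu> + f \<nu> \<mu>) + (\<Sum>\<mu>\<in>UNIV. f \<mu> \<mu>)
    = (\<Sum>\<mu>\<in>UNIV. \<Sum>\<nu>\<in>UNIV. f \<mu> \<nu>)"
proof -
  let ?lt = "{(\<mu>, \<nu>). \<mu> < \<nu>} :: ('n \<times> 'n) set" and ?gt = "{(\<mu>, \<nu>). \<nu> < \<mu>} :: ('n \<times> 'n) set"
    and ?eq = "range (\<lambda>\<mu>. (\<mu>, \<mu>)) :: ('n \<times> 'n) set" and ?f = "\<lambda>(\<mu>, \<nu>). f \<mu> \<nu>"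
  have "(\<Sum>\<mu>\<in>UNIV. \<Sum>\<nu>\<in>UNIV. f \<mu> \<nu>) = sum ?f UNIV"
    by (simp add: sum.cartesian_product)
  also have "UNIV = (?lt \<union> ?gt) \<union> ?eq" by force
  also have "sum ?f \<dots> = sum ?f ?lt + sum ?f ?gt + sum ?f ?eq"
    by (subst sum.union_disjoint, simp, simp, force, subst sum.union_disjoint) auto
  also have "sum ?f ?eq = (\<Sum>\<mu>\<in>UNIV. f \<mu> \<mu>)"
    by (subst sum.reindex) (auto simp: inj_on_def)
  also have "sum ?f ?gt = (\<Sum>(\<mu>, \<nu>)\<in>?lt. f \<nu> \<mu>)"
    by (rule sum.reindex_bij_witness[of _ prod.swap prod.swap]) auto
  finally show ?thesis by (simp add: sum.distrib split_def)
qed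

lemma quotient_sign: "(b - a) / (y - x) = (a - b) / (x - (y::real))"
  by (metis minus_diff_eq minus_divide_divide)

lemma DERIV_quotient:
  fixes f h :: "real \<Rightarrow> real"
  assumes "(f has_real_derivative f') (at x)" "(h has_real_derivative h') (at x)" "h x \<noteq> 0"
  shows "((\<lambda>t. f t / h t) has_real_derivative (f' - h' * (f x / h x)) / h x) (at x)"
  by (rule DERIV_cong, rule DERIV_divide[OF assms]) (use assms(3) in \<open>simp add: field_simps\<close>)

lemma differentiable_local_cong:
  assumes "open S" "p \<in> S" "\<And>q. q \<in> S \<Longrightarrow> f q = h q" "h differentiable (at p)"
  shows "f differentiable (at p)"
  using assms by (metis differentiable_def has_derivative_transform_within_open)

lemma smooth_on_differentiable: "smooth_on S f \<Longrightarrow> p \<in> S \<Longrightarrow> f differentiable (at p)"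
  unfolding smooth_on_def by (metis Ck_on.simps(2))

section \<open>Contraction of components with vectors\<close>

text \<open>
  The metric and the curvature tensor are given by components in the coordinate basis. Contraction
  with constant vectors turns identities between components into multilinear identities, which can
  then be evaluated on any frame.
\<close>

definition contract1 :: "('i::finite) cov1 \<Rightarrow> real^'i \<Rightarrow> real" where
  "contract1 T u = (\<Sum>a\<in>UNIV. T a * u $ a)"

definition contract2 :: "('i::finite) cov2 \<Rightarrow> real^'i \<Rightarrow> real^'i \<Rightarrow> real" where
  "contract2 T u v = contract1 (\<lambda>a. contract1 (T a) v) u"

definition contract4 :: "('i::finite) cov4 \<Rightarrow> real^'i \<Rightarrow> real^'i \<Rightarrow> real^'i \<Rightarrow> real^'i \<Rightarrow> real" where
  "contract4 T u v w z = contract2 (\<lambda>a b. contract2 (T a b) w z) u v"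

lemma contract1_add: "contract1 (\<lambda>a. S a + T a) u = contract1 S u + contract1 T u"
  by (simp add: contract1_def sum.distrib algebra_simps)

lemma contract1_diff: "contract1 (\<lambda>a. S a - T a) u = contract1 S u - contract1 T u"
  by (simp add: contract1_def sum_subtractf algebra_simps)

lemma contract1_cmult: "contract1 (\<lambda>a. k * T a) u = k * contract1 T u"
  by (simp add: contract1_def sum_distrib_left mult.assoc)

lemma contract1_multc: "contract1 (\<lambda>a. T a * k) u = contract1 T u * k"
  by (simp add: contract1_def sum_distrib_left mult_ac)

lemma contract1_minus: "contract1 (\<lambda>a. - T a) u = - contract1 T u"
  by (simp add: contract1_def sum_negf)

lemma contract1_sum: "contract1 (\<lambda>a. \<Sum>i\<in>I. T i a) u = (\<Sum>i\<in>I. contract1 (T i) u)"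
  unfolding contract1_def sum_distrib_right by (rule sum.swap)

text \<open>
  Rewriting with these rules pulls out every factor that is independent of the contracted index.
\<close>

lemmas contract1_pull = contract1_add contract1_diff contract1_cmult contract1_multc contract1_minus contract1_sum

lemma contract1_swap: "contract1 (\<lambda>a. contract1 (\<lambda>b. T a b) v) u = contract1 (\<lambda>b. contract1 (\<lambda>a. T a b) u) v"
proof -
  have "contract1 (\<lambda>a. contract1 (\<lambda>b. T a b) v) u = (\<Sum>a\<in>UNIV. \<Sum>b\<in>UNIV. T a b * v $ b * u $ a)"
    by (simp add: contract1_def sum_distrib_right)
  also have "\<dots> = (\<Sum>b\<in>UNIV. \<Sum>a\<in>UNIV. T a b * v $ b * u $ a)"
    by (rule sum.swap)
  also have "\<dots> = contract1 (\<lambda>b. contract1 (\<lambda>a. T a b) u) v"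
    by (simp add: contract1_def sum_distrib_left sum_distrib_right mult_ac)
  finally show ?thesis .
qed

lemma contract1_axis: "contract1 T (axis a 1) = T a"
  by (simp add: contract1_def axis_def if_distrib[of "\<lambda>x. _ * x"] cong: if_cong)

lemma linear_contract1: "linear (contract1 T)"
  by (rule linearI) (simp_all add: contract1_def sum.distrib sum_distrib_left algebra_simps)

lemmas contract1_vec_add = linear_add[OF linear_contract1]
lemmas contract1_vec_scale = linear_scale[OF linear_contract1, unfolded real_scaleR_def]
lemmas contract1_vec_sum = linear_sum[OF linear_contract1]

lemma contract4_eq: "contract4 T u v w z = contract1 (\<lambda>a. contract1 (\<lambda>b. contract1 (\<lambda>c. contract1 (T a b c) z) w) v) u"
  by (simp add: contract4_def contract2_def)

lemma contract4_axis: "contract4 T (axis a 1) (axis b 1) (axis c 1) (axis d 1) = T a b c d"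
  by (simp add: contract4_eq contract1_axis)

lemma contract4_vec_third:
  shows "contract4 T u v (w + w') z = contract4 T u v w z + contract4 T u v w' z"
    and "contract4 T u v (k *\<^sub>R w) z = k * contract4 T u v w z"
  by (simp_all add: contract4_eq contract1_vec_add contract1_vec_scale contract1_pull)

lemma contract4_vec_fourth:
  shows "contract4 T u v w (z + z') = contract4 T u v w z + contract4 T u v w z'"
    and "contract4 T u v w (k *\<^sub>R z) = k * contract4 T u v w z"
  by (simp_all add: contract4_eq contract1_vec_add contract1_vec_scale contract1_pull)

lemma contract4_vec_third_sum: "contract4 T u v (\<Sum>i\<in>I. w i) z = (\<Sum>i\<in>I. contract4 T u v (w i) z)"
  by (simp add: contract4_eq contract1_vec_sum contract1_pull)

lemma contract4_vec_fourth_sum: "contract4 T u v w (\<Sum>i\<in>I. z i) = (\<Sum>i\<in>I. contract4 T u v w (z i))"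
  by (simp add: contract4_eq contract1_vec_sum contract1_pull)

section \<open>Directional derivatives\<close>

lemma differentiable_has_dir_deriv:
  assumes "f differentiable (at p)"
  shows "((\<lambda>t. f (p + t *\<^sub>R u)) has_real_derivative dir_deriv u f p) (at 0)"
    and "dir_deriv u f p = frechet_derivative f (at p) u"
proof -
  have f: "(f has_derivative frechet_derivative f (at p)) (at (p + 0 *\<^sub>R u))"
    using assms by (simp add: frechet_derivative_works[symmetric])
  have g: "((\<lambda>t::real. p + t *\<^sub>R u) has_derivative (\<lambda>t. t *\<^sub>R u)) (at 0)"
    by (auto intro!: derivative_eq_intros)
  have lin: "linear (frechet_derivative f (at p))"
    using assms by (simp add: linear_frechet_derivative)
  have "((\<lambda>t. f (p + t *\<^sub>R u)) has_derivative (\<lambda>t. frechet_derivative f (at p) (t *\<^sub>R u))) (at 0)"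
    using has_derivative_compose[OF g f] by simp
  moreover have "(\<lambda>t. frechet_derivative f (at p) (t *\<^sub>R u)) = (*) (frechet_derivative f (at p) u)"
    using linear_scale[OF lin] by (simp add: fun_eq_iff mult.commute)
  ultimately have D: "((\<lambda>t. f (p + t *\<^sub>R u)) has_real_derivative frechet_derivative f (at p) u) (at 0)"
    by (simp add: has_field_derivative_def)
  then show "dir_deriv u f p = frechet_derivative f (at p) u"
    unfolding dir_deriv_def by (rule DERIV_imp_deriv)
  with D show "((\<lambda>t. f (p + t *\<^sub>R u)) has_real_derivative dir_deriv u f p) (at 0)" by simp
qed

lemma dir_derivI:
  "((\<lambda>t. f (p + t *\<^sub>R u)) has_real_derivative D) (at 0) \<Longrightarrow> dir_deriv u f p = D"
  unfolding dir_deriv_def by (rule DERIV_imp_deriv)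

text \<open>
  Differentiability is essential: the left side probes one line through \<open>p\<close> only, the right side the
  coordinate lines.
\<close>

lemma dir_deriv_eq_partials:
  assumes "f differentiable (at p)"
  shows "dir_deriv u f p = contract1 (\<lambda>e. partial e f p) u"
proof -
  have lin: "linear (frechet_derivative f (at p))"
    using assms by (simp add: linear_frechet_derivative)
  have "frechet_derivative f (at p) u = frechet_derivative f (at p) (\<Sum>e\<in>UNIV. u $ e *\<^sub>R axis e 1)"
    by (simp add: basis_expansion[of u, unfolded scalar_mult_eq_scaleR])
  also have "\<dots> = (\<Sum>e\<in>UNIV. u $ e * frechet_derivative f (at p) (axis e 1))"
    by (simp add: linear_sum[OF lin] linear_scale[OF lin])
  finally show ?thesis
    by (simp add: contract1_def partial_def differentiable_has_dir_deriv(2)[OF assms] mult.commute)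
qed

lemma differentiable_contract1:
  assumes "\<And>a. (\<lambda>q. T q a) differentiable (at p)"
  shows "(\<lambda>q. contract1 (T q) u) differentiable (at p)"
  unfolding contract1_def by (intro differentiable_sum differentiable_mult assms differentiable_const ballI finite)

lemma dir_deriv_contract1:
  assumes "\<And>a. (\<lambda>q. T q a) differentiable (at p)"
  shows "dir_deriv u (\<lambda>q. contract1 (T q) v) p = contract1 (\<lambda>a. dir_deriv u (\<lambda>q. T q a) p) v"
  unfolding contract1_def
  by (rule dir_derivI)
     (auto intro!: derivative_eq_intros differentiable_has_dir_deriv assms)

lemma dir_deriv_local_cong:
  assumes "open S" "p \<in> S" "\<And>q. q \<in> S \<Longrightarrow> f q = h q"
  shows "dir_deriv u f p = dir_deriv u h p"
proof -
  have "\<forall>\<^sub>F t in nhds 0. p + t *\<^sub>R u \<in> S"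
  proof -
    have "((\<lambda>t::real. p + t *\<^sub>R u) \<longlongrightarrow> p + 0 *\<^sub>R u) (nhds 0)"
      by (intro tendsto_intros filterlim_ident)
    then show ?thesis using assms(1,2) by (auto simp: tendsto_def)
  qed
  then have "\<forall>\<^sub>F t in nhds 0. f (p + t *\<^sub>R u) = h (p + t *\<^sub>R u)"
    by eventually_elim (rule assms)
  then show ?thesis unfolding dir_deriv_def by (rule deriv_cong_ev) simp
qed

section \<open>The second Bianchi identity and the Christoffel symbols on vectors\<close>

text \<open>
  Alternating over \<open>e\<close>, \<open>a\<close>, \<open>b\<close> removes the Christoffel symbols that act on \<open>a\<close> and \<open>b\<close>, because they are
  symmetric in their lower indices. Antisymmetry in the first index pair reduces the remaining six terms
  to the three cyclic ones.
\<close>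

lemma bianchi_index:
  fixes g :: "real^'i::finite \<Rightarrow> 'i cov2" and R :: "real^'i \<Rightarrow> 'i cov4"
  defines "T \<equiv> \<lambda>p e a b c d. partial e (\<lambda>q. R q a b c d) p
     - (\<Sum>f\<in>UNIV. christoffel g p f e c * R p a b f d) - (\<Sum>f\<in>UNIV. christoffel g p f e d * R p a b c f)"
  assumes S: "open S" "p \<in> S"
    and sym: "\<And>q a b. g q a b = g q b a"
    and diff: "\<And>a b c d. (\<lambda>q. R q a b c d) differentiable (at p)"
    and anti: "\<And>q a b c d. q \<in> S \<Longrightarrow> R q b a c d = - R q a b c d"
    and bianchi: "second_bianchi g R S"
  shows "T p e a b c d + T p a b e c d + T p b e a c d = 0"
proof -
  let ?\<Gamma> = "christoffel g p" and ?N = "\<lambda>e a b. nabla4 g R p e a b c d"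
  have sym\<Gamma>: "?\<Gamma> f b c = ?\<Gamma> f c b" for f b c
    unfolding christoffel_def sym[of _ c b] by (simp add: add.commute)
  have dR: "partial e (\<lambda>q. R q b a c d) p = - partial e (\<lambda>q. R q a b c d) p" for e a b
  proof -
    have "partial e (\<lambda>q. R q b a c d) p = partial e (\<lambda>q. - R q a b c d) p"
      unfolding partial_def by (rule dir_deriv_local_cong[OF S anti])
    also have "\<dots> = - partial e (\<lambda>q. R q a b c d) p"
      unfolding partial_def
      by (rule dir_derivI) (intro DERIV_minus differentiable_has_dir_deriv diff)
    finally show ?thesis .
  qed
  have N: "?N e a b = T p e a b c d - (\<Sum>f\<in>UNIV. ?\<Gamma> f e a * R p f b c d) - (\<Sum>f\<in>UNIV. ?\<Gamma> f e b * R p a f c d)"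
    for e a b
    unfolding nabla4_def T_def by (simp add: sum.distrib)
  have Tanti: "T p e b a c d = - T p e a b c d" for e a b
    unfolding T_def dR[of e b a] anti[OF S(2), of b a] by (simp add: sum_negf)
  have swap: "(\<Sum>f\<in>UNIV. ?\<Gamma> f e b * R p a f c d) = - (\<Sum>f\<in>UNIV. ?\<Gamma> f e b * R p f a c d)" for e a b
    unfolding anti[OF S(2), of _ a] by (simp add: sum_negf)
  have sw: "(\<Sum>f\<in>UNIV. ?\<Gamma> f e b * R p f a c d) = (\<Sum>f\<in>UNIV. ?\<Gamma> f b e * R p f a c d)" for e a b
    using sym\<Gamma> by simp
  have "alt3 ?N e a b = 0"
    using bianchi S(2) unfolding second_bianchi_def by blast
  then have "?N e a b + ?N a b e + ?N b e a - ?N e b a - ?N b a e - ?N a e b = 0"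
    by (simp add: alt3_def)
  then show ?thesis
    unfolding N swap
    using sw[of e b a] sw[of e a b] sw[of a e b] sw[of a b e] sw[of b e a]  sw[of b a e]
      Tanti[of e a b] Tanti[of a b e] Tanti[of b e a] by linarith
qed

definition christoffel_vec :: "(real^'i \<Rightarrow> 'i cov2) \<Rightarrow> real^'i::finite \<Rightarrow> real^'i \<Rightarrow> real^'i \<Rightarrow> real^'i" where
  "christoffel_vec g p u w = (\<chi> f. contract2 (christoffel g p f) u w)"

lemma contract1_christoffel_vec:
  "contract1 T (christoffel_vec g p u w) = (\<Sum>f\<in>UNIV. contract2 (christoffel g p f) u w * T f)"
  by (simp add: contract1_def christoffel_vec_def mult.commute)

text \<open>
  One summand of the cyclic identity: the derivative of the tensor along \<open>u\<close> with connection terms only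
  on the last two slots.
\<close>

definition bianchi_term ::
  "(real^'i \<Rightarrow> 'i cov2) \<Rightarrow> (real^'i \<Rightarrow> 'i cov4) \<Rightarrow> real^'i::finite \<Rightarrow>
   real^'i \<Rightarrow> real^'i \<Rightarrow> real^'i \<Rightarrow> real^'i \<Rightarrow> real^'i \<Rightarrow> real" where
  "bianchi_term g R p u v w y z = dir_deriv u (\<lambda>q. contract4 (R q) v w y z) p
     - contract4 (R p) v w (christoffel_vec g p u y) z - contract4 (R p) v w y (christoffel_vec g p u z)"

lemma bianchi_vectors:
  fixes g :: "real^'i::finite \<Rightarrow> 'i cov2" and R :: "real^'i \<Rightarrow> 'i cov4"
  assumes S: "open S" "p \<in> S"
    and sym: "\<And>q a b. g q a b = g q b a"
    and diff: "\<And>a b c d. (\<lambda>q. R q a b c d) differentiable (at p)"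
    and anti: "\<And>q a b c d. q \<in> S \<Longrightarrow> R q b a c d = - R q a b c d"
    and bianchi: "second_bianchi g R S"
  shows "bianchi_term g R p u v w y z + bianchi_term g R p v w u y z + bianchi_term g R p w u v y z = 0"
proof -
  define T where "T e a b c d = partial e (\<lambda>q. R q a b c d) p
     - (\<Sum>f\<in>UNIV. christoffel g p f e c * R p a b f d) - (\<Sum>f\<in>UNIV. christoffel g p f e d * R p a b c f)"
    for e a b c d
  have cyc: "T e a b c d = - T a b e c d - T b e a c d" for e a b c d
    using bianchi_index[OF S sym diff anti bianchi, of e a b c d] unfolding T_def by linarith
  have contracted: "bianchi_term g R p u v w y z = contract1 (\<lambda>e. contract4 (T e) v w y z) u" for u v w y z
  proof -
    have d: "dir_deriv u (\<lambda>q. contract4 (R q) v w y z) p = contract1 (\<lambda>e. contract4 (\<lambda>a b c d. partial e (\<lambda>q. R q a b c d) p) v w y z) u"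
      unfolding contract4_eq
      by (subst dir_deriv_eq_partials)
         (simp_all add: differentiable_contract1 diff partial_def dir_deriv_contract1)
    have y: "contract4 (R p) v w (christoffel_vec g p u y) z =
        contract1 (\<lambda>e. contract4 (\<lambda>a b c d. \<Sum>f\<in>UNIV. christoffel g p f e c * R p a b f d) v w y z) u"
      by (simp add: contract4_eq contract1_christoffel_vec contract1_pull contract2_def)
    have z: "contract4 (R p) v w y (christoffel_vec g p u z) =
        contract1 (\<lambda>e. contract4 (\<lambda>a b c d. \<Sum>f\<in>UNIV. christoffel g p f e d * R p a b c f) v w y z) u"
      by (simp add: contract4_eq contract1_christoffel_vec contract1_pull contract2_def)
    show ?thesis unfolding bianchi_term_def d y z T_def by (simp add: contract4_eq contract1_pull)
  qed
  have 2: "contract1 (\<lambda>a. contract4 (T a) w u y z) v = contract1 (\<lambda>e. contract4 (\<lambda>a b c d. T a b e c d) v w y z) u"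
    unfolding contract4_eq contract1_swap[of _ u w] contract1_swap[of _ u v] ..
  have 3: "contract1 (\<lambda>b. contract4 (T b) u v y z) w = contract1 (\<lambda>e. contract4 (\<lambda>a b c d. T b e a c d) v w y z) u"
    unfolding contract4_eq contract1_swap[of _ v w] contract1_swap[of _ u w] ..
  have "contract1 (\<lambda>e. contract4 (T e) v w y z) u =
     contract1 (\<lambda>e. contract4 (\<lambda>a b c d. - T a b e c d - T b e a c d) v w y z) u"
    by (subst cyc[abs_def]) (rule refl)
  then show ?thesis
    unfolding contracted 2 3 by (simp add: contract4_eq contract1_pull)
qed

text \<open>
  Koszul's formula for constant vector fields. It determines \<open>christoffel_vec\<close> in a frame without ever
  computing the inverse metric; positive definiteness serves to make the metric invertible.
\<close>

lemma christoffel_vec_lowered: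
  fixes g :: "real^'i::finite \<Rightarrow> 'i cov2"
  assumes sym: "\<And>q a b. g q a b = g q b a"
    and pos: "pos_def (g p)"
    and diff: "\<And>a b. (\<lambda>q. g q a b) differentiable (at p)"
  shows "contract2 (g p) z (christoffel_vec g p u w) =
    1/2 * (dir_deriv u (\<lambda>q. contract2 (g q) z w) p + dir_deriv w (\<lambda>q. contract2 (g q) z u) p
           - dir_deriv z (\<lambda>q. contract2 (g q) u w) p)"
proof -
  define M where "M = (\<chi> i j. g p i j)"
  have "invertible M"
  proof -
    have "M *v v = 0 \<Longrightarrow> v = 0" for v
    proof (rule ccontr)
      assume 0: "M *v v = 0" and "v \<noteq> 0"
      have "(\<Sum>a\<in>UNIV. \<Sum>b\<in>UNIV. g p a b * v $ a * v $ b) = v \<bullet> (M *v v)"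
        by (simp add: inner_vec_def matrix_vector_mult_def M_def sum_distrib_left mult_ac)
      with 0 \<open>v \<noteq> 0\<close> pos show False unfolding pos_def_def by force
    qed
    then show ?thesis
      by (meson invertible_left_inverse matrix_left_invertible_ker)
  qed
  then have inv: "M ** matrix_inv M = mat 1" unfolding invertible_def matrix_inv_def by (metis (mono_tags, lifting) someI_ex)
  have low: "(\<Sum>f\<in>UNIV. g p a f * christoffel g p f b c) =
      1/2 * (partial b (\<lambda>q. g q a c) p + partial c (\<lambda>q. g q a b) p - partial a (\<lambda>q. g q b c) p)" for a b c
  proof -
    let ?L = "\<lambda>d. partial b (\<lambda>q. g q d c) p + partial c (\<lambda>q. g q d b) p - partial d (\<lambda>q. g q b c) p"
    have "(\<Sum>f\<in>UNIV. g p a f * christoffel g p f b c)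
       = (\<Sum>f\<in>UNIV. \<Sum>d\<in>UNIV. g p a f * inv_metric (g p) f d * (1/2 * ?L d))"
      unfolding christoffel_def sum_distrib_left by (simp add: mult_ac)
    also have "\<dots> = (\<Sum>d\<in>UNIV. (\<Sum>f\<in>UNIV. g p a f * inv_metric (g p) f d) * (1/2 * ?L d))"
      unfolding sum_distrib_right by (rule sum.swap)
    also have "\<dots> = (\<Sum>d\<in>UNIV. (M ** matrix_inv M) $ a $ d * (1/2 * ?L d))"
      by (simp add: matrix_matrix_mult_def inv_metric_def M_def)
    also have "\<dots> = 1/2 * ?L a"
    proof -
      have "(\<Sum>d\<in>UNIV. mat 1 $ a $ d * (1/2 * ?L d)) = (\<Sum>d\<in>UNIV. if a = d then 1/2 * ?L d else 0)"
        by (rule sum.cong) (simp_all add: mat_def)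
      then show ?thesis unfolding inv by (simp only: sum.delta' finite UNIV_I if_True)
    qed
    finally show ?thesis .
  qed
  have d: "dir_deriv u (\<lambda>q. contract2 (g q) z w) p = contract1 (\<lambda>e. contract2 (\<lambda>a b. partial e (\<lambda>q. g q a b) p) z w) u" for u z w
    unfolding contract2_def
    by (subst dir_deriv_eq_partials) (simp_all add: differentiable_contract1 diff partial_def dir_deriv_contract1)
  have "contract2 (g p) z (christoffel_vec g p u w)
      = contract1 (\<lambda>a. contract1 (\<lambda>b. contract1 (\<lambda>c. \<Sum>f\<in>UNIV. g p a f * christoffel g p f b c) w) u) z"
    by (simp add: contract1_christoffel_vec contract1_pull contract2_def mult.commute)
  also have "\<dots> = 1/2 * (contract1 (\<lambda>a. contract1 (\<lambda>b. contract1 (\<lambda>c. partial b (\<lambda>q. g q a c) p) w) u) z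
     + contract1 (\<lambda>a. contract1 (\<lambda>b. contract1 (\<lambda>c. partial c (\<lambda>q. g q a b) p) w) u) z
     - contract1 (\<lambda>a. contract1 (\<lambda>b. contract1 (\<lambda>c. partial a (\<lambda>q. g q b c) p) w) u) z)"
    unfolding low contract1_pull ..
  also have "contract1 (\<lambda>a. contract1 (\<lambda>b. contract1 (\<lambda>c. partial b (\<lambda>q. g q a c) p) w) u) z
     = dir_deriv u (\<lambda>q. contract2 (g q) z w) p"
    unfolding d unfolding contract2_def contract1_swap[of _ u z] ..
  also have "contract1 (\<lambda>a. contract1 (\<lambda>b. contract1 (\<lambda>c. partial c (\<lambda>q. g q a b) p) w) u) z
     = dir_deriv w (\<lambda>q. contract2 (g q) z u) p"
    unfolding d unfolding contract2_def contract1_swap[of _ w u] contract1_swap[of _ w z] ..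
  also have "contract1 (\<lambda>a. contract1 (\<lambda>b. contract1 (\<lambda>c. partial a (\<lambda>q. g q b c) p) w) u) z
     = dir_deriv z (\<lambda>q. contract2 (g q) u w) p"
    unfolding d unfolding contract2_def ..
  finally show ?thesis .
qed

section \<open>The coframe along coordinate lines\<close>

definition coord_vec :: "'n \<Rightarrow> real^('n::finite + 'm::finite)" where
  "coord_vec \<mu> = axis (Inl \<mu>) 1"

definition vertical :: "real^('n::finite + 'm::finite) \<Rightarrow> bool" where
  "vertical v \<longleftrightarrow> (\<forall>\<mu>. v $ Inl \<mu> = 0)"

definition g_xx :: "('n \<Rightarrow> real \<Rightarrow> real) \<Rightarrow> 'n \<Rightarrow> ('n::finite, 'm::finite) point \<Rightarrow> real" where
  "g_xx X \<mu> q = U_fun \<mu> q / X \<mu> (xc \<mu> q)"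

text \<open>
  This is the derivative of \<open>ln \<bar>x\<^sub>\<mu>\<^sup>2 - x\<^sub>\<nu>\<^sup>2\<bar>\<close> along \<open>x\<^sub>\<mu>\<close>. For equal indices division by zero makes it \<open>0\<close>,
  which is the value that the formulas below need.
\<close>

definition log_slope :: "('n::finite, 'm::finite) point \<Rightarrow> 'n \<Rightarrow> 'n \<Rightarrow> real" where
  "log_slope q \<mu> \<nu> = 2 * xc \<mu> q / ((xc \<mu> q)\<^sup>2 - (xc \<nu> q)\<^sup>2)"

lemma log_slope_same [simp]: "log_slope q \<mu> \<mu> = 0"
  by (simp add: log_slope_def)

lemma coord_vec_Inl [simp]: "coord_vec \<mu> $ Inl \<nu> = of_bool (\<nu> = \<mu>)"
  by (simp add: coord_vec_def axis_def)

lemma contract1_psi_x [simp]: "contract1 (psi_form \<tau> q) (coord_vec \<mu>) = 0" "contract1 (psi_form0 q) (coord_vec \<mu>) = 0"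
  by (simp_all add: coord_vec_def contract1_axis psi_form_def psi_form0_def dcoord_def)

lemma xc_along_x: "xc \<nu> (p + t *\<^sub>R coord_vec \<mu>) = xc \<nu> p + (if \<nu> = \<mu> then t else 0)"
  by (simp add: xc_def)

lemma xc_along_vertical: "vertical v \<Longrightarrow> xc \<nu> (p + t *\<^sub>R v) = xc \<nu> p"
  by (simp add: xc_def vertical_def)

lemma kerr_metric_along_vertical:
  "vertical v \<Longrightarrow> kerr_metric \<epsilon> c X (p + t *\<^sub>R v) = kerr_metric \<epsilon> c X p"
  by (intro ext)
     (simp add: kerr_metric_def U_fun_def A_fun_def psi_form_def[abs_def] psi_form0_def[abs_def]
       A_fun_at_def xc_along_vertical)

text \<open>
  A weighted generating function of the elementary symmetric polynomials in the \<open>x\<^sub>\<nu>\<^sup>2\<close>, \<open>\<nu> \<in> M\<close>: the forms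
  \<open>\<psi>\<^sup>\<tau>\<close> evaluated on a fixed vector have this shape with \<open>M\<close> the complement of \<open>\<tau>\<close>.
\<close>

definition sym_sum :: "'n set \<Rightarrow> (nat \<Rightarrow> real) \<Rightarrow> ('n::finite, 'm::finite) point \<Rightarrow> real" where
  "sym_sum M \<omega> q = (\<Sum>N\<in>Pow M. \<omega> (card N) * (\<Prod>\<nu>\<in>N. (xc \<nu> q)\<^sup>2))"

lemma sym_sum_insert:
  assumes "\<mu> \<notin> M"
  shows "sym_sum (insert \<mu> M) \<omega> q = sym_sum M \<omega> q + (xc \<mu> q)\<^sup>2 * sym_sum M (\<lambda>j. \<omega> (Suc j)) q"
proof -
  have inj: "inj_on (insert \<mu>) (Pow M)" using assms by (auto simp: inj_on_def)
  have "sym_sum (insert \<mu> M) \<omega> q = sym_sum M \<omega> q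
      + (\<Sum>N\<in>insert \<mu> ` Pow M. \<omega> (card N) * (\<Prod>\<nu>\<in>N. (xc \<nu> q)\<^sup>2))"
    unfolding sym_sum_def Pow_insert using assms by (intro sum.union_disjoint) auto
  also have "(\<Sum>N\<in>insert \<mu> ` Pow M. \<omega> (card N) * (\<Prod>\<nu>\<in>N. (xc \<nu> q)\<^sup>2))
      = (xc \<mu> q)\<^sup>2 * sym_sum M (\<lambda>j. \<omega> (Suc j)) q"
    unfolding sum.reindex[OF inj] sym_sum_def sum_distrib_left
  proof (rule sum.cong[OF refl])
    fix N assume "N \<in> Pow M"
    with assms have "\<mu> \<notin> N" by auto
    then show "((\<lambda>N. \<omega> (card N) * (\<Prod>\<nu>\<in>N. (xc \<nu> q)\<^sup>2)) \<circ> insert \<mu>) N =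
        (xc \<mu> q)\<^sup>2 * (\<omega> (Suc (card N)) * (\<Prod>\<nu>\<in>N. (xc \<nu> q)\<^sup>2))" by simp
  qed
  finally show ?thesis .
qed

lemma sym_sum_along_x: "\<mu> \<notin> M \<Longrightarrow> sym_sum M \<omega> (p + t *\<^sub>R coord_vec \<mu>) = sym_sum M \<omega> p"
  unfolding sym_sum_def by (intro sum.cong refl arg_cong2[of _ _ _ _ "(*)"] prod.cong) (auto simp: xc_along_x)

lemma contract1_psi_form:
  fixes q :: "('n::finite, 'm::{finite,linorder}) point"
  shows "contract1 (psi_form \<tau> q) v = sym_sum (- {\<tau>}) (\<lambda>j. \<Sum>k | psi_no k = j. v $ Inr k) q"
proof -
  let ?P = "\<lambda>N. \<Prod>\<nu>\<in>N. (xc \<nu> q)\<^sup>2"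
  have "contract1 (psi_form \<tau> q) v
      = (\<Sum>k | psi_no k < CARD('n). A_fun_at \<tau> (psi_no k) q * (\<Sum>a\<in>UNIV. dcoord (Inr k) a * v $ a))"
    unfolding contract1_def psi_form_def sum_distrib_right sum_distrib_left
    by (subst sum.swap) (simp add: mult.assoc)
  also have "\<dots> = (\<Sum>k | psi_no k < CARD('n). A_fun_at \<tau> (psi_no k) q * v $ Inr k)"
    by (simp add: dcoord_def if_distrib[of "\<lambda>x. x * _"] cong: if_cong)
  also have "\<dots> = (\<Sum>k\<in>UNIV. A_fun_at \<tau> (psi_no k) q * v $ Inr k)"
  proof (rule sum.mono_neutral_left)
    show "\<forall>k\<in>UNIV - {k. psi_no k < CARD('n)}. A_fun_at \<tau> (psi_no k) q * v $ Inr k = 0"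
    proof
      fix k :: 'm assume k: "k \<in> UNIV - {k. psi_no k < CARD('n)}"
      have small: "card N < CARD('n)" if "\<tau> \<notin> N" for N :: "'n set"
        using that by (intro psubset_card_mono) auto
      have "\<not> (card N = psi_no k \<and> \<tau> \<notin> N)" for N :: "'n set"
        using small[of N] k by (cases "\<tau> \<in> N") auto
      then have "{N. card N = psi_no k \<and> \<tau> \<notin> N} = {}" by simp
      then show "A_fun_at \<tau> (psi_no k) q * v $ Inr k = 0"
        unfolding A_fun_at_def by (metis mult_zero_left sum.empty)
    qed
  qed auto
  also have "\<dots> = (\<Sum>k\<in>UNIV. \<Sum>N | N \<in> Pow (- {\<tau>}) \<and> psi_no k = card N. v $ Inr k * ?P N)"
    unfolding A_fun_at_def sum_distrib_right
    by (intro sum.cong) (auto simp: mult.commute)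
  also have "\<dots> = (\<Sum>N\<in>Pow (- {\<tau>}). \<Sum>k | k \<in> UNIV \<and> psi_no k = card N. v $ Inr k * ?P N)"
    by (rule sum.swap_restrict) auto
  finally show ?thesis by (simp add: sym_sum_def sum_distrib_right)
qed

text \<open>
  With \<open>M\<close> the complement of \<open>{\<mu>, \<tau>}\<close>, both \<open>\<psi>\<^sup>\<tau>\<close> and \<open>\<psi>\<^sup>\<mu>\<close> are of the form \<open>B + x\<^sup>2 C\<close> where \<open>B\<close> and \<open>C\<close>
  involve the variables in \<open>M\<close> only, \<open>x\<close> being \<open>x\<^sub>\<mu>\<close> in the first case and \<open>x\<^sub>\<tau>\<close> in the second. Hence
  \<open>\<psi>\<^sup>\<tau> - \<psi>\<^sup>\<mu> = (x\<^sub>\<mu>\<^sup>2 - x\<^sub>\<tau>\<^sup>2) C\<close>, and \<open>\<partial>\<^sub>\<mu> \<psi>\<^sup>\<tau> = 2 x\<^sub>\<mu> C\<close>.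
\<close>

lemma DERIV_psi_form:
  fixes p :: "('n::finite, 'm::{finite,linorder}) point"
  assumes "\<tau> \<noteq> \<mu> \<Longrightarrow> (xc \<mu> p)\<^sup>2 \<noteq> (xc \<tau> p)\<^sup>2"
  shows "((\<lambda>t. contract1 (psi_form \<tau> (p + t *\<^sub>R coord_vec \<mu>)) v) has_real_derivative
           log_slope p \<mu> \<tau> * (contract1 (psi_form \<tau> p) v - contract1 (psi_form \<mu> p) v)) (at 0)"
proof (cases "\<tau> = \<mu>")
  case True
  then show ?thesis unfolding contract1_psi_form by (simp add: sym_sum_along_x)
next
  case False
  define \<omega> where "\<omega> = (\<lambda>j. \<Sum>k | psi_no k = j. v $ Inr k)"
  let ?M = "- {\<mu>, \<tau>}" and ?\<omega>' = "\<lambda>j. \<omega> (Suc j)"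
  have ins: "- {\<tau>} = insert \<mu> ?M" "- {\<mu>} = insert \<tau> ?M" using False by auto
  have \<tau>: "contract1 (psi_form \<tau> q) v = sym_sum ?M \<omega> q + (xc \<mu> q)\<^sup>2 * sym_sum ?M ?\<omega>' q" for q
    unfolding contract1_psi_form ins(1) \<omega>_def[symmetric] by (rule sym_sum_insert) simp
  have \<mu>: "contract1 (psi_form \<mu> q) v = sym_sum ?M \<omega> q + (xc \<tau> q)\<^sup>2 * sym_sum ?M ?\<omega>' q" for q
    unfolding contract1_psi_form ins(2) \<omega>_def[symmetric] by (rule sym_sum_insert) simp
  have "((\<lambda>t. contract1 (psi_form \<tau> (p + t *\<^sub>R coord_vec \<mu>)) v) has_real_derivative
      2 * xc \<mu> p * sym_sum ?M ?\<omega>' p) (at 0)"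
    unfolding \<tau> by (auto intro!: derivative_eq_intros simp: sym_sum_along_x xc_along_x)
  also have "2 * xc \<mu> p * sym_sum ?M ?\<omega>' p = log_slope p \<mu> \<tau> * (contract1 (psi_form \<tau> p) v - contract1 (psi_form \<mu> p) v)"
    unfolding \<tau> \<mu> log_slope_def using assms False by (simp add: field_simps)
  finally show ?thesis .
qed

text \<open>
  Of all the factors of \<open>U\<^sub>\<nu> / X\<^sub>\<nu>\<close> only \<open>x\<^sub>\<mu>\<^sup>2 - x\<^sub>\<nu>\<^sup>2\<close> depends on \<open>x\<^sub>\<mu>\<close>.
\<close>

lemma DERIV_g_xx_other:
  fixes p :: "('n::finite, 'm::finite) point"
  assumes "\<mu> \<noteq> \<nu>" "(xc \<mu> p)\<^sup>2 \<noteq> (xc \<nu> p)\<^sup>2"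
  shows "((\<lambda>t. g_xx X \<nu> (p + t *\<^sub>R coord_vec \<mu>)) has_real_derivative log_slope p \<mu> \<nu> * g_xx X \<nu> p) (at 0)"
proof -
  define C where "C q = (\<Prod>\<kappa>\<in>UNIV - {\<nu>} - {\<mu>}. (xc \<kappa> q)\<^sup>2 - (xc \<nu> q)\<^sup>2) / X \<nu> (xc \<nu> q)"
    for q :: "('n, 'm) point"
  have eq: "g_xx X \<nu> q = ((xc \<mu> q)\<^sup>2 - (xc \<nu> q)\<^sup>2) * C q" for q
    unfolding g_xx_def C_def U_fun_def using assms(1) by (subst prod.remove[of _ \<mu>]) auto
  have C: "C (p + t *\<^sub>R coord_vec \<mu>) = C p" for t
    unfolding C_def using assms(1) by (intro arg_cong2[of _ _ _ _ "(/)"] prod.cong) (auto simp: xc_along_x)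
  have "((\<lambda>t. g_xx X \<nu> (p + t *\<^sub>R coord_vec \<mu>)) has_real_derivative 2 * xc \<mu> p * C p) (at 0)"
    unfolding eq C using assms(1) by (auto intro!: derivative_eq_intros simp: xc_along_x)
  also have "2 * xc \<mu> p * C p = log_slope p \<mu> \<nu> * g_xx X \<nu> p"
    unfolding eq log_slope_def using assms by simp
  finally show ?thesis .
qed

section \<open>Differentiability of the metric functions\<close>

lemma differentiable_prod:
  fixes f :: "'i \<Rightarrow> 'a::real_normed_vector \<Rightarrow> real"
  assumes "\<And>i. i \<in> I \<Longrightarrow> f i differentiable (at p)"
  shows "(\<lambda>q. \<Prod>i\<in>I. f i q) differentiable (at p)"
  using assms by (induction I rule: infinite_finite_induct) (simp_all add: differentiable_mult)

lemma differentiable_xc [simp]: "xc \<mu> differentiable (at p)"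
proof -
  have "bounded_linear (xc \<mu> :: ('a, 'b) point \<Rightarrow> real)"
    unfolding xc_def[abs_def] by (rule bounded_linear_vec_nth)
  then show ?thesis
    by (meson bounded_linear_imp_differentiable)
qed

lemma differentiable_A_fun [simp]: "A_fun k differentiable (at p)"
  unfolding A_fun_def[abs_def] by (intro differentiable_sum differentiable_prod differentiable_power ballI finite differentiable_xc)

lemma differentiable_U_fun [simp]: "U_fun \<mu> differentiable (at p)"
  unfolding U_fun_def[abs_def] by (intro differentiable_prod differentiable_diff differentiable_power differentiable_xc)

lemma differentiable_psi_form [simp]: "(\<lambda>q. psi_form \<mu> q a) differentiable (at p)"
  unfolding psi_form_def A_fun_at_def
  by (intro differentiable_sum differentiable_mult differentiable_prod differentiable_power ballI
      finite differentiable_xc differentiable_const)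

lemma differentiable_psi_form0 [simp]: "(\<lambda>q. psi_form0 q a) differentiable (at p)"
  unfolding psi_form0_def by (intro differentiable_sum differentiable_mult ballI finite differentiable_A_fun
      differentiable_const)

lemma differentiable_g_xx:
  assumes "X \<mu> differentiable (at (xc \<mu> p))" "X \<mu> (xc \<mu> p) \<noteq> 0"
  shows "g_xx X \<mu> differentiable (at p)"
  unfolding g_xx_def[abs_def]
  by (intro differentiable_divide differentiable_U_fun differentiable_compose[of "X \<mu>" "xc \<mu>"]) (simp_all add: assms)

section \<open>The dual frame at a point and its Christoffel symbols\<close>

lemma contract1_dcoord: "contract1 (dcoord i) u = u $ i"
  by (simp add: contract1_def dcoord_def if_distrib[of "\<lambda>x. x * _"] cong: if_cong)

lemma contract2_tensor2: "contract2 (tensor2 s t) u v = contract1 s u * contract1 t v"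
  by (simp add: contract2_def tensor2_def[abs_def] contract1_pull)

lemma contract2_kerr_metric:
  fixes q :: "('n::finite, 'm::{finite,linorder}) point"
  shows "contract2 (kerr_metric \<epsilon> c X q) u w =
   (\<Sum>\<mu>\<in>UNIV. g_xx X \<mu> q * u $ Inl \<mu> * w $ Inl \<mu>)
   + (\<Sum>\<mu>\<in>UNIV. 1 / g_xx X \<mu> q * contract1 (psi_form \<mu> q) u * contract1 (psi_form \<mu> q) w)
   + real \<epsilon> * (c / A_fun (CARD('n)) q) * contract1 (psi_form0 q) u * contract1 (psi_form0 q) w"
proof -
  have "contract2 (kerr_metric \<epsilon> c X q) u w =
     (\<Sum>\<mu>\<in>UNIV. U_fun \<mu> q / X \<mu> (xc \<mu> q) * contract2 (tensor2 (dcoord (Inl \<mu>)) (dcoord (Inl \<mu>))) u w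
              + X \<mu> (xc \<mu> q) / U_fun \<mu> q * contract2 (tensor2 (psi_form \<mu> q) (psi_form \<mu> q)) u w)
     + real \<epsilon> * (c / A_fun (CARD('n)) q) * contract2 (tensor2 (psi_form0 q) (psi_form0 q)) u w"
    unfolding kerr_metric_def contract2_def contract1_pull ..
  then show ?thesis
    by (simp add: contract2_tensor2 contract1_dcoord sum.distrib g_xx_def mult.assoc)
qed

locale kerr_point =
  fixes \<epsilon> :: nat and c :: real and X :: "'n::{finite,linorder} \<Rightarrow> real \<Rightarrow> real"
    and p :: "('n, 'm::{finite,linorder}) point"
  assumes eps: "\<epsilon> \<in> {0, 1}"
    and card_m: "CARD('m) = CARD('n) + \<epsilon>"
    and adm: "admissible \<epsilon> c X p"
    and X_diff: "\<And>\<mu>. X \<mu> differentiable (at (xc \<mu> p))"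
begin

abbreviation "g \<equiv> kerr_metric \<epsilon> c X"

lemma g_xx_pos: "g_xx X \<mu> p > 0"
  unfolding g_xx_def using adm by (rule admissible_U_over_X)

lemma g_xx_nz [simp]: "g_xx X \<mu> p \<noteq> 0"
  using g_xx_pos[of \<mu>] by simp

lemma X_nz: "X \<mu> (xc \<mu> p) \<noteq> 0"
  using adm unfolding admissible_def by blast

lemma A_fun_nz: "real \<epsilon> \<noteq> 0 \<Longrightarrow> A_fun (CARD('n)) p \<noteq> 0"
  using adm eps unfolding admissible_def by auto

lemma xc_sq_distinct:
  assumes "\<mu> \<noteq> \<nu>"
  shows "(xc \<mu> p)\<^sup>2 \<noteq> (xc \<nu> p)\<^sup>2"
proof -
  have "U_fun \<nu> p \<noteq> 0" using adm unfolding admissible_def by blast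
  with assms show ?thesis unfolding U_fun_def by auto
qed

lemma g_xx_diff [simp]: "g_xx X \<mu> differentiable (at p)"
  by (rule differentiable_g_xx[OF X_diff X_nz])

lemma eps_scale_diff [simp]: "(\<lambda>q. real \<epsilon> * (c / A_fun (CARD('n)) q)) differentiable (at p)"
proof (cases "real \<epsilon> = 0")
  case True
  show ?thesis unfolding True by simp
next
  case False
  then show ?thesis by (intro differentiable_mult differentiable_divide) (simp_all add: A_fun_nz)
qed

lemma psi_diff [simp]: "(\<lambda>q. contract1 (psi_form \<mu> q) u) differentiable (at p)"
  by (rule differentiable_contract1) simp

lemma psi0_diff [simp]: "(\<lambda>q. contract1 (psi_form0 q) u) differentiable (at p)"
  by (rule differentiable_contract1) simp

lemma metric_diff: "(\<lambda>q. contract2 (g q) u w) differentiable (at p)"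
  unfolding contract2_kerr_metric
  by (intro differentiable_add differentiable_sum differentiable_mult differentiable_divide
      psi_diff psi0_diff eps_scale_diff g_xx_diff g_xx_nz differentiable_const ballI finite)

lemma metric_comp_diff: "(\<lambda>q. g q a b) differentiable (at p)"
  using metric_diff[of "axis a 1" "axis b 1"] by (simp add: contract2_def contract1_axis)

lemma metric_sym: "g q a b = g q b a"
  by (simp add: kerr_metric_def tensor2_def mult.commute)

lemma metric_pos: "pos_def (g p)"
  using adm unfolding admissible_def by blast

text \<open>
  The metric is a combination of squares of the coframe and definite, so the coframe has no common
  zero besides \<open>0\<close>.
\<close>

lemma coframe_determines:
  assumes "\<And>\<mu>. u $ Inl \<mu> = 0" "\<And>\<mu>. contract1 (psi_form \<mu> p) u = 0" "real \<epsilon> * contract1 (psi_form0 p) u = 0"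
  shows "u = 0"
proof (rule ccontr)
  assume "u \<noteq> 0"
  then have "0 < (\<Sum>a\<in>UNIV. \<Sum>b\<in>UNIV. g p a b * u $ a * u $ b)"
    using metric_pos unfolding pos_def_def by blast
  also have "\<dots> = contract2 (g p) u u"
    by (simp add: contract2_def contract1_def sum_distrib_left mult_ac)
  also have "\<dots> = 0"
  proof -
    have "real \<epsilon> = 0 \<or> contract1 (psi_form0 p) u = 0" using assms(3) by simp
    then show ?thesis unfolding contract2_kerr_metric using assms(1,2) by auto
  qed
  finally show False by simp
qed

text \<open>
  The evaluations of the coframe form a linear map \<open>L\<close> of \<open>\<real>\<^sup>D\<close> to itself, once the \<open>\<psi>\<^sup>\<tau>\<close>, and \<open>\<psi>\<^sup>0\<close> for
  \<open>\<epsilon> = 1\<close>, have been labelled by \<open>'m\<close> through an injection of \<open>'n\<close> into \<open>'m\<close>. It is injective, hence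
  surjective, and preimages of basis vectors are the dual frame. Multiplying by \<open>\<epsilon>\<close> in the conditions on
  \<open>\<psi>\<^sup>0\<close> treats both values of \<open>\<epsilon>\<close> at once: for \<open>\<epsilon> = 0\<close> there is no index left for \<open>\<psi>\<^sup>0\<close>.
\<close>

lemma dual_frame_exists:
  obtains V :: "'n \<Rightarrow> real^('n + 'm)" and Z :: "real^('n + 'm)"
  where "\<And>\<sigma>. vertical (V \<sigma>)" "vertical Z"
    "\<And>\<sigma> \<tau>. contract1 (psi_form \<tau> p) (V \<sigma>) = of_bool (\<tau> = \<sigma>)" "\<And>\<tau>. contract1 (psi_form \<tau> p) Z = 0"
    "\<And>\<sigma>. real \<epsilon> * contract1 (psi_form0 p) (V \<sigma>) = 0"
    "real \<epsilon> * contract1 (psi_form0 p) Z = real \<epsilon>"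
proof -
  obtain \<iota> :: "'n \<Rightarrow> 'm" where inj: "inj \<iota>"
    using card_le_inj[of "UNIV :: 'n set" "UNIV :: 'm set"] card_m by auto
  define L :: "real^('n + 'm) \<Rightarrow> real^('n + 'm)" where
    "L u = (\<chi> i. case i of Inl \<mu> \<Rightarrow> u $ Inl \<mu>
        | Inr k \<Rightarrow> if k \<in> range \<iota> then contract1 (psi_form (inv \<iota> k) p) u else contract1 (psi_form0 p) u)" for u
  have lin: "linear L"
    by (rule linearI)
       (auto simp: L_def vec_eq_iff contract1_vec_add contract1_vec_scale split: sum.splits)
  have L_Inl: "L u $ Inl \<mu> = u $ Inl \<mu>" and L_psi: "L u $ Inr (\<iota> \<tau>) = contract1 (psi_form \<tau> p) u"
    and L_psi0: "k \<notin> range \<iota> \<Longrightarrow> L u $ Inr k = contract1 (psi_form0 p) u" for u \<mu> \<tau> k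
    using inj by (simp_all add: L_def)
  have card_range: "card (range \<iota>) = CARD('n)" using inj by (simp add: card_image)
  have free: "\<exists>k0. k0 \<notin> range \<iota>" if "\<epsilon> \<noteq> 0"
  proof -
    have "range \<iota> \<noteq> UNIV" using card_range card_m that by (metis add_cancel_right_right)
    then show ?thesis by auto
  qed
  have "inj L"
  proof (subst linear_injective_0[OF lin], intro allI impI)
    fix u assume 0: "L u = 0"
    have "real \<epsilon> * contract1 (psi_form0 p) u = 0"
    proof (cases "\<epsilon> = 0")
      case False
      then obtain k0 where "k0 \<notin> range \<iota>" using free by blast
      with 0 L_psi0[of k0 u] show ?thesis by simp
    qed simp
    moreover have "u $ Inl \<mu> = 0" "contract1 (psi_form \<mu> p) u = 0" for \<mu>
      using 0 L_Inl[of u \<mu>] L_psi[of u \<mu>] by simp_all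
    ultimately show "u = 0" by (intro coframe_determines)
  qed
  then have "surj L" using lin linear_injective_imp_surjective by blast
  then have "\<forall>i. \<exists>u. L u = axis i 1" by (metis surjD)
  then obtain W where W: "\<And>i. L (W i) = axis i 1" by metis
  define V where "V \<sigma> = W (Inr (\<iota> \<sigma>))" for \<sigma>
  have V_psi0: "real \<epsilon> * contract1 (psi_form0 p) (V \<sigma>) = 0" for \<sigma>
  proof (cases "\<epsilon> = 0")
    case False
    then obtain k0 where k0: "k0 \<notin> range \<iota>" using free by blast
    then have "k0 \<noteq> \<iota> \<sigma>" by blast
    with L_psi0[OF k0, of "V \<sigma>"] show ?thesis by (simp add: V_def W axis_def)
  qed simp
  have V: "vertical (V \<sigma>)" "contract1 (psi_form \<tau> p) (V \<sigma>) = of_bool (\<tau> = \<sigma>)" for \<sigma> \<tau>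
    using L_Inl[of "V \<sigma>"] L_psi[of "V \<sigma>" \<tau>] inj
    by (auto simp: vertical_def V_def W axis_def inj_eq)
  show ?thesis
  proof (cases "\<epsilon> = 0")
    case True
    show ?thesis
      by (rule that[of V 0]) (simp_all add: V V_psi0 True, simp_all add: vertical_def contract1_def)
  next
    case False
    then obtain k0 where k0: "k0 \<notin> range \<iota>" using free by blast
    show ?thesis
    proof (rule that[of V "W (Inr k0)"])
      show "vertical (W (Inr k0))" using L_Inl[of "W (Inr k0)"] by (auto simp: vertical_def W axis_def)
      show "contract1 (psi_form \<tau> p) (W (Inr k0)) = 0" for \<tau>
        using L_psi[of "W (Inr k0)" \<tau>] k0 by (auto simp: W axis_def split: if_splits)
      show "real \<epsilon> * contract1 (psi_form0 p) (W (Inr k0)) = real \<epsilon>"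
        using L_psi0[OF k0, of "W (Inr k0)"] by (simp add: W axis_def)
    qed (simp_all add: V V_psi0)
  qed
qed

end

text \<open>
  For \<open>\<epsilon> = 1\<close> the vector \<open>Z\<close> completes the frame as the dual of \<open>\<psi>\<^sup>0\<close>; for \<open>\<epsilon> = 0\<close> it enters with coefficient \<open>0\<close>.
\<close>

locale kerr_frame = kerr_point \<epsilon> c X p
  for \<epsilon> c and X :: "'n::{finite,linorder} \<Rightarrow> real \<Rightarrow> real"
    and p :: "('n, 'm::{finite,linorder}) point" +
  fixes V :: "'n \<Rightarrow> real^('n + 'm)" and Z :: "real^('n + 'm)"
  assumes V_vertical: "\<And>\<sigma>. vertical (V \<sigma>)" and Z_vertical: "vertical Z"
    and psi_V [simp]: "\<And>\<sigma> \<tau>. contract1 (psi_form \<tau> p) (V \<sigma>) = of_bool (\<tau> = \<sigma>)"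
    and psi_Z [simp]: "\<And>\<tau>. contract1 (psi_form \<tau> p) Z = 0"
    and psi0_V: "\<And>\<sigma>. real \<epsilon> * contract1 (psi_form0 p) (V \<sigma>) = 0"
    and psi0_Z: "real \<epsilon> * contract1 (psi_form0 p) Z = real \<epsilon>"
begin

lemma V_Inl [simp]: "V \<sigma> $ Inl \<mu> = 0" and Z_Inl [simp]: "Z $ Inl \<mu> = 0"
  using V_vertical[of \<sigma>] Z_vertical by (simp_all add: vertical_def)

lemma frame_expansion:
  "u = (\<Sum>\<kappa>\<in>UNIV. u $ Inl \<kappa> *\<^sub>R coord_vec \<kappa>) + (\<Sum>\<kappa>\<in>UNIV. contract1 (psi_form \<kappa> p) u *\<^sub>R V \<kappa>)
     + (real \<epsilon> * contract1 (psi_form0 p) u) *\<^sub>R Z"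
  (is "u = ?rhs")
proof -
  have "?rhs - u = 0"
  proof (rule coframe_determines)
    show "(?rhs - u) $ Inl \<mu> = 0" for \<mu> by simp
    show "contract1 (psi_form \<mu> p) (?rhs - u) = 0" for \<mu>
      by (simp add: linear_diff[OF linear_contract1] contract1_vec_add contract1_vec_scale contract1_vec_sum)
    show "real \<epsilon> * contract1 (psi_form0 p) (?rhs - u) = 0"
    proof (cases "\<epsilon> = 0")
      case False
      then have "contract1 (psi_form0 p) (V \<kappa>) = 0" "contract1 (psi_form0 p) Z = 1" "\<epsilon> = 1" for \<kappa>
        using eps psi0_V[of \<kappa>] psi0_Z by auto
      then show ?thesis
        by (simp add: linear_diff[OF linear_contract1] contract1_vec_add contract1_vec_scale contract1_vec_sum)
    qed simp
  qed
  then show ?thesis by simp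
qed

lemma g_x: "contract2 (g p) (coord_vec \<kappa>) u = g_xx X \<kappa> p * u $ Inl \<kappa>"
  unfolding contract2_kerr_metric by simp

lemma g_V: "contract2 (g p) (V \<kappa>) u = contract1 (psi_form \<kappa> p) u / g_xx X \<kappa> p"
proof -
  have "real \<epsilon> * (c / A_fun (CARD('n)) p) * contract1 (psi_form0 p) (V \<kappa>) * contract1 (psi_form0 p) u = 0"
    using psi0_V[of \<kappa>] by auto
  then show ?thesis unfolding contract2_kerr_metric psi_V sum_of_bool by simp
qed

definition d_g_xx :: "'n \<Rightarrow> 'n \<Rightarrow> real" where "d_g_xx \<mu> \<nu> = dir_deriv (coord_vec \<mu>) (g_xx X \<nu>) p"

lemma d_g_xx_other: "\<mu> \<noteq> \<nu> \<Longrightarrow> d_g_xx \<mu> \<nu> = log_slope p \<mu> \<nu> * g_xx X \<nu> p"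
  unfolding d_g_xx_def by (rule dir_derivI, rule DERIV_g_xx_other) (simp_all add: xc_sq_distinct)

text \<open>
  The derivative along \<open>x\<^sub>\<mu>\<close> at \<open>p\<close> of \<open>\<psi>\<^sup>\<tau>\<close> on the constant vector \<open>V\<^sub>\<sigma>\<close>.
\<close>

definition d_psi :: "'n \<Rightarrow> 'n \<Rightarrow> 'n \<Rightarrow> real" where
  "d_psi \<mu> \<tau> \<sigma> = log_slope p \<mu> \<tau> * (of_bool (\<tau> = \<sigma>) - of_bool (\<mu> = \<sigma>))"

lemma DERIV_psi_V:
  "((\<lambda>t. contract1 (psi_form \<tau> (p + t *\<^sub>R coord_vec \<mu>)) (V \<sigma>)) has_real_derivative d_psi \<mu> \<tau> \<sigma>) (at 0)"
  using DERIV_psi_form[of \<tau> \<mu> p "V \<sigma>"] xc_sq_distinct[of \<mu> \<tau>] by (auto simp: d_psi_def)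

text \<open>
  Both the metric and, later, the diagonal block of the tensor \<open>R\<close> are quadratic forms of this
  shape on the \<open>\<psi>\<close>-directions. The part in \<open>\<psi>\<^sup>0\<close> vanishes to second order at \<open>p\<close>, so its coefficient \<open>h\<close>
  leaves no trace; this is why the two values of \<open>\<epsilon>\<close> lead to the same equations.
\<close>

lemma dir_deriv_psi_quadratic:
  assumes f: "\<And>\<kappa>. f \<kappa> differentiable (at p)" and h: "h differentiable (at p)"
  shows "dir_deriv (coord_vec \<mu>) (\<lambda>q. (\<Sum>\<kappa>\<in>UNIV. f \<kappa> q * contract1 (psi_form \<kappa> q) (V \<sigma>) * contract1 (psi_form \<kappa> q) (V \<tau>))
       + real \<epsilon> * h q * contract1 (psi_form0 q) (V \<sigma>) * contract1 (psi_form0 q) (V \<tau>)) p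
     = of_bool (\<sigma> = \<tau>) * dir_deriv (coord_vec \<mu>) (f \<sigma>) p + f \<tau> p * d_psi \<mu> \<tau> \<sigma> + f \<sigma> p * d_psi \<mu> \<sigma> \<tau>"
proof -
  let ?D = "\<lambda>F. dir_deriv (coord_vec \<mu>) F p"
  let ?a = "contract1 (psi_form0 p) (V \<sigma>)" and ?b = "contract1 (psi_form0 p) (V \<tau>)"
  let ?a' = "?D (\<lambda>q. contract1 (psi_form0 q) (V \<sigma>))" and ?b' = "?D (\<lambda>q. contract1 (psi_form0 q) (V \<tau>))"
  let ?q = "\<lambda>t::real. p + t *\<^sub>R coord_vec \<mu>"
  have df: "((\<lambda>t. f \<kappa> (?q t)) has_real_derivative ?D (f \<kappa>)) (at 0)" for \<kappa>
    by (rule differentiable_has_dir_deriv[OF f])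
  have dh: "((\<lambda>t. h (?q t)) has_real_derivative ?D h) (at 0)"
    by (rule differentiable_has_dir_deriv[OF h])
  have d0: "((\<lambda>t. contract1 (psi_form0 (?q t)) v) has_real_derivative ?D (\<lambda>q. contract1 (psi_form0 q) v)) (at 0)" for v
    by (rule differentiable_has_dir_deriv) simp
  let ?t = "\<lambda>\<kappa>. (?D (f \<kappa>) * of_bool (\<kappa> = \<sigma>) + d_psi \<mu> \<kappa> \<sigma> * f \<kappa> p) * of_bool (\<kappa> = \<tau>)
        + d_psi \<mu> \<kappa> \<tau> * f \<kappa> p * of_bool (\<kappa> = \<sigma>)"
  let ?e = "real \<epsilon> * ((?D h * ?a + ?a' * h p) * ?b + ?b' * (h p * ?a))"
  have summand: "((\<lambda>t. f \<kappa> (?q t) * contract1 (psi_form \<kappa> (?q t)) (V \<sigma>) * contract1 (psi_form \<kappa> (?q t)) (V \<tau>))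
      has_real_derivative ?t \<kappa>) (at 0)" for \<kappa>
    using DERIV_mult[OF DERIV_mult[OF df[of \<kappa>] DERIV_psi_V[of \<kappa> \<mu> \<sigma>]] DERIV_psi_V[of \<kappa> \<mu> \<tau>]]
    by (simp add: mult.assoc)
  have extra: "((\<lambda>t. real \<epsilon> * (h (?q t) * contract1 (psi_form0 (?q t)) (V \<sigma>) * contract1 (psi_form0 (?q t)) (V \<tau>)))
      has_real_derivative ?e) (at 0)"
    using DERIV_cmult[OF DERIV_mult[OF DERIV_mult[OF dh d0[of "V \<sigma>"]] d0[of "V \<tau>"]]] by simp
  have "((\<lambda>t. (\<Sum>\<kappa>\<in>UNIV. f \<kappa> (?q t) * contract1 (psi_form \<kappa> (?q t)) (V \<sigma>) * contract1 (psi_form \<kappa> (?q t)) (V \<tau>))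
       + real \<epsilon> * (h (?q t) * contract1 (psi_form0 (?q t)) (V \<sigma>) * contract1 (psi_form0 (?q t)) (V \<tau>)))
    has_real_derivative (\<Sum>\<kappa>\<in>UNIV. ?t \<kappa>) + ?e) (at 0)"
    by (intro DERIV_add DERIV_sum summand extra)
  also have "?e = 0"
    using psi0_V[of \<sigma>] psi0_V[of \<tau>] by auto
  also have "(\<Sum>\<kappa>\<in>UNIV. ?t \<kappa>) + 0
     = of_bool (\<sigma> = \<tau>) * ?D (f \<sigma>) + f \<tau> p * d_psi \<mu> \<tau> \<sigma> + f \<sigma> p * d_psi \<mu> \<sigma> \<tau>"
    unfolding sum.distrib sum_of_bool by auto
  finally show ?thesis by (intro dir_derivI) (simp add: mult.assoc)
qed

text \<open>
  The derivatives of the metric on the frame at \<open>p\<close>, and with them the frame components of the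
  Christoffel symbols. The component of \<open>\<Gamma>\<close> along \<open>Z\<close> drops out later, by \<open>curv_Z\<close>.
\<close>

lemma dir_deriv_g_xx: "dir_deriv (coord_vec \<mu>) (\<lambda>q. contract2 (g q) (coord_vec \<alpha>) (coord_vec \<beta>)) p = of_bool (\<alpha> = \<beta>) * d_g_xx \<mu> \<alpha>"
proof -
  have eq: "contract2 (g q) (coord_vec \<alpha>) (coord_vec \<beta>) = of_bool (\<alpha> = \<beta>) * g_xx X \<alpha> q" for q
    unfolding contract2_kerr_metric by simp
  show ?thesis
    unfolding d_g_xx_def eq
    using DERIV_cmult[OF differentiable_has_dir_deriv(1)[OF g_xx_diff[of \<alpha>], of "coord_vec \<mu>"], of "of_bool (\<alpha> = \<beta>)"]
    by (rule dir_derivI)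
qed

lemma dir_deriv_g_xv:
  assumes "vertical v"
  shows "dir_deriv u (\<lambda>q. contract2 (g q) (coord_vec \<alpha>) v) p = 0" "dir_deriv u (\<lambda>q. contract2 (g q) v (coord_vec \<alpha>)) p = 0"
proof -
  have "contract2 (g q) (coord_vec \<alpha>) v = 0" "contract2 (g q) v (coord_vec \<alpha>) = 0" for q
    using assms unfolding contract2_kerr_metric vertical_def by simp_all
  then show "dir_deriv u (\<lambda>q. contract2 (g q) (coord_vec \<alpha>) v) p = 0" "dir_deriv u (\<lambda>q. contract2 (g q) v (coord_vec \<alpha>)) p = 0"
    by (auto intro!: dir_derivI)
qed

lemma dir_deriv_g_vertical: "vertical v \<Longrightarrow> dir_deriv v (\<lambda>q. contract2 (g q) u w) p = 0"
  by (rule dir_derivI) (simp add: kerr_metric_along_vertical)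

definition d_g_VV :: "'n \<Rightarrow> 'n \<Rightarrow> 'n \<Rightarrow> real" where
  "d_g_VV \<mu> \<sigma> \<tau> = - of_bool (\<sigma> = \<tau>) * d_g_xx \<mu> \<sigma> / (g_xx X \<sigma> p)\<^sup>2 + d_psi \<mu> \<tau> \<sigma> / g_xx X \<tau> p + d_psi \<mu> \<sigma> \<tau> / g_xx X \<sigma> p"

lemma dir_deriv_g_VV: "dir_deriv (coord_vec \<mu>) (\<lambda>q. contract2 (g q) (V \<sigma>) (V \<tau>)) p = d_g_VV \<mu> \<sigma> \<tau>"
proof -
  have inv: "dir_deriv (coord_vec \<mu>) (\<lambda>q. 1 / g_xx X \<kappa> q) p = - d_g_xx \<mu> \<kappa> / (g_xx X \<kappa> p)\<^sup>2" for \<kappa>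
    unfolding d_g_xx_def
    using DERIV_inverse_fun[OF differentiable_has_dir_deriv(1)[OF g_xx_diff[of \<kappa>], of "coord_vec \<mu>"]]
    by (intro dir_derivI) (simp add: field_simps power2_eq_square)
  have "dir_deriv (coord_vec \<mu>) (\<lambda>q. contract2 (g q) (V \<sigma>) (V \<tau>)) p =
    dir_deriv (coord_vec \<mu>) (\<lambda>q. (\<Sum>\<kappa>\<in>UNIV. 1 / g_xx X \<kappa> q * contract1 (psi_form \<kappa> q) (V \<sigma>) * contract1 (psi_form \<kappa> q) (V \<tau>))
       + real \<epsilon> * (real \<epsilon> * (c / A_fun (CARD('n)) q)) * contract1 (psi_form0 q) (V \<sigma>) * contract1 (psi_form0 q) (V \<tau>)) p"
    using eps by (elim insertE) (simp_all add: contract2_kerr_metric)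
  also have "\<dots> = d_g_VV \<mu> \<sigma> \<tau>"
    using eps_scale_diff by (subst dir_deriv_psi_quadratic) (simp_all add: d_g_VV_def inv differentiable_divide)
  finally show ?thesis .
qed

abbreviation "\<Gamma> \<equiv> christoffel_vec g p"

lemma \<Gamma>_low: "contract2 (g p) z (\<Gamma> u w) =
    1/2 * (dir_deriv u (\<lambda>q. contract2 (g q) z w) p + dir_deriv w (\<lambda>q. contract2 (g q) z u) p
           - dir_deriv z (\<lambda>q. contract2 (g q) u w) p)"
  by (rule christoffel_vec_lowered[where g = g, OF metric_sym metric_pos metric_comp_diff])

lemma \<Gamma>_Inl: "\<Gamma> u w $ Inl \<kappa> = contract2 (g p) (coord_vec \<kappa>) (\<Gamma> u w) / g_xx X \<kappa> p"
  by (simp add: g_x)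

lemma \<Gamma>_psi: "contract1 (psi_form \<kappa> p) (\<Gamma> u w) = contract2 (g p) (V \<kappa>) (\<Gamma> u w) * g_xx X \<kappa> p"
  by (simp add: g_V)

lemma \<Gamma>_xx: "\<Gamma> (coord_vec \<alpha>) (coord_vec \<beta>) $ Inl \<kappa> =
     (of_bool (\<kappa> = \<beta>) * d_g_xx \<alpha> \<kappa> + of_bool (\<kappa> = \<alpha>) * d_g_xx \<beta> \<kappa> - of_bool (\<alpha> = \<beta>) * d_g_xx \<kappa> \<alpha>) / (2 * g_xx X \<kappa> p)"
   "contract1 (psi_form \<kappa> p) (\<Gamma> (coord_vec \<alpha>) (coord_vec \<beta>)) = 0"
  by (simp_all add: \<Gamma>_Inl \<Gamma>_psi \<Gamma>_low dir_deriv_g_xx dir_deriv_g_xv V_vertical dir_deriv_g_vertical)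

lemma \<Gamma>_xV: "\<Gamma> (coord_vec \<alpha>) (V \<sigma>) $ Inl \<kappa> = 0" "\<Gamma> (V \<sigma>) (coord_vec \<alpha>) $ Inl \<kappa> = 0"
   "contract1 (psi_form \<kappa> p) (\<Gamma> (coord_vec \<alpha>) (V \<sigma>)) = d_g_VV \<alpha> \<kappa> \<sigma> * g_xx X \<kappa> p / 2"
   "contract1 (psi_form \<kappa> p) (\<Gamma> (V \<sigma>) (coord_vec \<alpha>)) = d_g_VV \<alpha> \<kappa> \<sigma> * g_xx X \<kappa> p / 2"
  by (simp_all add: \<Gamma>_Inl \<Gamma>_psi \<Gamma>_low dir_deriv_g_xv dir_deriv_g_VV V_vertical dir_deriv_g_vertical)

lemma \<Gamma>_VV: "\<Gamma> (V \<sigma>) (V \<tau>) $ Inl \<kappa> = - d_g_VV \<kappa> \<sigma> \<tau> / (2 * g_xx X \<kappa> p)"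
   "contract1 (psi_form \<kappa> p) (\<Gamma> (V \<sigma>) (V \<tau>)) = 0"
  by (simp_all add: \<Gamma>_Inl \<Gamma>_psi \<Gamma>_low dir_deriv_g_xv dir_deriv_g_VV V_vertical dir_deriv_g_vertical)

text \<open>
  A tensor that annihilates \<open>Z\<close> in one slot sees only the \<open>\<partial>\<^sub>\<kappa>\<close>- and \<open>V\<^sub>\<kappa>\<close>-components of a vector there.
\<close>

lemma contract4_third_frame:
  assumes "contract4 T a b Z z = 0"
  shows "contract4 T a b u z = (\<Sum>\<kappa>\<in>UNIV. u $ Inl \<kappa> * contract4 T a b (coord_vec \<kappa>) z)
      + (\<Sum>\<kappa>\<in>UNIV. contract1 (psi_form \<kappa> p) u * contract4 T a b (V \<kappa>) z)"
  by (subst frame_expansion[of u]) (simp add: contract4_vec_third contract4_vec_third_sum assms)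

lemma contract4_fourth_frame:
  assumes "contract4 T a b z Z = 0"
  shows "contract4 T a b z u = (\<Sum>\<kappa>\<in>UNIV. u $ Inl \<kappa> * contract4 T a b z (coord_vec \<kappa>))
      + (\<Sum>\<kappa>\<in>UNIV. contract1 (psi_form \<kappa> p) u * contract4 T a b z (V \<kappa>))"
  by (subst frame_expansion[of u]) (simp add: contract4_vec_fourth contract4_vec_fourth_sum assms)

end

section \<open>Tensors of totally zero weight on vectors\<close>

lemma contract4_odot_anti:
  "contract4 (odot_anti h f) u v w z =
     1/4 * contract2 h u v * contract2 f w z + 1/4 * contract2 f u v * contract2 h w z
     + 1/8 * contract2 h u w * contract2 f v z + 1/8 * contract2 f u w * contract2 h v z
     - 1/8 * contract2 h u z * contract2 f v w - 1/8 * contract2 f u z * contract2 h v w"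
  unfolding contract4_eq odot_anti_def contract2_def contract1_pull by (simp add: mult_ac)

lemma contract4_odot_sym:
  "contract4 (odot_sym Q k) u v w z =
     1/8 * contract2 Q u z * contract2 k v w + 1/8 * contract2 k u z * contract2 Q v w
     - 1/8 * contract2 Q u w * contract2 k v z - 1/8 * contract2 k u w * contract2 Q v z"
  unfolding contract4_eq odot_sym_def contract2_def contract1_pull by (simp add: mult_ac)

lemma contract2_h_form:
  assumes "admissible \<epsilon> c X q"
  shows "contract2 (h_form X \<mu> q) u v = u $ Inl \<mu> * contract1 (psi_form \<mu> q) v - contract1 (psi_form \<mu> q) u * v $ Inl \<mu>"
proof -
  let ?s = "sqrt (U_fun \<mu> q / X \<mu> (xc \<mu> q))" and ?t = "sqrt (X \<mu> (xc \<mu> q) / U_fun \<mu> q)"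
  have st: "?s * ?t = 1"
    using admissible_U_over_X[OF assms, of \<mu>]
    by (simp add: real_sqrt_mult[symmetric] field_simps) (auto simp: zero_less_divide_iff)
  have "contract2 (h_form X \<mu> q) u v = ?s * u $ Inl \<mu> * (?t * contract1 (psi_form \<mu> q) v) - ?t * contract1 (psi_form \<mu> q) u * (?s * v $ Inl \<mu>)"
    unfolding h_form_def tensor2_def e_form_def eh_form_def contract2_def contract1_pull contract1_dcoord ..
  also have "\<dots> = (?s * ?t) * (u $ Inl \<mu> * contract1 (psi_form \<mu> q) v - contract1 (psi_form \<mu> q) u * v $ Inl \<mu>)"
    by (simp add: algebra_simps)
  finally show ?thesis unfolding st by simp
qed

lemma contract2_Q_form:
  assumes "admissible \<epsilon> c X q"
  shows "contract2 (Q_form X \<mu> q) u v = g_xx X \<mu> q * u $ Inl \<mu> * v $ Inl \<mu>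
      + 1 / g_xx X \<mu> q * contract1 (psi_form \<mu> q) u * contract1 (psi_form \<mu> q) v"
proof -
  let ?s = "sqrt (U_fun \<mu> q / X \<mu> (xc \<mu> q))" and ?t = "sqrt (X \<mu> (xc \<mu> q) / U_fun \<mu> q)"
  have pos: "g_xx X \<mu> q > 0"
    unfolding g_xx_def using admissible_U_over_X[OF assms] .
  have t: "X \<mu> (xc \<mu> q) / U_fun \<mu> q = 1 / g_xx X \<mu> q" by (simp add: g_xx_def)
  have ss: "?s * ?s = g_xx X \<mu> q" "?t * ?t = 1 / g_xx X \<mu> q"
    unfolding t using pos by (simp_all add: g_xx_def[symmetric])
  have "contract2 (Q_form X \<mu> q) u v = ?s * u $ Inl \<mu> * (?s * v $ Inl \<mu>) + ?t * contract1 (psi_form \<mu> q) u * (?t * contract1 (psi_form \<mu> q) v)"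
    unfolding Q_form_def tensor2_def e_form_def eh_form_def contract2_def contract1_pull contract1_dcoord ..
  also have "\<dots> = (?s * ?s) * u $ Inl \<mu> * v $ Inl \<mu> + (?t * ?t) * contract1 (psi_form \<mu> q) u * contract1 (psi_form \<mu> q) v"
    by (simp only: mult_ac)
  finally show ?thesis unfolding ss .
qed

text \<open>
  The values of \<open>h_form\<close> and \<open>Q_form\<close> on vectors without the square roots, hence differentiable functions of
  the point.
\<close>

definition h_val :: "'n \<Rightarrow> ('n::finite, 'm::{finite,linorder}) point \<Rightarrow> real^('n + 'm) \<Rightarrow> real^('n + 'm) \<Rightarrow> real" where
  "h_val \<kappa> q u v = u $ Inl \<kappa> * contract1 (psi_form \<kappa> q) v - contract1 (psi_form \<kappa> q) u * v $ Inl \<kappa>"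

definition Q_val :: "('n \<Rightarrow> real \<Rightarrow> real) \<Rightarrow> 'n \<Rightarrow> ('n::finite, 'm::{finite,linorder}) point \<Rightarrow> real^('n + 'm) \<Rightarrow> real^('n + 'm) \<Rightarrow> real" where
  "Q_val X \<kappa> q u v = g_xx X \<kappa> q * u $ Inl \<kappa> * v $ Inl \<kappa>
      + 1 / g_xx X \<kappa> q * contract1 (psi_form \<kappa> q) u * contract1 (psi_form \<kappa> q) v"

text \<open>
  The sum over \<open>\<kappa> < \<rho>\<close> with a symmetric summand becomes half of a double sum, and the diagonal terms with
  \<open>\<Omega> \<kappa> \<kappa>\<close>, which carry the factor \<open>1/2\<close> already, complete it. Writing the metric in \<open>Q\<^sub>\<epsilon>\<close> as the sum of the
  \<open>Q\<^sub>\<rho>\<close> and a multiple of the square of \<open>\<psi>\<^sup>0\<close> merges \<open>\<alpha>\<epsilon>\<close> with \<open>\<alpha>\<close> in the coefficient \<open>M\<close>. The factor \<open>-8\<close> clears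
  the denominators and the sign in \<open>odot_sym\<close>.
\<close>

lemma contract4_zero_weight_tensor:
  fixes q :: "('n::{finite,linorder}, 'm::{finite,linorder}) point"
  assumes adm: "admissible \<epsilon> c X q"
    and eps: "\<And>\<kappa>. real \<epsilon> * \<alpha>\<epsilon> \<kappa> q = \<alpha>\<epsilon> \<kappa> q"
    and sym: "\<And>\<kappa> \<rho>. \<kappa> \<noteq> \<rho> \<Longrightarrow> \<Omega> \<rho> \<kappa> q = \<Omega> \<kappa> \<rho> q" "\<And>\<kappa> \<rho>. \<kappa> \<noteq> \<rho> \<Longrightarrow> \<alpha> \<rho> \<kappa> q = \<alpha> \<kappa> \<rho> q"
    and M: "\<And>\<kappa> \<rho>. M \<kappa> \<rho> = (if \<kappa> = \<rho> then 0 else \<alpha> \<kappa> \<rho> q) + \<alpha>\<epsilon> \<kappa> q + \<alpha>\<epsilon> \<rho> q"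
  defines "h \<equiv> \<lambda>\<kappa>. contract2 (h_form X \<kappa> q)" and "Q \<equiv> \<lambda>\<kappa>. contract2 (Q_form X \<kappa> q)"
    and "s \<equiv> contract1 (psi_form0 q)"
  shows "- 8 * contract4 (zero_weight_tensor \<epsilon> c X \<Omega> \<alpha> \<alpha>\<epsilon> q) u v w z =
    (\<Sum>\<kappa>\<in>UNIV. \<Sum>\<rho>\<in>UNIV. \<Omega> \<kappa> \<rho> q * (h \<kappa> u z * h \<rho> v w - h \<kappa> u w * h \<rho> v z - 2 * h \<kappa> u v * h \<rho> w z))
    + (\<Sum>\<kappa>\<in>UNIV. \<Sum>\<rho>\<in>UNIV. M \<kappa> \<rho> * (Q \<kappa> u w * Q \<rho> v z - Q \<kappa> u z * Q \<rho> v w))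
    + (\<Sum>\<kappa>\<in>UNIV. \<alpha>\<epsilon> \<kappa> q * (c / A_fun (CARD('n)) q) *
        (Q \<kappa> u w * (s v * s z) + Q \<kappa> v z * (s u * s w) - Q \<kappa> u z * (s v * s w) - Q \<kappa> v w * (s u * s z)))"
proof -
  define F where "F \<kappa> \<rho> = h \<kappa> u z * h \<rho> v w - h \<kappa> u w * h \<rho> v z - 2 * h \<kappa> u v * h \<rho> w z" for \<kappa> \<rho>
  define P where "P \<kappa> \<rho> = Q \<kappa> u w * Q \<rho> v z - Q \<kappa> u z * Q \<rho> v w" for \<kappa> \<rho>
  define E where "E \<kappa> = Q \<kappa> u w * (s v * s z) + Q \<kappa> v z * (s u * s w) - Q \<kappa> u z * (s v * s w) - Q \<kappa> v w * (s u * s z)" for \<kappa>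
  let ?g = "contract2 (kerr_metric \<epsilon> c X q)" and ?C = "real \<epsilon> * (c / A_fun (CARD('n)) q)"
  have g: "?g a b = (\<Sum>\<kappa>\<in>UNIV. Q \<kappa> a b) + ?C * (s a * s b)" for a b
    unfolding Q_def s_def contract2_Q_form[OF adm] contract2_kerr_metric sum.distrib by simp
  have Pg: "Q \<kappa> u w * ?g v z + Q \<kappa> v z * ?g u w - Q \<kappa> u z * ?g v w - Q \<kappa> v w * ?g u z
      = (\<Sum>\<rho>\<in>UNIV. P \<kappa> \<rho> + P \<rho> \<kappa>) + ?C * E \<kappa>" for \<kappa>
  proof -
    have "(\<Sum>\<rho>\<in>UNIV. P \<kappa> \<rho> + P \<rho> \<kappa>) = Q \<kappa> u w * (\<Sum>\<rho>\<in>UNIV. Q \<rho> v z) - Q \<kappa> u z * (\<Sum>\<rho>\<in>UNIV. Q \<rho> v w)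
        + (\<Sum>\<rho>\<in>UNIV. Q \<rho> u w) * Q \<kappa> v z - (\<Sum>\<rho>\<in>UNIV. Q \<rho> u z) * Q \<kappa> v w"
      unfolding P_def by (simp add: sum.distrib sum_subtractf sum_distrib_left sum_distrib_right)
    then show ?thesis unfolding g E_def by (simp add: algebra_simps)
  qed
  have anti: "- 8 * contract4 (odot_anti (h_form X \<kappa> q) (h_form X \<rho> q)) u v w z = F \<kappa> \<rho> + F \<rho> \<kappa>" for \<kappa> \<rho>
    unfolding contract4_odot_anti F_def h_def by (simp add: algebra_simps)
  have symQ: "- 8 * contract4 (odot_sym (Q_form X \<kappa> q) (Q_form X \<rho> q)) u v w z = P \<kappa> \<rho> + P \<rho> \<kappa>" for \<kappa> \<rho>
    unfolding contract4_odot_sym P_def Q_def by (simp add: algebra_simps)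
  have Qe: "contract2 (Q_eps_form \<epsilon> c X q) a b = real \<epsilon> * ?g a b" for a b
    unfolding Q_eps_form_def contract2_def contract1_pull ..
  have symg: "\<alpha>\<epsilon> \<kappa> q * (- 8 * contract4 (odot_sym (Q_form X \<kappa> q) (Q_eps_form \<epsilon> c X q)) u v w z)
      = \<alpha>\<epsilon> \<kappa> q * (\<Sum>\<rho>\<in>UNIV. P \<kappa> \<rho> + P \<rho> \<kappa>) + \<alpha>\<epsilon> \<kappa> q * (c / A_fun (CARD('n)) q) * E \<kappa>" for \<kappa>
  proof -
    have "- 8 * contract4 (odot_sym (Q_form X \<kappa> q) (Q_eps_form \<epsilon> c X q)) u v w z =
      real \<epsilon> * (Q \<kappa> u w * ?g v z + Q \<kappa> v z * ?g u w - Q \<kappa> u z * ?g v w - Q \<kappa> v w * ?g u z)"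
      unfolding contract4_odot_sym Qe Q_def by (simp add: algebra_simps)
    then have "\<alpha>\<epsilon> \<kappa> q * (- 8 * contract4 (odot_sym (Q_form X \<kappa> q) (Q_eps_form \<epsilon> c X q)) u v w z) =
      (real \<epsilon> * \<alpha>\<epsilon> \<kappa> q) * (\<Sum>\<rho>\<in>UNIV. P \<kappa> \<rho> + P \<rho> \<kappa>) + (real \<epsilon> * (real \<epsilon> * \<alpha>\<epsilon> \<kappa> q)) * (c / A_fun (CARD('n)) q) * E \<kappa>"
      unfolding Pg by (simp add: algebra_simps)
    then show ?thesis unfolding eps .
  qed
  have "- 8 * contract4 (zero_weight_tensor \<epsilon> c X \<Omega> \<alpha> \<alpha>\<epsilon> q) u v w z =
     (\<Sum>(\<kappa>, \<rho>)\<in>{(\<kappa>, \<rho>). \<kappa> < \<rho>}. \<Omega> \<kappa> \<rho> q * (F \<kappa> \<rho> + F \<rho> \<kappa>) + \<alpha> \<kappa> \<rho> q * (P \<kappa> \<rho> + P \<rho> \<kappa>))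
     + (\<Sum>\<kappa>\<in>UNIV. 1/2 * \<Omega> \<kappa> \<kappa> q * (F \<kappa> \<kappa> + F \<kappa> \<kappa>)
         + (\<alpha>\<epsilon> \<kappa> q * (\<Sum>\<rho>\<in>UNIV. P \<kappa> \<rho> + P \<rho> \<kappa>) + \<alpha>\<epsilon> \<kappa> q * (c / A_fun (CARD('n)) q) * E \<kappa>))"
  proof -
    have "contract4 (zero_weight_tensor \<epsilon> c X \<Omega> \<alpha> \<alpha>\<epsilon> q) u v w z =
       (\<Sum>i\<in>{(\<kappa>, \<rho>). \<kappa> < \<rho>}.
           \<Omega> (fst i) (snd i) q * contract4 (odot_anti (h_form X (fst i) q) (h_form X (snd i) q)) u v w z
         + \<alpha> (fst i) (snd i) q * contract4 (odot_sym (Q_form X (fst i) q) (Q_form X (snd i) q)) u v w z)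
       + (\<Sum>\<kappa>\<in>UNIV. 1/2 * \<Omega> \<kappa> \<kappa> q * contract4 (odot_anti (h_form X \<kappa> q) (h_form X \<kappa> q)) u v w z
         + \<alpha>\<epsilon> \<kappa> q * contract4 (odot_sym (Q_form X \<kappa> q) (Q_eps_form \<epsilon> c X q)) u v w z)"
      unfolding zero_weight_tensor_def contract4_eq split_def contract1_pull ..
    then have "- 8 * contract4 (zero_weight_tensor \<epsilon> c X \<Omega> \<alpha> \<alpha>\<epsilon> q) u v w z =
       (\<Sum>i\<in>{(\<kappa>, \<rho>). \<kappa> < \<rho>}.
           \<Omega> (fst i) (snd i) q * (- 8 * contract4 (odot_anti (h_form X (fst i) q) (h_form X (snd i) q)) u v w z)
         + \<alpha> (fst i) (snd i) q * (- 8 * contract4 (odot_sym (Q_form X (fst i) q) (Q_form X (snd i) q)) u v w z))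
       + (\<Sum>\<kappa>\<in>UNIV. 1/2 * \<Omega> \<kappa> \<kappa> q * (- 8 * contract4 (odot_anti (h_form X \<kappa> q) (h_form X \<kappa> q)) u v w z)
         + \<alpha>\<epsilon> \<kappa> q * (- 8 * contract4 (odot_sym (Q_form X \<kappa> q) (Q_eps_form \<epsilon> c X q)) u v w z))"
      by (simp only: sum_distrib_left distrib_left mult.left_commute[of "- 8"])
    then show ?thesis unfolding anti symQ symg split_def .
  qed
  also have "\<dots> = ((\<Sum>(\<kappa>, \<rho>)\<in>{(\<kappa>, \<rho>). \<kappa> < \<rho>}. \<Omega> \<kappa> \<rho> q * F \<kappa> \<rho> + \<Omega> \<rho> \<kappa> q * F \<rho> \<kappa>) + (\<Sum>\<kappa>\<in>UNIV. \<Omega> \<kappa> \<kappa> q * F \<kappa> \<kappa>))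
     + ((\<Sum>(\<kappa>, \<rho>)\<in>{(\<kappa>, \<rho>). \<kappa> < \<rho>}. (if \<kappa> = \<rho> then 0 else \<alpha> \<kappa> \<rho> q) * P \<kappa> \<rho> + (if \<rho> = \<kappa> then 0 else \<alpha> \<rho> \<kappa> q) * P \<rho> \<kappa>)
        + (\<Sum>\<kappa>\<in>UNIV. (if \<kappa> = \<kappa> then 0 else \<alpha> \<kappa> \<kappa> q) * P \<kappa> \<kappa>))
     + (\<Sum>\<kappa>\<in>UNIV. \<alpha>\<epsilon> \<kappa> q * (\<Sum>\<rho>\<in>UNIV. P \<kappa> \<rho> + P \<rho> \<kappa>)) + (\<Sum>\<kappa>\<in>UNIV. \<alpha>\<epsilon> \<kappa> q * (c / A_fun (CARD('n)) q) * E \<kappa>)"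
  proof -
    have "(\<Sum>(\<kappa>, \<rho>)\<in>{(\<kappa>, \<rho>). \<kappa> < \<rho>}. \<Omega> \<kappa> \<rho> q * (F \<kappa> \<rho> + F \<rho> \<kappa>) + \<alpha> \<kappa> \<rho> q * (P \<kappa> \<rho> + P \<rho> \<kappa>))
      = (\<Sum>(\<kappa>, \<rho>)\<in>{(\<kappa>, \<rho>). \<kappa> < \<rho>}. (\<Omega> \<kappa> \<rho> q * F \<kappa> \<rho> + \<Omega> \<rho> \<kappa> q * F \<rho> \<kappa>)
        + ((if \<kappa> = \<rho> then 0 else \<alpha> \<kappa> \<rho> q) * P \<kappa> \<rho> + (if \<rho> = \<kappa> then 0 else \<alpha> \<rho> \<kappa> q) * P \<rho> \<kappa>))"
    proof (rule sum.cong[OF refl], clarify)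
      fix \<kappa> \<rho> :: 'n assume "\<kappa> < \<rho>"
      then show "\<Omega> \<kappa> \<rho> q * (F \<kappa> \<rho> + F \<rho> \<kappa>) + \<alpha> \<kappa> \<rho> q * (P \<kappa> \<rho> + P \<rho> \<kappa>)
          = (\<Omega> \<kappa> \<rho> q * F \<kappa> \<rho> + \<Omega> \<rho> \<kappa> q * F \<rho> \<kappa>)
        + ((if \<kappa> = \<rho> then 0 else \<alpha> \<kappa> \<rho> q) * P \<kappa> \<rho> + (if \<rho> = \<kappa> then 0 else \<alpha> \<rho> \<kappa> q) * P \<rho> \<kappa>)"
        using sym[of \<kappa> \<rho>] by (simp add: algebra_simps)
    qed
    then show ?thesis by (simp add: sum.distrib split_def)
  qed
  also have "\<dots> = (\<Sum>\<kappa>\<in>UNIV. \<Sum>\<rho>\<in>UNIV. \<Omega> \<kappa> \<rho> q * F \<kappa> \<rho>)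
      + ((\<Sum>\<kappa>\<in>UNIV. \<Sum>\<rho>\<in>UNIV. (if \<kappa> = \<rho> then 0 else \<alpha> \<kappa> \<rho> q) * P \<kappa> \<rho>)
         + (\<Sum>\<kappa>\<in>UNIV. \<alpha>\<epsilon> \<kappa> q * (\<Sum>\<rho>\<in>UNIV. P \<kappa> \<rho> + P \<rho> \<kappa>)))
      + (\<Sum>\<kappa>\<in>UNIV. \<alpha>\<epsilon> \<kappa> q * (c / A_fun (CARD('n)) q) * E \<kappa>)"
    unfolding sum_pairs_symmetrised[of "\<lambda>\<kappa> \<rho>. \<Omega> \<kappa> \<rho> q * F \<kappa> \<rho>"]
      sum_pairs_symmetrised[of "\<lambda>\<kappa> \<rho>. (if \<kappa> = \<rho> then 0 else \<alpha> \<kappa> \<rho> q) * P \<kappa> \<rho>"] by (simp only: add.assoc)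
  also have "(\<Sum>\<kappa>\<in>UNIV. \<Sum>\<rho>\<in>UNIV. (if \<kappa> = \<rho> then 0 else \<alpha> \<kappa> \<rho> q) * P \<kappa> \<rho>)
         + (\<Sum>\<kappa>\<in>UNIV. \<alpha>\<epsilon> \<kappa> q * (\<Sum>\<rho>\<in>UNIV. P \<kappa> \<rho> + P \<rho> \<kappa>))
      = (\<Sum>\<kappa>\<in>UNIV. \<Sum>\<rho>\<in>UNIV. M \<kappa> \<rho> * P \<kappa> \<rho>)"
  proof -
    have "(\<Sum>\<kappa>\<in>UNIV. \<Sum>\<rho>\<in>UNIV. \<alpha>\<epsilon> \<kappa> q * P \<rho> \<kappa>) = (\<Sum>\<kappa>\<in>UNIV. \<Sum>\<rho>\<in>UNIV. \<alpha>\<epsilon> \<rho> q * P \<kappa> \<rho>)"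
      by (rule sum.swap)
    then show ?thesis
      unfolding M distrib_right sum.distrib sum_distrib_left distrib_left by simp
  qed
  finally show ?thesis unfolding F_def P_def E_def .
qed

section \<open>The zero-weight tensor on the frame\<close>

locale kerr_bianchi = kerr_frame \<epsilon> c X p V Z
  for \<epsilon> c and X :: "'n::{finite,linorder} \<Rightarrow> real \<Rightarrow> real"
    and p :: "('n, 'm::{finite,linorder}) point" and V Z +
  fixes S :: "('n, 'm) point set"
    and R :: "('n, 'm) point \<Rightarrow> ('n + 'm) cov4"
    and \<Omega> \<alpha> :: "'n \<Rightarrow> 'n \<Rightarrow> ('n, 'm) point \<Rightarrow> real"
    and \<alpha>\<epsilon> d :: "'n \<Rightarrow> ('n, 'm) point \<Rightarrow> real"
  assumes S: "open S" "p \<in> S"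
    and adm_S: "\<And>q. q \<in> S \<Longrightarrow> admissible \<epsilon> c X q"
    and d_diff [simp]: "\<And>\<mu>. d \<mu> differentiable (at p)"
    and Omega_diag_diff: "\<And>\<mu>. \<Omega> \<mu> \<mu> differentiable (at p)"
    and R: "\<And>q. q \<in> S \<Longrightarrow> R q = zero_weight_tensor \<epsilon> c X \<Omega> \<alpha> \<alpha>\<epsilon> q"
    and alpha: "\<And>\<mu> \<nu> q. \<mu> \<noteq> \<nu> \<Longrightarrow> q \<in> S \<Longrightarrow>
      \<alpha> \<mu> \<nu> q = (xc \<mu> q * d \<mu> q - xc \<nu> q * d \<nu> q) / ((xc \<mu> q)\<^sup>2 - (xc \<nu> q)\<^sup>2)
                 - real \<epsilon> * (d \<mu> q / xc \<mu> q + d \<nu> q / xc \<nu> q)"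
    and Omega: "\<And>\<mu> \<nu> q. \<mu> \<noteq> \<nu> \<Longrightarrow> q \<in> S \<Longrightarrow>
      \<Omega> \<mu> \<nu> q = (xc \<mu> q * d \<nu> q - xc \<nu> q * d \<mu> q) / ((xc \<mu> q)\<^sup>2 - (xc \<nu> q)\<^sup>2)"
    and alpha_eps: "\<And>\<mu> q. q \<in> S \<Longrightarrow> \<alpha>\<epsilon> \<mu> q = real \<epsilon> * (d \<mu> q / xc \<mu> q)"
    and bianchi: "second_bianchi (kerr_metric \<epsilon> c X) R S"
begin

text \<open>
  \<open>K\<close> is \<open>\<alpha>\<close> plus the two contributions of \<open>\<alpha>\<epsilon>\<close>, from which all terms with \<open>\<epsilon>\<close> cancel. \<open>Q_coeff\<close> is the coefficient
  of the \<open>Q\<close>-part of \<open>R\<close>, and \<open>sectional\<close> adds what the \<open>h\<close>-part contributes to the plane of \<open>\<partial>\<^sub>\<mu>\<close> and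
  \<open>V\<^sub>\<mu>\<close>. The claim on \<open>\<Omega> \<mu> \<mu>\<close> amounts to \<open>sectional \<mu> \<mu> = \<partial>\<^sub>\<mu> d\<^sub>\<mu>\<close>.
\<close>

definition K :: "'n \<Rightarrow> 'n \<Rightarrow> ('n, 'm) point \<Rightarrow> real" where
  "K \<mu> \<nu> q = (xc \<mu> q * d \<mu> q - xc \<nu> q * d \<nu> q) / ((xc \<mu> q)\<^sup>2 - (xc \<nu> q)\<^sup>2)"

definition Q_coeff :: "'n \<Rightarrow> 'n \<Rightarrow> ('n, 'm) point \<Rightarrow> real" where
  "Q_coeff \<mu> \<nu> q = (if \<mu> = \<nu> then 2 * \<alpha>\<epsilon> \<mu> q else K \<mu> \<nu> q)"

definition sectional :: "'n \<Rightarrow> 'n \<Rightarrow> ('n, 'm) point \<Rightarrow> real" where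
  "sectional \<mu> \<nu> q = (if \<mu> = \<nu> then 2 * \<alpha>\<epsilon> \<mu> q - 3 * \<Omega> \<mu> \<mu> q else K \<mu> \<nu> q)"

text \<open>
  \<open>R\<close> is any tensor of the given form, not the curvature of the metric. In this normalisation its value on
  \<open>(\<partial>\<^sub>\<mu>, V\<^sub>\<nu>, \<partial>\<^sub>\<mu>, V\<^sub>\<nu>)\<close> is \<open>sectional \<mu> \<nu>\<close> times the squared lengths of the two vectors.
\<close>

definition curv :: "('n, 'm) point \<Rightarrow> real^('n + 'm) \<Rightarrow> real^('n + 'm) \<Rightarrow> real^('n + 'm) \<Rightarrow> real^('n + 'm) \<Rightarrow> real" where
  "curv q u v w z = - 8 * contract4 (R q) u v w z"

lemma K_sym: "K \<nu> \<mu> q = K \<mu> \<nu> q"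
  unfolding K_def by (rule quotient_sign)

lemma Omega_sym: "q \<in> S \<Longrightarrow> \<Omega> \<nu> \<mu> q = \<Omega> \<mu> \<nu> q"
  by (cases "\<mu> = \<nu>") (simp_all add: Omega quotient_sign)

lemma eps_alpha_eps: "q \<in> S \<Longrightarrow> real \<epsilon> * \<alpha>\<epsilon> \<kappa> q = \<alpha>\<epsilon> \<kappa> q"
  using eps by (auto simp: alpha_eps)

lemma curv_eq:
  assumes q: "q \<in> S"
  defines "h \<equiv> \<lambda>\<kappa>. h_val \<kappa> q" and "Q \<equiv> \<lambda>\<kappa>. Q_val X \<kappa> q" and "s \<equiv> contract1 (psi_form0 q)"
  shows "curv q u v w z =
    (\<Sum>\<kappa>\<in>UNIV. \<Sum>\<rho>\<in>UNIV. \<Omega> \<kappa> \<rho> q * (h \<kappa> u z * h \<rho> v w - h \<kappa> u w * h \<rho> v z - 2 * h \<kappa> u v * h \<rho> w z))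
    + (\<Sum>\<kappa>\<in>UNIV. \<Sum>\<rho>\<in>UNIV. Q_coeff \<kappa> \<rho> q * (Q \<kappa> u w * Q \<rho> v z - Q \<kappa> u z * Q \<rho> v w))
    + (\<Sum>\<kappa>\<in>UNIV. \<alpha>\<epsilon> \<kappa> q * (c / A_fun (CARD('n)) q) *
        (Q \<kappa> u w * (s v * s z) + Q \<kappa> v z * (s u * s w) - Q \<kappa> u z * (s v * s w) - Q \<kappa> v w * (s u * s z)))"
proof -
  have h: "contract2 (h_form X \<kappa> q) a b = h \<kappa> a b" and Q: "contract2 (Q_form X \<kappa> q) a b = Q \<kappa> a b" for \<kappa> a b
    unfolding h_def Q_def h_val_def Q_val_def
    by (rule contract2_h_form[OF adm_S[OF q]], rule contract2_Q_form[OF adm_S[OF q]])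
  have "curv q u v w z = - 8 * contract4 (zero_weight_tensor \<epsilon> c X \<Omega> \<alpha> \<alpha>\<epsilon> q) u v w z"
    by (simp add: curv_def R[OF q])
  then show ?thesis
    unfolding s_def
  proof (subst (asm) contract4_zero_weight_tensor[where M = "\<lambda>\<kappa> \<rho>. Q_coeff \<kappa> \<rho> q"])
    show "admissible \<epsilon> c X q" by (rule adm_S[OF q])
    show "real \<epsilon> * \<alpha>\<epsilon> \<kappa> q = \<alpha>\<epsilon> \<kappa> q" for \<kappa> by (rule eps_alpha_eps[OF q])
    show "\<Omega> \<rho> \<kappa> q = \<Omega> \<kappa> \<rho> q" for \<kappa> \<rho> by (rule Omega_sym[OF q])
    show "\<alpha> \<rho> \<kappa> q = \<alpha> \<kappa> \<rho> q" if "\<kappa> \<noteq> \<rho>" for \<kappa> \<rho>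
      using K_sym[of \<kappa> \<rho> q] that by (simp add: alpha[OF _ q] K_def add.commute)
    show "Q_coeff \<kappa> \<rho> q = (if \<kappa> = \<rho> then 0 else \<alpha> \<kappa> \<rho> q) + \<alpha>\<epsilon> \<kappa> q + \<alpha>\<epsilon> \<rho> q" for \<kappa> \<rho>
      by (simp add: Q_coeff_def K_def alpha[OF _ q] alpha_eps[OF q] algebra_simps)
  qed (simp only: h Q)
qed

text \<open>
  With a coordinate vector \<open>\<partial>\<^sub>\<beta>\<close> in the first slot every product in \<open>curv_eq\<close> contains either \<open>\<psi>\<^sup>0\<close> of \<open>\<partial>\<^sub>\<beta>\<close>,
  which is \<open>0\<close>, or a factor that vanishes unless \<open>\<kappa> = \<beta>\<close>. The sum over \<open>\<kappa>\<close> disappears, and all components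
  below are read off from the result.
\<close>

lemma curv_x:
  assumes q: "q \<in> S"
  shows "curv q (coord_vec \<beta>) v w z =
    (\<Sum>\<rho>\<in>UNIV. \<Omega> \<beta> \<rho> q * (contract1 (psi_form \<beta> q) z * h_val \<rho> q v w - contract1 (psi_form \<beta> q) w * h_val \<rho> q v z
        - 2 * contract1 (psi_form \<beta> q) v * h_val \<rho> q w z))
    + g_xx X \<beta> q * (\<Sum>\<rho>\<in>UNIV. Q_coeff \<beta> \<rho> q * (w $ Inl \<beta> * Q_val X \<rho> q v z - z $ Inl \<beta> * Q_val X \<rho> q v w))
    + real \<epsilon> * (\<alpha>\<epsilon> \<beta> q * (c / A_fun (CARD('n)) q) * g_xx X \<beta> q) *
        (w $ Inl \<beta> * contract1 (psi_form0 q) v * contract1 (psi_form0 q) z - z $ Inl \<beta> * contract1 (psi_form0 q) v * contract1 (psi_form0 q) w)"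
proof -
  have h: "h_val \<kappa> q (coord_vec \<beta>) y = of_bool (\<kappa> = \<beta>) * contract1 (psi_form \<beta> q) y"
    and Q: "Q_val X \<kappa> q (coord_vec \<beta>) y = of_bool (\<kappa> = \<beta>) * (g_xx X \<beta> q * y $ Inl \<beta>)" for \<kappa> y
    by (auto simp: h_val_def Q_val_def)
  let ?O = "\<lambda>\<rho>. contract1 (psi_form \<beta> q) z * h_val \<rho> q v w - contract1 (psi_form \<beta> q) w * h_val \<rho> q v z
        - 2 * contract1 (psi_form \<beta> q) v * h_val \<rho> q w z"
  let ?P = "\<lambda>\<rho>. w $ Inl \<beta> * Q_val X \<rho> q v z - z $ Inl \<beta> * Q_val X \<rho> q v w"
  let ?s = "contract1 (psi_form0 q)"
  have 1: "(\<Sum>\<kappa>\<in>UNIV. \<Sum>\<rho>\<in>UNIV. \<Omega> \<kappa> \<rho> q * (h_val \<kappa> q (coord_vec \<beta>) z * h_val \<rho> q v w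
        - h_val \<kappa> q (coord_vec \<beta>) w * h_val \<rho> q v z - 2 * h_val \<kappa> q (coord_vec \<beta>) v * h_val \<rho> q w z))
      = (\<Sum>\<rho>\<in>UNIV. \<Omega> \<beta> \<rho> q * ?O \<rho>)"
    unfolding h by (rule sum_single[where \<mu> = \<beta>]) simp_all
  have 2: "(\<Sum>\<kappa>\<in>UNIV. \<Sum>\<rho>\<in>UNIV. Q_coeff \<kappa> \<rho> q * (Q_val X \<kappa> q (coord_vec \<beta>) w * Q_val X \<rho> q v z
        - Q_val X \<kappa> q (coord_vec \<beta>) z * Q_val X \<rho> q v w))
      = g_xx X \<beta> q * (\<Sum>\<rho>\<in>UNIV. Q_coeff \<beta> \<rho> q * ?P \<rho>)"
    unfolding Q sum_distrib_left
    by (rule sum_single[where \<mu> = \<beta>]) (simp_all add: algebra_simps)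
  have 3: "(\<Sum>\<kappa>\<in>UNIV. \<alpha>\<epsilon> \<kappa> q * (c / A_fun (CARD('n)) q) *
        (Q_val X \<kappa> q (coord_vec \<beta>) w * (?s v * ?s z) + Q_val X \<kappa> q v z * (?s (coord_vec \<beta>) * ?s w)
         - Q_val X \<kappa> q (coord_vec \<beta>) z * (?s v * ?s w) - Q_val X \<kappa> q v w * (?s (coord_vec \<beta>) * ?s z)))
      = \<alpha>\<epsilon> \<beta> q * (c / A_fun (CARD('n)) q) * g_xx X \<beta> q * (w $ Inl \<beta> * ?s v * ?s z - z $ Inl \<beta> * ?s v * ?s w)"
    unfolding Q contract1_psi_x
    by (rule sum_single[where \<mu> = \<beta>]) (simp_all add: algebra_simps)
  have 4: "real \<epsilon> * (\<alpha>\<epsilon> \<beta> q * (c / A_fun (CARD('n)) q) * g_xx X \<beta> q)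
      = \<alpha>\<epsilon> \<beta> q * (c / A_fun (CARD('n)) q) * g_xx X \<beta> q"
    using eps_alpha_eps[OF q, of \<beta>] by (simp only: mult.assoc[symmetric])
  show ?thesis unfolding curv_eq[OF q] 1 2 3 4 ..
qed

lemma g_xx_S_nz: "q \<in> S \<Longrightarrow> g_xx X \<kappa> q \<noteq> 0"
  using admissible_U_over_X[OF adm_S, of q \<kappa>] unfolding g_xx_def by (metis less_irrefl)

lemma curv_xvxv_diag:
  assumes q: "q \<in> S" and v: "vertical v" "vertical z"
  shows "curv q (coord_vec \<beta>) v (coord_vec \<beta>) z =
    (\<Sum>\<kappa>\<in>UNIV. g_xx X \<beta> q * sectional \<beta> \<kappa> q / g_xx X \<kappa> q * contract1 (psi_form \<kappa> q) v * contract1 (psi_form \<kappa> q) z)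
    + real \<epsilon> * (\<alpha>\<epsilon> \<beta> q * (c / A_fun (CARD('n)) q) * g_xx X \<beta> q) * contract1 (psi_form0 q) v * contract1 (psi_form0 q) z"
proof -
  have vI: "v $ Inl \<kappa> = 0" "z $ Inl \<kappa> = 0" for \<kappa> using v by (simp_all add: vertical_def)
  have 1: "(\<Sum>\<rho>\<in>UNIV. \<Omega> \<beta> \<rho> q * (contract1 (psi_form \<beta> q) z * h_val \<rho> q v (coord_vec \<beta>)
        - contract1 (psi_form \<beta> q) (coord_vec \<beta>) * h_val \<rho> q v z - 2 * contract1 (psi_form \<beta> q) v * h_val \<rho> q (coord_vec \<beta>) z))
      = - 3 * \<Omega> \<beta> \<beta> q * contract1 (psi_form \<beta> q) v * contract1 (psi_form \<beta> q) z"
    by (rule sum_single[where \<mu> = \<beta>]) (simp_all add: h_val_def vI)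
  have 2: "g_xx X \<beta> q * (\<Sum>\<rho>\<in>UNIV. Q_coeff \<beta> \<rho> q * (coord_vec \<beta> $ Inl \<beta> * Q_val X \<rho> q v z - z $ Inl \<beta> * Q_val X \<rho> q v (coord_vec \<beta>)))
      = (\<Sum>\<kappa>\<in>UNIV. g_xx X \<beta> q * Q_coeff \<beta> \<kappa> q / g_xx X \<kappa> q * contract1 (psi_form \<kappa> q) v * contract1 (psi_form \<kappa> q) z)"
    by (simp add: sum_distrib_left Q_val_def vI mult.assoc)
  have 3: "(\<Sum>\<kappa>\<in>UNIV. g_xx X \<beta> q * sectional \<beta> \<kappa> q / g_xx X \<kappa> q * contract1 (psi_form \<kappa> q) v * contract1 (psi_form \<kappa> q) z)
    = (\<Sum>\<kappa>\<in>UNIV. g_xx X \<beta> q * Q_coeff \<beta> \<kappa> q / g_xx X \<kappa> q * contract1 (psi_form \<kappa> q) v * contract1 (psi_form \<kappa> q) z)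
      - (\<Sum>\<kappa>\<in>UNIV. 3 * \<Omega> \<beta> \<kappa> q * contract1 (psi_form \<kappa> q) v * contract1 (psi_form \<kappa> q) z * of_bool (\<kappa> = \<beta>))"
    unfolding sum_subtractf[symmetric]
    by (rule sum.cong[OF refl]) (auto simp: sectional_def Q_coeff_def g_xx_S_nz[OF q] field_simps)
  show ?thesis unfolding curv_x[OF q] 1 2 3 by (simp add: vI)
qed

lemma curv_xvxv_off:
  assumes q: "q \<in> S" and v: "vertical v" "vertical z" and ne: "\<beta> \<noteq> \<gamma>"
  shows "curv q (coord_vec \<beta>) v (coord_vec \<gamma>) z =
    - \<Omega> \<beta> \<gamma> q * (2 * contract1 (psi_form \<beta> q) v * contract1 (psi_form \<gamma> q) z + contract1 (psi_form \<beta> q) z * contract1 (psi_form \<gamma> q) v)"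
proof -
  have vI: "v $ Inl \<kappa> = 0" "z $ Inl \<kappa> = 0" for \<kappa> using v by (simp_all add: vertical_def)
  have 1: "(\<Sum>\<rho>\<in>UNIV. \<Omega> \<beta> \<rho> q * (contract1 (psi_form \<beta> q) z * h_val \<rho> q v (coord_vec \<gamma>)
        - contract1 (psi_form \<beta> q) (coord_vec \<gamma>) * h_val \<rho> q v z - 2 * contract1 (psi_form \<beta> q) v * h_val \<rho> q (coord_vec \<gamma>) z))
      = - \<Omega> \<beta> \<gamma> q * (2 * contract1 (psi_form \<beta> q) v * contract1 (psi_form \<gamma> q) z + contract1 (psi_form \<beta> q) z * contract1 (psi_form \<gamma> q) v)"
    by (rule sum_single[where \<mu> = \<gamma>]) (simp_all add: h_val_def vI algebra_simps)
  show ?thesis unfolding curv_x[OF q] 1 using ne by (simp add: vI)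
qed

lemma curv_xxxv: "q \<in> S \<Longrightarrow> vertical v \<Longrightarrow> curv q (coord_vec \<beta>) (coord_vec \<gamma>) (coord_vec \<delta>) v = 0"
  and curv_xxvx: "q \<in> S \<Longrightarrow> vertical v \<Longrightarrow> curv q (coord_vec \<beta>) (coord_vec \<gamma>) v (coord_vec \<delta>) = 0"
  and curv_xvxx: "q \<in> S \<Longrightarrow> vertical v \<Longrightarrow> curv q (coord_vec \<beta>) v (coord_vec \<gamma>) (coord_vec \<delta>) = 0"
  and curv_xvvv: "q \<in> S \<Longrightarrow> vertical v \<Longrightarrow> vertical w \<Longrightarrow> vertical z \<Longrightarrow> curv q (coord_vec \<beta>) v w z = 0"
  by (simp_all add: curv_x h_val_def Q_val_def vertical_def)

lemma curv_xxvv: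
  assumes q: "q \<in> S" and v: "vertical v" "vertical z"
  shows "curv q (coord_vec \<beta>) (coord_vec \<gamma>) v z =
    \<Omega> \<beta> \<gamma> q * (contract1 (psi_form \<beta> q) z * contract1 (psi_form \<gamma> q) v - contract1 (psi_form \<beta> q) v * contract1 (psi_form \<gamma> q) z)"
proof -
  have vI: "v $ Inl \<kappa> = 0" "z $ Inl \<kappa> = 0" for \<kappa> using v by (simp_all add: vertical_def)
  have 1: "(\<Sum>\<rho>\<in>UNIV. \<Omega> \<beta> \<rho> q * (contract1 (psi_form \<beta> q) z * h_val \<rho> q (coord_vec \<gamma>) v
        - contract1 (psi_form \<beta> q) v * h_val \<rho> q (coord_vec \<gamma>) z - 2 * contract1 (psi_form \<beta> q) (coord_vec \<gamma>) * h_val \<rho> q v z))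
      = \<Omega> \<beta> \<gamma> q * (contract1 (psi_form \<beta> q) z * contract1 (psi_form \<gamma> q) v - contract1 (psi_form \<beta> q) v * contract1 (psi_form \<gamma> q) z)"
    by (rule sum_single[where \<mu> = \<gamma>]) (simp_all add: h_val_def vI algebra_simps)
  show ?thesis unfolding curv_x[OF q] 1 by (simp add: vI)
qed

lemma curv_xxxx:
  assumes q: "q \<in> S" and ne: "\<beta> \<noteq> \<gamma>"
  shows "curv q (coord_vec \<beta>) (coord_vec \<gamma>) (coord_vec \<gamma>) (coord_vec \<delta>) =
    - of_bool (\<delta> = \<beta>) * K \<beta> \<gamma> q * g_xx X \<beta> q * g_xx X \<gamma> q"
    and "curv q (coord_vec \<beta>) (coord_vec \<gamma>) (coord_vec \<beta>) (coord_vec \<delta>) =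
    of_bool (\<delta> = \<gamma>) * K \<beta> \<gamma> q * g_xx X \<beta> q * g_xx X \<gamma> q"
proof -
  have Q: "Q_val X \<rho> q (coord_vec \<gamma>) y = of_bool (\<rho> = \<gamma>) * (g_xx X \<gamma> q * y $ Inl \<gamma>)" for \<rho> y
    by (auto simp: Q_val_def)
  have 1: "(\<Sum>\<rho>\<in>UNIV. Q_coeff \<beta> \<rho> q * (w $ Inl \<beta> * Q_val X \<rho> q (coord_vec \<gamma>) z - z $ Inl \<beta> * Q_val X \<rho> q (coord_vec \<gamma>) w))
      = K \<beta> \<gamma> q * g_xx X \<gamma> q * (w $ Inl \<beta> * z $ Inl \<gamma> - z $ Inl \<beta> * w $ Inl \<gamma>)" for w z
    unfolding Q using ne by (intro sum_single[where \<mu> = \<gamma>]) (simp_all add: Q_coeff_def algebra_simps)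
  show "curv q (coord_vec \<beta>) (coord_vec \<gamma>) (coord_vec \<gamma>) (coord_vec \<delta>) =
    - of_bool (\<delta> = \<beta>) * K \<beta> \<gamma> q * g_xx X \<beta> q * g_xx X \<gamma> q"
    unfolding curv_x[OF q] 1 using ne by (auto simp: h_val_def)
  show "curv q (coord_vec \<beta>) (coord_vec \<gamma>) (coord_vec \<beta>) (coord_vec \<delta>) =
    of_bool (\<delta> = \<gamma>) * K \<beta> \<gamma> q * g_xx X \<beta> q * g_xx X \<gamma> q"
    unfolding curv_x[OF q] 1 using ne by (auto simp: h_val_def)
qed

lemma curv_Z:
  assumes "real \<epsilon> * contract1 (psi_form0 p) v = 0"
  shows "curv p (coord_vec \<beta>) v Z z = 0" "curv p (coord_vec \<beta>) v z Z = 0"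
proof -
  have "real \<epsilon> = 0 \<or> contract1 (psi_form0 p) v = 0" using assms by simp
  then show "curv p (coord_vec \<beta>) v Z z = 0" "curv p (coord_vec \<beta>) v z Z = 0"
    by (auto simp: curv_x[OF S(2)] h_val_def Q_val_def)
qed

section \<open>The Bianchi identity for the tensor on the frame\<close>

lemma Omega_diff [simp]: "\<Omega> \<mu> \<nu> differentiable (at p)"
proof (cases "\<mu> = \<nu>")
  case False
  have diff: "(\<lambda>q. (xc \<mu> q * d \<nu> q - xc \<nu> q * d \<mu> q) / ((xc \<mu> q)\<^sup>2 - (xc \<nu> q)\<^sup>2)) differentiable (at p)"
    using xc_sq_distinct[OF False]
    by (intro differentiable_divide differentiable_diff differentiable_mult differentiable_power) simp_all
  show ?thesis by (rule differentiable_local_cong[OF S Omega[OF False] diff])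
qed (simp add: Omega_diag_diff)

lemma K_diff: "\<mu> \<noteq> \<nu> \<Longrightarrow> K \<mu> \<nu> differentiable (at p)"
  unfolding K_def[abs_def] using xc_sq_distinct[of \<mu> \<nu>]
  by (intro differentiable_divide differentiable_diff differentiable_mult differentiable_power) simp_all

lemma eps_times_diff: "(real \<epsilon> \<noteq> 0 \<Longrightarrow> f differentiable (at p)) \<Longrightarrow> (\<lambda>q. real \<epsilon> * f q) differentiable (at p)"
  by (cases "real \<epsilon> = 0") (auto intro: differentiable_mult)

text \<open>
  For \<open>\<epsilon> = 1\<close> the product \<open>A\<^sup>(\<^sup>n\<^sup>)\<close> of all \<open>x\<^sub>\<nu>\<^sup>2\<close> is a denominator of the metric.
\<close>

lemma xc_nz: "real \<epsilon> \<noteq> 0 \<Longrightarrow> xc \<mu> p \<noteq> 0"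
proof -
  assume e: "real \<epsilon> \<noteq> 0"
  have "{N :: 'n set. card N = CARD('n)} = {UNIV}"
    using card_subset_eq[of "UNIV :: 'n set"] by auto
  then have "A_fun (CARD('n)) p = (\<Prod>\<nu>\<in>UNIV. (xc \<nu> p)\<^sup>2)" by (simp add: A_fun_def)
  with A_fun_nz[OF e] show ?thesis by auto
qed

lemma alpha_eps_diff [simp]: "\<alpha>\<epsilon> \<mu> differentiable (at p)"
proof (rule differentiable_local_cong[OF S alpha_eps])
  show "(\<lambda>q. real \<epsilon> * (d \<mu> q / xc \<mu> q)) differentiable (at p)"
    by (rule eps_times_diff, intro differentiable_divide) (simp_all add: xc_nz)
qed

lemma alpha_eps_A_diff: "(\<lambda>q. \<alpha>\<epsilon> \<mu> q * (c / A_fun (CARD('n)) q)) differentiable (at p)"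
proof (rule differentiable_local_cong[OF S])
  show "\<alpha>\<epsilon> \<mu> q * (c / A_fun (CARD('n)) q) = real \<epsilon> * (d \<mu> q / xc \<mu> q * (c / A_fun (CARD('n)) q))" if "q \<in> S" for q
    using alpha_eps[OF that] by simp
  show "(\<lambda>q. real \<epsilon> * (d \<mu> q / xc \<mu> q * (c / A_fun (CARD('n)) q))) differentiable (at p)"
    by (rule eps_times_diff, intro differentiable_divide differentiable_mult) (simp_all add: xc_nz A_fun_nz)
qed

lemma Q_coeff_diff: "Q_coeff \<mu> \<nu> differentiable (at p)"
  unfolding Q_coeff_def[abs_def] by (cases "\<mu> = \<nu>") (simp_all add: K_diff)

lemma sectional_diff: "sectional \<mu> \<nu> differentiable (at p)"
  unfolding sectional_def[abs_def] by (cases "\<mu> = \<nu>") (simp_all add: K_diff)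

lemma h_val_diff: "(\<lambda>q. h_val \<kappa> q u v) differentiable (at p)"
  unfolding h_val_def by (intro differentiable_diff differentiable_mult) simp_all

lemma Q_val_diff: "(\<lambda>q. Q_val X \<kappa> q u v) differentiable (at p)"
  unfolding Q_val_def by (intro differentiable_add differentiable_mult differentiable_divide) simp_all

lemma curv_diff: "(\<lambda>q. curv q u v w z) differentiable (at p)"
  by (rule differentiable_local_cong[OF S curv_eq], assumption)
     (intro differentiable_add differentiable_diff differentiable_sum differentiable_mult ballI finite
       alpha_eps_A_diff Q_coeff_diff Omega_diff h_val_diff Q_val_diff psi0_diff differentiable_const)

lemma R_contract4: "contract4 (R q) u v w z = - 1/8 * curv q u v w z"
  by (simp add: curv_def)

lemma R_diff: "(\<lambda>q. R q a b c' e) differentiable (at p)"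
proof -
  have "R q a b c' e = - 1/8 * curv q (axis a 1) (axis b 1) (axis c' 1) (axis e 1)" for q
    by (simp add: curv_def contract4_axis)
  then show ?thesis using curv_diff by simp
qed

lemma R_anti: "q \<in> S \<Longrightarrow> R q b a c' e = - R q a b c' e"
proof -
  assume "q \<in> S"
  then have "riemann_symmetric (R q)" using R riemann_symmetric_zero_weight_tensor by metis
  then have "R q b a c' e = alt2 (\<lambda>a b. alt2 (\<lambda>c d. R q a b c d) c' e) b a"
    and "R q a b c' e = alt2 (\<lambda>a b. alt2 (\<lambda>c d. R q a b c d) c' e) a b"
    unfolding riemann_symmetric_def by blast+
  then show ?thesis unfolding alt2_def by (simp add: field_simps)
qed

lemma curv_anti: "q \<in> S \<Longrightarrow> curv q v u w z = - curv q u v w z"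
proof -
  assume q: "q \<in> S"
  have "contract4 (R q) v u w z = contract4 (\<lambda>a b. R q b a) u v w z"
    unfolding contract4_eq contract1_swap[of _ u v] ..
  also have "\<dots> = - contract4 (R q) u v w z"
  proof -
    have "(\<lambda>a b. R q b a) = (\<lambda>a b c' e. - R q a b c' e)" by (intro ext) (rule R_anti[OF q])
    then show ?thesis by (simp add: contract4_eq contract1_minus)
  qed
  finally show ?thesis by (simp add: curv_def)
qed

text \<open>
  The counterpart of \<open>bianchi_term\<close> in the normalisation of \<open>curv\<close>.
\<close>

definition curv_bianchi_term where
  "curv_bianchi_term u v w y z = dir_deriv u (\<lambda>q. curv q v w y z) p - curv p v w (\<Gamma> u y) z - curv p v w y (\<Gamma> u z)"

lemma curv_bianchi_cyclic: "curv_bianchi_term u v w y z + curv_bianchi_term v w u y z + curv_bianchi_term w u v y z = 0"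
proof -
  have "bianchi_term g R p u v w y z = - 1/8 * curv_bianchi_term u v w y z" for u v w y z
  proof -
    have "dir_deriv u (\<lambda>q. contract4 (R q) v w y z) p = - 1/8 * dir_deriv u (\<lambda>q. curv q v w y z) p"
      unfolding R_contract4
      by (intro dir_derivI DERIV_cmult differentiable_has_dir_deriv curv_diff)
    then show ?thesis unfolding bianchi_term_def curv_bianchi_term_def R_contract4 by (simp add: field_simps)
  qed
  then show ?thesis
    using bianchi_vectors[OF S metric_sym R_diff R_anti bianchi, of u v w y z] by simp
qed

lemma curv_third_frame:
  assumes "curv p a b Z z = 0"
  shows "curv p a b u z = (\<Sum>\<kappa>\<in>UNIV. u $ Inl \<kappa> * curv p a b (coord_vec \<kappa>) z)
      + (\<Sum>\<kappa>\<in>UNIV. contract1 (psi_form \<kappa> p) u * curv p a b (V \<kappa>) z)"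
proof -
  have "contract4 (R p) a b Z z = 0" using assms by (simp add: curv_def)
  from contract4_third_frame[OF this, of u] show ?thesis
    by (simp add: curv_def sum_distrib_left algebra_simps)
qed

lemma curv_fourth_frame:
  assumes "curv p a b z Z = 0"
  shows "curv p a b z u = (\<Sum>\<kappa>\<in>UNIV. u $ Inl \<kappa> * curv p a b z (coord_vec \<kappa>))
      + (\<Sum>\<kappa>\<in>UNIV. contract1 (psi_form \<kappa> p) u * curv p a b z (V \<kappa>))"
proof -
  have "contract4 (R p) a b z Z = 0" using assms by (simp add: curv_def)
  from contract4_fourth_frame[OF this, of u] show ?thesis
    by (simp add: curv_def sum_distrib_left algebra_simps)
qed

text \<open>
  The assumption holds for \<open>a = \<partial>\<^sub>\<nu>\<close> and for \<open>a = V\<^sub>\<sigma>\<close>, and keeps \<open>Z\<close> from contributing. Each Christoffel vector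
  lies, up to a multiple of \<open>Z\<close>, in the span of the \<open>\<partial>\<^sub>\<kappa>\<close> or in that of the \<open>V\<^sub>\<kappa>\<close>, so one sum is left.
\<close>

lemma curv_connection:
  assumes a: "real \<epsilon> * contract1 (psi_form0 p) a = 0"
  shows
    "curv p (coord_vec \<beta>) a (\<Gamma> (coord_vec \<mu>) (coord_vec \<nu>)) z
       = (\<Sum>\<kappa>\<in>UNIV. \<Gamma> (coord_vec \<mu>) (coord_vec \<nu>) $ Inl \<kappa> * curv p (coord_vec \<beta>) a (coord_vec \<kappa>) z)"
    "curv p (coord_vec \<beta>) a (\<Gamma> (V \<sigma>) (coord_vec \<nu>)) z
       = (\<Sum>\<kappa>\<in>UNIV. d_g_VV \<nu> \<kappa> \<sigma> * g_xx X \<kappa> p / 2 * curv p (coord_vec \<beta>) a (V \<kappa>) z)"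
    "curv p (coord_vec \<beta>) a z (\<Gamma> (coord_vec \<mu>) (V \<sigma>))
       = (\<Sum>\<kappa>\<in>UNIV. d_g_VV \<mu> \<kappa> \<sigma> * g_xx X \<kappa> p / 2 * curv p (coord_vec \<beta>) a z (V \<kappa>))"
    "curv p (coord_vec \<beta>) a z (\<Gamma> (V \<sigma>) (V \<tau>))
       = (\<Sum>\<kappa>\<in>UNIV. - d_g_VV \<kappa> \<sigma> \<tau> / (2 * g_xx X \<kappa> p) * curv p (coord_vec \<beta>) a z (coord_vec \<kappa>))"
proof -
  note third = curv_third_frame[OF curv_Z(1)[OF a]] and fourth = curv_fourth_frame[OF curv_Z(2)[OF a]]
  show "curv p (coord_vec \<beta>) a (\<Gamma> (coord_vec \<mu>) (coord_vec \<nu>)) z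
       = (\<Sum>\<kappa>\<in>UNIV. \<Gamma> (coord_vec \<mu>) (coord_vec \<nu>) $ Inl \<kappa> * curv p (coord_vec \<beta>) a (coord_vec \<kappa>) z)"
    by (rule trans[OF third]) (simp add: \<Gamma>_xx(2))
  show "curv p (coord_vec \<beta>) a (\<Gamma> (V \<sigma>) (coord_vec \<nu>)) z
       = (\<Sum>\<kappa>\<in>UNIV. d_g_VV \<nu> \<kappa> \<sigma> * g_xx X \<kappa> p / 2 * curv p (coord_vec \<beta>) a (V \<kappa>) z)"
    by (rule trans[OF third]) (simp add: \<Gamma>_xV)
  show "curv p (coord_vec \<beta>) a z (\<Gamma> (coord_vec \<mu>) (V \<sigma>))
       = (\<Sum>\<kappa>\<in>UNIV. d_g_VV \<mu> \<kappa> \<sigma> * g_xx X \<kappa> p / 2 * curv p (coord_vec \<beta>) a z (V \<kappa>))"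
    by (rule trans[OF fourth]) (simp add: \<Gamma>_xV)
  show "curv p (coord_vec \<beta>) a z (\<Gamma> (V \<sigma>) (V \<tau>))
       = (\<Sum>\<kappa>\<in>UNIV. - d_g_VV \<kappa> \<sigma> \<tau> / (2 * g_xx X \<kappa> p) * curv p (coord_vec \<beta>) a z (coord_vec \<kappa>))"
    by (rule trans[OF fourth]) (simp add: \<Gamma>_VV)
qed

section \<open>Two components of the Bianchi identity\<close>

lemma s_x: "real \<epsilon> * contract1 (psi_form0 p) (coord_vec \<mu>) = 0" by simp

lemmas conn_x = curv_connection[OF s_x] and conn_V = curv_connection[OF psi0_V]

lemma dir_deriv_curv_diag:
  "dir_deriv (coord_vec \<mu>) (\<lambda>q. curv q (coord_vec \<beta>) (V \<sigma>) (coord_vec \<beta>) (V \<tau>)) p =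
     of_bool (\<sigma> = \<tau>) * dir_deriv (coord_vec \<mu>) (\<lambda>q. g_xx X \<beta> q * sectional \<beta> \<sigma> q / g_xx X \<sigma> q) p
     + g_xx X \<beta> p * sectional \<beta> \<tau> p / g_xx X \<tau> p * d_psi \<mu> \<tau> \<sigma>
     + g_xx X \<beta> p * sectional \<beta> \<sigma> p / g_xx X \<sigma> p * d_psi \<mu> \<sigma> \<tau>"
proof -
  have "dir_deriv (coord_vec \<mu>) (\<lambda>q. curv q (coord_vec \<beta>) (V \<sigma>) (coord_vec \<beta>) (V \<tau>)) p =
     dir_deriv (coord_vec \<mu>) (\<lambda>q. (\<Sum>\<kappa>\<in>UNIV. g_xx X \<beta> q * sectional \<beta> \<kappa> q / g_xx X \<kappa> q * contract1 (psi_form \<kappa> q) (V \<sigma>) * contract1 (psi_form \<kappa> q) (V \<tau>))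
    + real \<epsilon> * (\<alpha>\<epsilon> \<beta> q * (c / A_fun (CARD('n)) q) * g_xx X \<beta> q) * contract1 (psi_form0 q) (V \<sigma>) * contract1 (psi_form0 q) (V \<tau>)) p"
    by (rule dir_deriv_local_cong[OF S]) (rule curv_xvxv_diag[OF _ V_vertical V_vertical])
  also have "\<dots> = of_bool (\<sigma> = \<tau>) * dir_deriv (coord_vec \<mu>) (\<lambda>q. g_xx X \<beta> q * sectional \<beta> \<sigma> q / g_xx X \<sigma> q) p
     + g_xx X \<beta> p * sectional \<beta> \<tau> p / g_xx X \<tau> p * d_psi \<mu> \<tau> \<sigma>
     + g_xx X \<beta> p * sectional \<beta> \<sigma> p / g_xx X \<sigma> p * d_psi \<mu> \<sigma> \<tau>"
    by (rule dir_deriv_psi_quadratic)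
       (intro differentiable_mult differentiable_divide g_xx_diff sectional_diff g_xx_nz alpha_eps_A_diff)+
  finally show ?thesis .
qed

lemma dir_deriv_curv_off:
  assumes "\<beta> \<noteq> \<gamma>"
  shows "dir_deriv (coord_vec \<mu>) (\<lambda>q. curv q (coord_vec \<beta>) (V \<sigma>) (coord_vec \<gamma>) (V \<tau>)) p =
     - dir_deriv (coord_vec \<mu>) (\<Omega> \<beta> \<gamma>) p * (2 * of_bool (\<beta> = \<sigma> \<and> \<gamma> = \<tau>) + of_bool (\<beta> = \<tau> \<and> \<gamma> = \<sigma>))
     - \<Omega> \<beta> \<gamma> p * (2 * (d_psi \<mu> \<beta> \<sigma> * of_bool (\<gamma> = \<tau>) + of_bool (\<beta> = \<sigma>) * d_psi \<mu> \<gamma> \<tau>)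
         + d_psi \<mu> \<beta> \<tau> * of_bool (\<gamma> = \<sigma>) + of_bool (\<beta> = \<tau>) * d_psi \<mu> \<gamma> \<sigma>)"
proof -
  let ?psi = "\<lambda>\<kappa> q. contract1 (psi_form \<kappa> q)" and ?q = "\<lambda>t::real. p + t *\<^sub>R coord_vec \<mu>"
  have "dir_deriv (coord_vec \<mu>) (\<lambda>q. curv q (coord_vec \<beta>) (V \<sigma>) (coord_vec \<gamma>) (V \<tau>)) p =
     dir_deriv (coord_vec \<mu>) (\<lambda>q. - \<Omega> \<beta> \<gamma> q * (2 * ?psi \<beta> q (V \<sigma>) * ?psi \<gamma> q (V \<tau>) + ?psi \<beta> q (V \<tau>) * ?psi \<gamma> q (V \<sigma>))) p"
    by (rule dir_deriv_local_cong[OF S]) (rule curv_xvxv_off[OF _ V_vertical V_vertical assms])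
  also have "\<dots> = - dir_deriv (coord_vec \<mu>) (\<Omega> \<beta> \<gamma>) p * (2 * of_bool (\<beta> = \<sigma> \<and> \<gamma> = \<tau>) + of_bool (\<beta> = \<tau> \<and> \<gamma> = \<sigma>))
     - \<Omega> \<beta> \<gamma> p * (2 * (d_psi \<mu> \<beta> \<sigma> * of_bool (\<gamma> = \<tau>) + of_bool (\<beta> = \<sigma>) * d_psi \<mu> \<gamma> \<tau>)
         + d_psi \<mu> \<beta> \<tau> * of_bool (\<gamma> = \<sigma>) + of_bool (\<beta> = \<tau>) * d_psi \<mu> \<gamma> \<sigma>)"
  proof -
    have dO: "((\<lambda>t. \<Omega> \<beta> \<gamma> (?q t)) has_real_derivative dir_deriv (coord_vec \<mu>) (\<Omega> \<beta> \<gamma>) p) (at 0)"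
      by (rule differentiable_has_dir_deriv) simp
    show ?thesis
      by (rule dir_derivI, rule DERIV_cong,
          rule DERIV_mult[OF DERIV_minus[OF dO]
            DERIV_add[OF DERIV_mult[OF DERIV_cmult[OF DERIV_psi_V] DERIV_psi_V] DERIV_mult[OF DERIV_psi_V DERIV_psi_V]]])
         (simp add: algebra_simps of_bool_conj)
  qed
  finally show ?thesis .
qed

lemma dir_deriv_vertical_curv: "dir_deriv (V \<sigma>) (\<lambda>q. curv q (coord_vec \<beta>) (coord_vec \<gamma>) (coord_vec \<delta>) (V \<tau>)) p = 0"
proof -
  have "dir_deriv (V \<sigma>) (\<lambda>q. curv q (coord_vec \<beta>) (coord_vec \<gamma>) (coord_vec \<delta>) (V \<tau>)) p = dir_deriv (V \<sigma>) (\<lambda>q. 0) p"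
    by (rule dir_deriv_local_cong[OF S]) (rule curv_xxxv[OF _ V_vertical])
  then show ?thesis by (simp add: dir_derivI)
qed

lemma dir_deriv_anti: "dir_deriv y (\<lambda>q. curv q v u w z) p = - dir_deriv y (\<lambda>q. curv q u v w z) p"
proof -
  have "dir_deriv y (\<lambda>q. curv q v u w z) p = dir_deriv y (\<lambda>q. - curv q u v w z) p"
    by (rule dir_deriv_local_cong[OF S curv_anti])
  also have "\<dots> = - dir_deriv y (\<lambda>q. curv q u v w z) p"
    by (intro dir_derivI DERIV_minus differentiable_has_dir_deriv curv_diff)
  finally show ?thesis .
qed

lemma dir_deriv_K_ratio:
  assumes ne: "\<mu> \<noteq> \<nu>"
  shows "dir_deriv (coord_vec \<mu>) (\<lambda>q. g_xx X \<nu> q * sectional \<nu> \<mu> q / g_xx X \<mu> q) p =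
    g_xx X \<nu> p / g_xx X \<mu> p * (log_slope p \<mu> \<nu> * K \<mu> \<nu> p + dir_deriv (coord_vec \<mu>) (K \<mu> \<nu>) p - K \<mu> \<nu> p * d_g_xx \<mu> \<mu> / g_xx X \<mu> p)"
proof -
  have sectional: "sectional \<nu> \<mu> q = K \<mu> \<nu> q" for q using ne by (simp add: sectional_def K_sym)
  let ?q = "\<lambda>t::real. p + t *\<^sub>R coord_vec \<mu>"
  have dg: "((\<lambda>t. g_xx X \<kappa> (?q t)) has_real_derivative d_g_xx \<mu> \<kappa>) (at 0)" for \<kappa>
    unfolding d_g_xx_def by (rule differentiable_has_dir_deriv) simp
  have dK: "((\<lambda>t. K \<mu> \<nu> (?q t)) has_real_derivative dir_deriv (coord_vec \<mu>) (K \<mu> \<nu>) p) (at 0)"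
    by (rule differentiable_has_dir_deriv) (rule K_diff[OF ne])
  show ?thesis
    unfolding sectional
    by (rule dir_derivI, rule DERIV_cong, rule DERIV_divide[OF DERIV_mult[OF dg dK] dg])
       (simp_all add: d_g_xx_other[OF ne] field_simps)
qed

lemma curv_frame_diag:
  "curv p (coord_vec \<beta>) (V \<sigma>) (coord_vec \<beta>) (V \<tau>) = of_bool (\<sigma> = \<tau>) * (g_xx X \<beta> p * sectional \<beta> \<sigma> p / g_xx X \<sigma> p)"
proof -
  have "real \<epsilon> * (\<alpha>\<epsilon> \<beta> p * (c / A_fun (CARD('n)) p) * g_xx X \<beta> p) * contract1 (psi_form0 p) (V \<sigma>) * contract1 (psi_form0 p) (V \<tau>) = 0"
    using psi0_V[of \<sigma>] by auto
  then show ?thesis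
    unfolding curv_xvxv_diag[OF S(2) V_vertical V_vertical] psi_V sum_of_bool by auto
qed

lemma curv_frame_off:
  "\<beta> \<noteq> \<gamma> \<Longrightarrow> curv p (coord_vec \<beta>) (V \<sigma>) (coord_vec \<gamma>) (V \<tau>) =
    - \<Omega> \<beta> \<gamma> p * (2 * of_bool (\<beta> = \<sigma>) * of_bool (\<gamma> = \<tau>) + of_bool (\<beta> = \<tau>) * of_bool (\<gamma> = \<sigma>))"
  by (simp add: curv_xvxv_off[OF S(2) V_vertical V_vertical])

lemmas curv_frame = curv_frame_diag curv_frame_off
    curv_xxvv[OF S(2) V_vertical V_vertical] curv_xxxx[OF S(2)] curv_xvvv[OF S(2) V_vertical V_vertical V_vertical]
    curv_xxxv[OF S(2) V_vertical] curv_xxvx[OF S(2) V_vertical] curv_xvxx[OF S(2) V_vertical]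

lemma
  assumes ne: "\<mu> \<noteq> \<nu>"
  shows d_g_VV_same: "d_g_VV \<mu> \<mu> \<mu> = - d_g_xx \<mu> \<mu> / (g_xx X \<mu> p)\<^sup>2"
    and d_g_VV_cross: "d_g_VV \<mu> \<mu> \<nu> = - log_slope p \<mu> \<nu> / g_xx X \<nu> p"
    and d_g_VV_other: "d_g_VV \<mu> \<nu> \<nu> = log_slope p \<mu> \<nu> / g_xx X \<nu> p"
    and d_g_VV_cross': "d_g_VV \<mu> \<nu> \<mu> = - log_slope p \<mu> \<nu> / g_xx X \<nu> p"
  using ne by (simp_all add: d_g_VV_def d_psi_def d_g_xx_other power2_eq_square field_simps)

text \<open>
  In this lemma and the next the facts \<open>D\<close>, \<open>B\<close>, \<open>C\<close> are the derivative and the connection terms on the third and the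
  fourth slot, for each of the three cyclic summands; in the second summand the first two slots have been
  exchanged, so that a coordinate vector comes first. In every connection term the sum over the frame has a
  single summand that does not vanish. The quantity \<open>L\<close> contains the unknown \<open>\<partial>\<^sub>\<mu> G\<^sub>\<mu>\<close> and cancels in the total.
\<close>

lemma bianchi_K:
  assumes ne: "\<mu> \<noteq> \<nu>"
  shows "dir_deriv (coord_vec \<mu>) (K \<mu> \<nu>) p + log_slope p \<mu> \<nu> / 2 * (K \<mu> \<nu> p - sectional \<mu> \<mu> p)
       + 3/2 * log_slope p \<nu> \<mu> * \<Omega> \<mu> \<nu> p = 0"
proof -
  note ne' = ne ne[symmetric]
  let ?x = "coord_vec :: 'n \<Rightarrow> real^('n + 'm)" and ?G = "\<lambda>\<kappa>. g_xx X \<kappa> p"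
  let ?k = "K \<mu> \<nu> p" and ?o = "\<Omega> \<mu> \<nu> p" and ?s = "sectional \<mu> \<mu> p"
  define r where "r = ?G \<nu> / ?G \<mu>"
  define L where "L = d_g_xx \<mu> \<mu> / ?G \<mu>"
  note dg = d_g_VV_same[OF ne] d_g_VV_cross[OF ne] d_g_VV_cross'[OF ne] d_g_VV_other[OF ne]
    d_g_VV_same[OF ne'(2)] d_g_VV_cross[OF ne'(2)] d_g_VV_cross'[OF ne'(2)] d_g_VV_other[OF ne'(2)]
  have secs: "sectional \<nu> \<mu> p = ?k" using ne by (simp add: sectional_def K_sym)
  have D1: "dir_deriv (?x \<mu>) (\<lambda>q. curv q (?x \<nu>) (V \<mu>) (?x \<nu>) (V \<mu>)) p
      = r * (log_slope p \<mu> \<nu> * ?k + dir_deriv (?x \<mu>) (K \<mu> \<nu>) p - ?k * L)"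
    by (simp add: r_def L_def dir_deriv_curv_diag dir_deriv_K_ratio[OF ne] d_psi_def)
  have B1: "curv p (?x \<nu>) (V \<mu>) (\<Gamma> (?x \<mu>) (?x \<nu>)) (V \<mu>) = log_slope p \<mu> \<nu> / 2 * r * ?k"
    unfolding conn_V(1)
    by (rule sum_single[where \<mu> = \<nu>]) (use ne' in \<open>auto simp: r_def L_def curv_frame \<Gamma>_xx d_g_xx_other secs\<close>)
  have C1: "curv p (?x \<nu>) (V \<mu>) (?x \<nu>) (\<Gamma> (?x \<mu>) (V \<mu>)) = - L / 2 * r * ?k"
    unfolding conn_V(3)
    by (rule sum_single[where \<mu> = \<mu>])
       (use ne' in \<open>auto simp: r_def L_def curv_frame dg secs power2_eq_square\<close>)
  have D2: "dir_deriv (?x \<nu>) (\<lambda>q. curv q (?x \<mu>) (V \<mu>) (?x \<nu>) (V \<mu>)) p = 0"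
    using ne' by (simp add: dir_deriv_curv_off d_psi_def)
  have B2: "curv p (?x \<mu>) (V \<mu>) (\<Gamma> (?x \<nu>) (?x \<nu>)) (V \<mu>) = - log_slope p \<mu> \<nu> / 2 * r * ?s"
    unfolding conn_V(1)
    by (rule sum_single[where \<mu> = \<mu>]) (use ne' in \<open>auto simp: r_def L_def curv_frame \<Gamma>_xx d_g_xx_other\<close>)
  have C2: "curv p (?x \<mu>) (V \<mu>) (?x \<nu>) (\<Gamma> (?x \<nu>) (V \<mu>)) = log_slope p \<nu> \<mu> * r * ?o"
    unfolding conn_V(3)
    by (rule sum_single[where \<mu> = \<nu>]) (use ne' in \<open>auto simp: r_def L_def curv_frame dg\<close>)
  have D3: "dir_deriv (V \<mu>) (\<lambda>q. curv q (?x \<mu>) (?x \<nu>) (?x \<nu>) (V \<mu>)) p = 0"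
    by (rule dir_deriv_vertical_curv)
  have B3: "curv p (?x \<mu>) (?x \<nu>) (\<Gamma> (V \<mu>) (?x \<nu>)) (V \<mu>) = - log_slope p \<nu> \<mu> / 2 * r * ?o"
    unfolding conn_x(2)
    by (rule sum_single[where \<mu> = \<nu>]) (use ne' in \<open>auto simp: r_def L_def curv_frame dg\<close>)
  have C3: "curv p (?x \<mu>) (?x \<nu>) (?x \<nu>) (\<Gamma> (V \<mu>) (V \<mu>)) = - L / 2 * r * ?k"
    unfolding conn_x(4)
    by (rule sum_single[where \<mu> = \<mu>])
       (use ne' in \<open>auto simp: r_def L_def curv_frame dg power2_eq_square mult_ac\<close>)
  have "r * (dir_deriv (?x \<mu>) (K \<mu> \<nu>) p + log_slope p \<mu> \<nu> / 2 * (?k - ?s) + 3/2 * log_slope p \<nu> \<mu> * ?o) = 0"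
    using curv_bianchi_cyclic[of "?x \<mu>" "?x \<nu>" "V \<mu>" "?x \<nu>" "V \<mu>"]
    unfolding curv_bianchi_term_def curv_anti[OF S(2), of "V \<mu>" "?x \<mu>"] dir_deriv_anti[of _ "V \<mu>" "?x \<mu>"]
      D1 B1 C1 D2 B2 C2 D3 B3 C3
    by (simp add: algebra_simps)
  then show ?thesis by (simp add: r_def)
qed

lemma bianchi_Omega:
  assumes ne: "\<mu> \<noteq> \<nu>"
  shows "dir_deriv (coord_vec \<mu>) (\<Omega> \<mu> \<nu>) p + 3/2 * log_slope p \<mu> \<nu> * \<Omega> \<mu> \<nu> p
       + log_slope p \<nu> \<mu> / 2 * (K \<mu> \<nu> p - sectional \<mu> \<mu> p) = 0"
proof -
  note ne' = ne ne[symmetric]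
  let ?x = "coord_vec :: 'n \<Rightarrow> real^('n + 'm)" and ?G = "\<lambda>\<kappa>. g_xx X \<kappa> p"
  let ?k = "K \<mu> \<nu> p" and ?o = "\<Omega> \<mu> \<nu> p" and ?s = "sectional \<mu> \<mu> p"
  define L where "L = d_g_xx \<mu> \<mu> / ?G \<mu>"
  note dg = d_g_VV_same[OF ne] d_g_VV_cross[OF ne] d_g_VV_cross'[OF ne] d_g_VV_other[OF ne]
    d_g_VV_same[OF ne'(2)] d_g_VV_cross[OF ne'(2)] d_g_VV_cross'[OF ne'(2)] d_g_VV_other[OF ne'(2)]
  have O: "\<Omega> \<nu> \<mu> p = ?o" by (rule Omega_sym[OF S(2)])
  have secs: "sectional \<nu> \<mu> p = ?k" "sectional \<mu> \<nu> p = ?k" using ne by (auto simp: sectional_def K_sym)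
  have D1: "dir_deriv (?x \<mu>) (\<lambda>q. curv q (?x \<nu>) (V \<mu>) (?x \<mu>) (V \<nu>)) p
      = - dir_deriv (?x \<mu>) (\<Omega> \<mu> \<nu>) p - log_slope p \<mu> \<nu> * ?o"
  proof -
    have "dir_deriv (?x \<mu>) (\<Omega> \<nu> \<mu>) p = dir_deriv (?x \<mu>) (\<Omega> \<mu> \<nu>) p"
      by (rule dir_deriv_local_cong[OF S Omega_sym])
    then show ?thesis using ne' by (simp add: dir_deriv_curv_off d_psi_def O)
  qed
  have B1: "curv p (?x \<nu>) (V \<mu>) (\<Gamma> (?x \<mu>) (?x \<mu>)) (V \<nu>) = - L / 2 * ?o"
    unfolding conn_V(1)
  proof (rule sum_single[where \<mu> = \<mu>])
    fix \<kappa> assume "\<kappa> \<noteq> \<mu>"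
    then show "\<Gamma> (?x \<mu>) (?x \<mu>) $ Inl \<kappa> * curv p (?x \<nu>) (V \<mu>) (?x \<kappa>) (V \<nu>) = 0"
      using ne' by (cases "\<kappa> = \<nu>") (auto simp: L_def curv_frame)
  qed (use ne' in \<open>auto simp: L_def curv_frame \<Gamma>_xx O\<close>)
  have C1: "curv p (?x \<nu>) (V \<mu>) (?x \<mu>) (\<Gamma> (?x \<mu>) (V \<nu>)) = - log_slope p \<mu> \<nu> / 2 * ?o"
    unfolding conn_V(3)
    by (rule sum_single[where \<mu> = \<nu>]) (use ne' in \<open>auto simp: L_def curv_frame dg O\<close>)
  have D2: "dir_deriv (?x \<nu>) (\<lambda>q. curv q (?x \<mu>) (V \<mu>) (?x \<mu>) (V \<nu>)) p = - log_slope p \<nu> \<mu> * ?s"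
    using ne' by (simp add: dir_deriv_curv_diag d_psi_def)
  have B2: "curv p (?x \<mu>) (V \<mu>) (\<Gamma> (?x \<nu>) (?x \<mu>)) (V \<nu>) = - log_slope p \<mu> \<nu> * ?o"
    unfolding conn_V(1)
    by (rule sum_single[where \<mu> = \<nu>]) (use ne' in \<open>auto simp: L_def curv_frame \<Gamma>_xx d_g_xx_other\<close>)
  have C2: "curv p (?x \<mu>) (V \<mu>) (?x \<mu>) (\<Gamma> (?x \<nu>) (V \<nu>)) = - log_slope p \<nu> \<mu> / 2 * ?s"
    unfolding conn_V(3)
    by (rule sum_single[where \<mu> = \<mu>]) (use ne' in \<open>auto simp: L_def curv_frame dg\<close>)
  have D3: "dir_deriv (V \<mu>) (\<lambda>q. curv q (?x \<mu>) (?x \<nu>) (?x \<mu>) (V \<nu>)) p = 0"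
    by (rule dir_deriv_vertical_curv)
  have B3: "curv p (?x \<mu>) (?x \<nu>) (\<Gamma> (V \<mu>) (?x \<mu>)) (V \<nu>) = L / 2 * ?o"
    unfolding conn_x(2)
    by (rule sum_single[where \<mu> = \<mu>])
       (use ne' in \<open>auto simp: L_def curv_frame dg power2_eq_square mult_ac\<close>)
  have C3: "curv p (?x \<mu>) (?x \<nu>) (?x \<mu>) (\<Gamma> (V \<mu>) (V \<nu>)) = log_slope p \<nu> \<mu> / 2 * ?k"
    unfolding conn_x(4)
    by (rule sum_single[where \<mu> = \<nu>]) (use ne' in \<open>auto simp: L_def curv_frame dg\<close>)
  show ?thesis
    using curv_bianchi_cyclic[of "?x \<mu>" "?x \<nu>" "V \<mu>" "?x \<mu>" "V \<nu>"]
    unfolding curv_bianchi_term_def curv_anti[OF S(2), of "V \<mu>" "?x \<mu>"] dir_deriv_anti[of _ "V \<mu>" "?x \<mu>"]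
      D1 B1 C1 D2 B2 C2 D3 B3 C3
    by (simp add: algebra_simps)
qed

text \<open>
  The quotients for \<open>K\<close> and \<open>\<Omega>\<close> can be inverted: \<open>d\<^sub>\<mu> = x\<^sub>\<mu> K + x\<^sub>\<nu> \<Omega>\<close> and \<open>d\<^sub>\<nu> = x\<^sub>\<nu> K + x\<^sub>\<mu> \<Omega>\<close>. With these, all
  terms free of derivatives of \<open>d\<close> combine, and \<open>bianchi_K\<close>, \<open>bianchi_Omega\<close> turn into the homogeneous linear system \<open>E1\<close>, \<open>E2\<close> with
  determinant \<open>x\<^sub>\<nu>\<^sup>2 - x\<^sub>\<mu>\<^sup>2\<close>.
\<close>

lemma bianchi_consequences:
  assumes ne: "\<mu> \<noteq> \<nu>"
  shows "dir_deriv (coord_vec \<mu>) (d \<mu>) p = sectional \<mu> \<mu> p"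
    and "dir_deriv (coord_vec \<mu>) (d \<nu>) p = - 2 * \<Omega> \<mu> \<nu> p"
proof -
  let ?xm = "xc \<mu> p" and ?xn = "xc \<nu> p" and ?D = "\<lambda>f. dir_deriv (coord_vec \<mu>) f p" and ?q = "\<lambda>t::real. p + t *\<^sub>R coord_vec \<mu>"
  let ?\<Delta> = "?xm\<^sup>2 - ?xn\<^sup>2"
  have \<Delta>: "?\<Delta> \<noteq> 0" using xc_sq_distinct[OF ne] by simp
  have dx: "((\<lambda>t. xc \<kappa> (?q t)) has_real_derivative of_bool (\<kappa> = \<mu>)) (at 0)" for \<kappa>
    unfolding xc_along_x by (auto intro!: derivative_eq_intros)
  have dd: "((\<lambda>t. d \<kappa> (?q t)) has_real_derivative ?D (d \<kappa>)) (at 0)" for \<kappa>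
    by (rule differentiable_has_dir_deriv) simp
  have dsq: "((\<lambda>t. (xc \<mu> (?q t))\<^sup>2 - (xc \<nu> (?q t))\<^sup>2) has_real_derivative 2 * ?xm) (at 0)"
    using DERIV_diff[OF DERIV_power[OF dx[of \<mu>], of 2] DERIV_power[OF dx[of \<nu>], of 2]] ne by simp
  have DK: "?\<Delta> * ?D (K \<mu> \<nu>) = d \<mu> p + ?xm * ?D (d \<mu>) - ?xn * ?D (d \<nu>) - 2 * ?xm * K \<mu> \<nu> p"
  proof -
    have "?D (K \<mu> \<nu>) = (d \<mu> p + ?xm * ?D (d \<mu>) - ?xn * ?D (d \<nu>) - 2 * ?xm * K \<mu> \<nu> p) / ?\<Delta>"
      unfolding K_def
      by (rule dir_derivI, rule DERIV_cong,
          rule DERIV_quotient[OF DERIV_diff[OF DERIV_mult[OF dx dd] DERIV_mult[OF dx dd]] dsq])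
         (use \<Delta> ne in \<open>simp_all add: mult.commute\<close>)
    then show ?thesis using \<Delta> by simp
  qed
  have DO: "?\<Delta> * ?D (\<Omega> \<mu> \<nu>) = d \<nu> p + ?xm * ?D (d \<nu>) - ?xn * ?D (d \<mu>) - 2 * ?xm * \<Omega> \<mu> \<nu> p"
  proof -
    have "?D (\<Omega> \<mu> \<nu>) = ?D (\<lambda>q. (xc \<mu> q * d \<nu> q - xc \<nu> q * d \<mu> q) / ((xc \<mu> q)\<^sup>2 - (xc \<nu> q)\<^sup>2))"
      by (rule dir_deriv_local_cong[OF S Omega[OF ne]])
    also have "\<dots> = (d \<nu> p + ?xm * ?D (d \<nu>) - ?xn * ?D (d \<mu>) - 2 * ?xm * \<Omega> \<mu> \<nu> p) / ?\<Delta>"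
      unfolding Omega[OF ne S(2)]
      by (rule dir_derivI, rule DERIV_cong,
          rule DERIV_quotient[OF DERIV_diff[OF DERIV_mult[OF dx dd] DERIV_mult[OF dx dd]] dsq])
         (use \<Delta> ne in \<open>simp_all add: mult.commute\<close>)
    finally show ?thesis using \<Delta> by simp
  qed
  have k: "?\<Delta> * K \<mu> \<nu> p = ?xm * d \<mu> p - ?xn * d \<nu> p"
    using \<Delta> by (simp add: K_def)
  have o: "?\<Delta> * \<Omega> \<mu> \<nu> p = ?xm * d \<nu> p - ?xn * d \<mu> p"
    using \<Delta> by (simp add: Omega[OF ne S(2)])
  have r: "?\<Delta> * log_slope p \<mu> \<nu> = 2 * ?xm" "?\<Delta> * log_slope p \<nu> \<mu> = - 2 * ?xn"
  proof -
    have "log_slope p \<mu> \<nu> = 2 * ?xm / ?\<Delta>" "log_slope p \<nu> \<mu> = (- 2 * ?xn) / ?\<Delta>"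
      using quotient_sign[of 0 "2 * ?xn" "?xn\<^sup>2" "?xm\<^sup>2"] by (simp_all add: log_slope_def)
    then show "?\<Delta> * log_slope p \<mu> \<nu> = 2 * ?xm" "?\<Delta> * log_slope p \<nu> \<mu> = - 2 * ?xn" using \<Delta> by simp_all
  qed
  have dm: "d \<mu> p = ?xm * K \<mu> \<nu> p + ?xn * \<Omega> \<mu> \<nu> p"
  proof -
    have "?\<Delta> * d \<mu> p = ?\<Delta> * (?xm * K \<mu> \<nu> p + ?xn * \<Omega> \<mu> \<nu> p)"
      using k o by algebra
    then show ?thesis using \<Delta> by simp
  qed
  have dn: "d \<nu> p = ?xn * K \<mu> \<nu> p + ?xm * \<Omega> \<mu> \<nu> p"
  proof -
    have "?\<Delta> * d \<nu> p = ?\<Delta> * (?xn * K \<mu> \<nu> p + ?xm * \<Omega> \<mu> \<nu> p)"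
      using k o by algebra
    then show ?thesis using \<Delta> by simp
  qed
  let ?a = "?D (d \<mu>) - sectional \<mu> \<mu> p" and ?b = "?D (d \<nu>) + 2 * \<Omega> \<mu> \<nu> p"
  have factor: "\<delta> * u + (\<delta> * v) / 2 * w + 3/2 * (\<delta> * y) * z = \<delta> * (u + v / 2 * w + 3/2 * y * z)"
    for \<delta> u v w y z :: real by (simp add: field_simps)
  have E1: "?xm * ?a = ?xn * ?b"
  proof -
    have "?\<Delta> * ?D (K \<mu> \<nu>) + (?\<Delta> * log_slope p \<mu> \<nu>) / 2 * (K \<mu> \<nu> p - sectional \<mu> \<mu> p)
       + 3/2 * (?\<Delta> * log_slope p \<nu> \<mu>) * \<Omega> \<mu> \<nu> p = 0"
      unfolding factor bianchi_K[OF ne] by simp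
    then show ?thesis unfolding DK r using dm by (simp add: algebra_simps)
  qed
  have E2: "?xn * ?a = ?xm * ?b"
  proof -
    have "?\<Delta> * ?D (\<Omega> \<mu> \<nu>) + (?\<Delta> * log_slope p \<nu> \<mu>) / 2 * (K \<mu> \<nu> p - sectional \<mu> \<mu> p)
       + 3/2 * (?\<Delta> * log_slope p \<mu> \<nu>) * \<Omega> \<mu> \<nu> p = 0"
      unfolding factor using bianchi_Omega[OF ne] by (simp add: add_ac)
    then show ?thesis unfolding DO r using dn by (simp add: algebra_simps)
  qed
  have "?\<Delta> * ?a = 0" "?\<Delta> * ?b = 0" using E1 E2 by algebra+
  then show "?D (d \<mu>) = sectional \<mu> \<mu> p" "?D (d \<nu>) = - 2 * \<Omega> \<mu> \<nu> p" using \<Delta> by auto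
qed

end

section \<open>The theorem\<close>

theorem theorem7:
  fixes \<epsilon> :: nat
    and c :: real
    and X :: "'n::{finite,linorder} \<Rightarrow> real \<Rightarrow> real"
    and S :: "('n, 'm::{finite,linorder}) point set"
    and R :: "('n, 'm) point \<Rightarrow> ('n + 'm) cov4"
    and \<Omega> \<alpha> :: "'n \<Rightarrow> 'n \<Rightarrow> ('n, 'm) point \<Rightarrow> real"
    and \<alpha>\<epsilon> d :: "'n \<Rightarrow> ('n, 'm) point \<Rightarrow> real"
  assumes n: "CARD('n) \<ge> 2"
    and eps: "\<epsilon> \<in> {0, 1}"
    and psi: "CARD('m) = CARD('n) + \<epsilon>"
    and S: "open S"
    and adm: "\<And>p. p \<in> S \<Longrightarrow> admissible \<epsilon> c X p"
    and X_smooth: "\<And>\<mu>. smooth_on (xc \<mu> ` S) (X \<mu>)"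
    and d_smooth: "\<And>\<mu>. smooth_on S (d \<mu>)"
    and Omega_smooth: "\<And>\<mu>. smooth_on S (\<Omega> \<mu> \<mu>)"
    and riem: "\<And>p. p \<in> S \<Longrightarrow> riemann_symmetric (R p)"
    and weight: "\<And>p. p \<in> S \<Longrightarrow>
      totally_zero_weight \<epsilon> c X p (\<lambda>i j k l. complex_of_real (R p i j k l))"
    and R: "\<And>p. p \<in> S \<Longrightarrow> R p = zero_weight_tensor \<epsilon> c X \<Omega> \<alpha> \<alpha>\<epsilon> p"
    and alpha: "\<And>\<mu> \<nu> p. \<mu> \<noteq> \<nu> \<Longrightarrow> p \<in> S \<Longrightarrow>
      \<alpha> \<mu> \<nu> p = (xc \<mu> p * d \<mu> p - xc \<nu> p * d \<nu> p) / ((xc \<mu> p)\<^sup>2 - (xc \<nu> p)\<^sup>2)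
                 - real \<epsilon> * (d \<mu> p / xc \<mu> p + d \<nu> p / xc \<nu> p)"
    and Omega: "\<And>\<mu> \<nu> p. \<mu> \<noteq> \<nu> \<Longrightarrow> p \<in> S \<Longrightarrow>
      \<Omega> \<mu> \<nu> p = (xc \<mu> p * d \<nu> p - xc \<nu> p * d \<mu> p) / ((xc \<mu> p)\<^sup>2 - (xc \<nu> p)\<^sup>2)"
    and alpha_eps: "\<And>\<mu> p. p \<in> S \<Longrightarrow> \<alpha>\<epsilon> \<mu> p = real \<epsilon> * (d \<mu> p / xc \<mu> p)"
    and bianchi: "second_bianchi (kerr_metric \<epsilon> c X) R S"
  shows "\<forall>p\<in>S. \<forall>\<mu> \<nu>. \<mu> \<noteq> \<nu> \<longrightarrow>
      \<Omega> \<mu> \<mu> p = - (1/3) * partial (Inl \<mu>) (d \<mu>) p + 2/3 * real \<epsilon> * (d \<mu> p / xc \<mu> p)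
    \<and> partial (Inl \<mu>) (d \<nu>) p
        = - 2 * ((xc \<mu> p * d \<nu> p - xc \<nu> p * d \<mu> p) / ((xc \<mu> p)\<^sup>2 - (xc \<nu> p)\<^sup>2))"
proof (intro ballI allI impI)
  fix p :: "('n, 'm) point" and \<mu> \<nu> :: 'n
  assume p: "p \<in> S" and ne: "\<mu> \<noteq> \<nu>"
  interpret kp: kerr_point \<epsilon> c X p
    using eps psi adm[OF p] smooth_on_differentiable[OF X_smooth] p by unfold_locales auto
  obtain V Z where VZ: "\<And>\<sigma>. vertical (V \<sigma>)" "vertical Z"
    "\<And>\<sigma> \<tau>. contract1 (psi_form \<tau> p) (V \<sigma>) = of_bool (\<tau> = \<sigma>)" "\<And>\<tau>. contract1 (psi_form \<tau> p) Z = 0"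
    "\<And>\<sigma>. real \<epsilon> * contract1 (psi_form0 p) (V \<sigma>) = 0" "real \<epsilon> * contract1 (psi_form0 p) Z = real \<epsilon>"
    using kp.dual_frame_exists by metis
  interpret kerr_bianchi \<epsilon> c X p V Z S R \<Omega> \<alpha> \<alpha>\<epsilon> d
    by unfold_locales
       (use VZ S p adm R alpha Omega alpha_eps bianchi smooth_on_differentiable[OF d_smooth p]
         smooth_on_differentiable[OF Omega_smooth p] in auto)
  have p\<mu>: "partial (Inl \<mu>) f p = dir_deriv (coord_vec \<mu>) f p" for f
    by (simp add: partial_def coord_vec_def)
  show "\<Omega> \<mu> \<mu> p = - (1/3) * partial (Inl \<mu>) (d \<mu>) p + 2/3 * real \<epsilon> * (d \<mu> p / xc \<mu> p)
    \<and> partial (Inl \<mu>) (d \<nu>) p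
        = - 2 * ((xc \<mu> p * d \<nu> p - xc \<nu> p * d \<mu> p) / ((xc \<mu> p)\<^sup>2 - (xc \<nu> p)\<^sup>2))"
    using bianchi_consequences[OF ne] unfolding p\<mu>
    by (simp add: sectional_def alpha_eps[OF p] Omega[OF ne p] diff_divide_distrib)
qed

end
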